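(* Let $q$ be an odd prime power, $N_0=\mathbb{F}_q^2$, $H_0=SO_2(\mathbb{F}_q)=\left\{\begin{pmatrix}a&-b\\ b&a\end{pmatrix}: a^2+b^2=1\right\}$, and $G_0=\{(z,h):z\in N_0,h\in H_0\}$ with multiplication $(z_1,h_1)(z_2,h_2)=(z_1+h_1z_2,h_1h_2)$, acting on $\mathbb{F}_q^2$ by $(z,h)x=z+hx$. For $x=(x_1,x_2),y=(y_1,y_2)\in\mathbb{F}_q^2$ put $\|x-y\|=(x_1-y_1)^2+(x_2-y_2)^2$. Let $\alpha\in(3/2,2)$, let $E\subseteq\mathbb{F}_q^2$ with $|E|=q^\alpha$, let $t\in\mathbb{F}_q^*$, and fix $(u_0,v_0)\in E\times E$ with $\|u_0-v_0\|=t$. Let $X_t$ be the set of all $g\in G_0$ such that $gx=u_0$ and $gy=v_0$ for some $(x,y)\in E\times E$ with $\|x-y\|=t$. Then there exists $\delta=\delta(\alpha)>0$ such that $|X_tX_t|\gg|X_t|^{1+\delta}$; moreover \[ |X_tX_t|\gg\min\left\{q|E|,\ \frac{|E|^4}{q^4}\right\}. \]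
   Context: $X_tX_t=\{gh:g,h\in X_t\}$. The notation $\gg$ is asymptotic as $q\to\infty$: $A\gg B$ means $A\ge cB$ for some constant $c>0$ (depending at most on $\alpha$) for all sufficiently large $q$. *)

theory Defs
  imports Complex_Main "HOL-Algebra.Algebra"
begin

text \<open>
  The implied constants must be chosen before the finite field is. Fields are therefore
  ring records, whose carriers are sets, and not types of class \<open>field\<close>, over which one
  cannot quantify inside a formula. For any infinite type \<open>'a\<close>, for instance \<open>nat\<close>, every
  finite field is isomorphic to some \<open>F :: 'a ring\<close>; so a bound that holds with one constant
  for all \<open>F :: 'a ring\<close> is uniform over all finite fields.
\<close>

type_synonym 'a vec2 = "'a \<times> 'a"

text \<open>A 2 x 2 matrix is the pair of its rows.\<close>

type_synonym 'a mat2 = "'a vec2 \<times> 'a vec2"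

definition plane :: "('a, 'm) ring_scheme \<Rightarrow> 'a vec2 set" where
  "plane F = carrier F \<times> carrier F"

fun vec_add :: "('a, 'm) ring_scheme \<Rightarrow> 'a vec2 \<Rightarrow> 'a vec2 \<Rightarrow> 'a vec2" where
  "vec_add F (x1, x2) (y1, y2) = (x1 \<oplus>\<^bsub>F\<^esub> y1, x2 \<oplus>\<^bsub>F\<^esub> y2)"

fun mat_vec :: "('a, 'm) ring_scheme \<Rightarrow> 'a mat2 \<Rightarrow> 'a vec2 \<Rightarrow> 'a vec2" where
  "mat_vec F ((a, b), (c, d)) (x1, x2) =
     (a \<otimes>\<^bsub>F\<^esub> x1 \<oplus>\<^bsub>F\<^esub> b \<otimes>\<^bsub>F\<^esub> x2, c \<otimes>\<^bsub>F\<^esub> x1 \<oplus>\<^bsub>F\<^esub> d \<otimes>\<^bsub>F\<^esub> x2)"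

fun mat_mult :: "('a, 'm) ring_scheme \<Rightarrow> 'a mat2 \<Rightarrow> 'a mat2 \<Rightarrow> 'a mat2" where
  "mat_mult F ((a, b), (c, d)) ((a', b'), (c', d')) =
     ((a \<otimes>\<^bsub>F\<^esub> a' \<oplus>\<^bsub>F\<^esub> b \<otimes>\<^bsub>F\<^esub> c', a \<otimes>\<^bsub>F\<^esub> b' \<oplus>\<^bsub>F\<^esub> b \<otimes>\<^bsub>F\<^esub> d'),
      (c \<otimes>\<^bsub>F\<^esub> a' \<oplus>\<^bsub>F\<^esub> d \<otimes>\<^bsub>F\<^esub> c', c \<otimes>\<^bsub>F\<^esub> b' \<oplus>\<^bsub>F\<^esub> d \<otimes>\<^bsub>F\<^esub> d'))"

definition SO2 :: "('a, 'm) ring_scheme \<Rightarrow> 'a mat2 set" where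
  "SO2 F = {((a, \<ominus>\<^bsub>F\<^esub> b), (b, a)) | a b. a \<in> carrier F \<and> b \<in> carrier F \<and>
     a [^]\<^bsub>F\<^esub> (2::nat) \<oplus>\<^bsub>F\<^esub> b [^]\<^bsub>F\<^esub> (2::nat) = \<one>\<^bsub>F\<^esub>}"

definition rigid_motions :: "('a, 'm) ring_scheme \<Rightarrow> ('a vec2 \<times> 'a mat2) monoid" where
  "rigid_motions F =
     \<lparr> carrier = plane F \<times> SO2 F,
       monoid.mult = (\<lambda>(z1, h1) (z2, h2). (vec_add F z1 (mat_vec F h1 z2), mat_mult F h1 h2)),
       monoid.one = ((\<zero>\<^bsub>F\<^esub>, \<zero>\<^bsub>F\<^esub>), ((\<one>\<^bsub>F\<^esub>, \<zero>\<^bsub>F\<^esub>), (\<zero>\<^bsub>F\<^esub>, \<one>\<^bsub>F\<^esub>))) \<rparr>"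

fun act :: "('a, 'm) ring_scheme \<Rightarrow> 'a vec2 \<times> 'a mat2 \<Rightarrow> 'a vec2 \<Rightarrow> 'a vec2" where
  "act F (z, h) x = vec_add F z (mat_vec F h x)"

fun qdist :: "('a, 'm) ring_scheme \<Rightarrow> 'a vec2 \<Rightarrow> 'a vec2 \<Rightarrow> 'a" where
  "qdist F (x1, x2) (y1, y2) =
     (x1 \<ominus>\<^bsub>F\<^esub> y1) [^]\<^bsub>F\<^esub> (2::nat) \<oplus>\<^bsub>F\<^esub> (x2 \<ominus>\<^bsub>F\<^esub> y2) [^]\<^bsub>F\<^esub> (2::nat)"

definition motion_set ::
  "('a, 'm) ring_scheme \<Rightarrow> 'a vec2 set \<Rightarrow> 'a \<Rightarrow> 'a vec2 \<Rightarrow> 'a vec2 \<Rightarrow> ('a vec2 \<times> 'a mat2) set" where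
  "motion_set F E t u0 v0 =
     {g \<in> carrier (rigid_motions F).
        \<exists>x\<in>E. \<exists>y\<in>E. qdist F x y = t \<and> act F g x = u0 \<and> act F g y = v0}"

end

theory Submission
  imports Defs "HOL-Algebra.Algebraic_Closure_Type" "HOL-Number_Theory.Residues" "HOL-Analysis.Convex"
begin

text \<open>
  Since \<open>H\<^sub>0\<close> acts simply transitively on circles of nonzero radius, \<open>X\<^sub>t\<close> is in bijection with the pairs in
  \<open>E \<times> E\<close> at distance \<open>t\<close>. The Fourier transform of a circle is a Kloosterman sum, so Weil's bound gives
  \<open>|X\<^sub>t| = |E|\<^sup>2 / q + O(q\<^sup>1\<^sup>/\<^sup>2 |E|)\<close>. The multiplicative energy of a set \<open>A \<subseteq> G\<^sub>0\<close> whose fibres over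
  \<open>H\<^sub>0\<close> have at most \<open>K\<close> points is at most \<open>|A|\<^sup>3 K / q\<^sup>2 + q\<^sup>2 |A|\<^sup>2\<close>: the first term comes from the zero
  frequency of the translation part, the second from the other frequencies, on which \<open>H\<^sub>0\<close> acts freely.
  For \<open>A = X\<^sub>t\<close> one has \<open>K \<le> |E|\<close>, and Cauchy-Schwarz gives the growth of \<open>X\<^sub>t X\<^sub>t\<close>.

  Weil's bound is proved as follows. If \<open>K\<^sub>n\<close> is the Kloosterman sum over the field with \<open>p\<^sup>n\<close> elements, then
  \<open>K\<^sub>2\<^sub>n = 2 p\<^sup>n - K\<^sub>n\<^sup>2\<close>, so a violation of \<open>|K\<^sub>n| \<le> 2 p\<^sup>n\<^sup>/\<^sup>2\<close> would be amplified by repeated doubling of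
  \<open>n\<close>. For even \<open>n\<close>, Stepanov's method gives \<open>|K\<^sub>n| \<le> C p\<^sup>n\<^sup>/\<^sup>2\<close> with a constant depending only on \<open>p\<close>.
\<close>

hide_const (open) Polynomials.degree up_ring.coeff up_ring.monom Polynomial.order Divisibility.prime

text \<open>The condition \<alpha> > 3/2 enters twice: it makes the error q^(1/2) |E| small against
  |E|^2 / q, and it makes 4 \<alpha> - 4 exceed 2 \<alpha> - 1, the exponent of |X_t|. The condition
  \<alpha> < 2 does the latter for the exponent 1 + \<alpha>. Stepanov's method counts points where
  a polynomial takes a given quadratic character, and a Kloosterman sum is not such a count. With s
  = x + b/x it becomes a sum of the quadratic character of s^2 - 4 b against an additive character.
  The latter does not change under s -> s + y^p - y, so averaging over y leaves quadratic character
  sums of (y^p - y + c)^2 - 4 b. The degree 2 p of this polynomial is why the constant depends on p,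
  and why the doubling of n is needed to remove it. Fields of square order q^2 are used because
  there q-th powers can replace derivatives. For the energy bound, the plane is treated as F[i] with
  i^2 = -1. This ring may have zero divisors, so the circle's free action has to be checked on
  isotropic frequencies as well.\<close>

section \<open>Linear systems and polynomials in two variables\<close>

lemma underdetermined_system_solution:
  fixes f :: "'j \<Rightarrow> nat \<Rightarrow> 'a::field"
  assumes "finite J" "M < card J"
  shows "\<exists>c. (\<exists>j\<in>J. c j \<noteq> 0) \<and> (\<forall>m<M. (\<Sum>j\<in>J. c j * f j m) = 0)"
  using assms
proof (induction M arbitrary: J f)
  case 0
  then obtain j where "j \<in> J" by fastforce
  then show ?case by (intro exI[of _ "\<lambda>_. 1"]) auto
next
  case (Suc M)
  show ?case
  proof (cases "\<forall>j\<in>J. f j M = 0")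
    case True
    from Suc.IH[of J f] Suc.prems obtain c where
      c: "\<exists>j\<in>J. c j \<noteq> 0" "\<forall>m<M. (\<Sum>j\<in>J. c j * f j m) = 0" by auto
    from True have "(\<Sum>j\<in>J. c j * f j M) = 0" by simp
    with c show ?thesis by (metis less_antisym)
  next
    case False
    then obtain k where k: "k \<in> J" "f k M \<noteq> 0" by auto
    define J' where "J' = J - {k}"
    have J': "finite J'" "M < card J'" "k \<notin> J'" "J = insert k J'"
      using Suc.prems k by (auto simp: J'_def)
    from Suc.IH[of J' "\<lambda>j m. f j m - f j M / f k M * f k m"] J' obtain c where
      c: "\<exists>j\<in>J'. c j \<noteq> 0" "\<forall>m<M. (\<Sum>j\<in>J'. c j * (f j m - f j M / f k M * f k m)) = 0" by auto
    define s where "s = (\<Sum>j\<in>J'. c j * f j M / f k M)"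
    have *: "(\<Sum>j\<in>J. (c(k := - s)) j * f j m) = (\<Sum>j\<in>J'. c j * (f j m - f j M / f k M * f k m))" for m
    proof -
      have "(\<Sum>j\<in>J. (c(k := - s)) j * f j m) = - s * f k m + (\<Sum>j\<in>J'. (c(k := - s)) j * f j m)"
        using J' by simp
      also have "(\<Sum>j\<in>J'. (c(k := - s)) j * f j m) = (\<Sum>j\<in>J'. c j * f j m)"
        using J' by (intro sum.cong) auto
      finally show ?thesis
        by (simp add: s_def algebra_simps sum_subtractf sum_distrib_left sum_distrib_right)
    qed
    have "(\<Sum>j\<in>J'. c j * (f j M - f j M / f k M * f k M)) = 0"
      using k by simp
    with c(2) have "\<forall>m<Suc M. (\<Sum>j\<in>J. (c(k := - s)) j * f j m) = 0"
      unfolding * by (metis less_antisym)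
    moreover have "\<exists>j\<in>J. (c(k := - s)) j \<noteq> 0"
      using c(1) J' by auto
    ultimately show ?thesis by blast
  qed
qed

text \<open>Setting Y = X^n in a polynomial in Y whose coefficients have degree below n in X is a
  base-n expansion: the terms occupy disjoint blocks of exponents, so nothing can cancel. The
  induction splits off the lowest digit.\<close>

lemma poly_monom_eq_0_imp_eq_0:
  fixes R :: "'a::field poly poly"
  assumes "\<And>i. degree (coeff R i) < n" "poly R (monom 1 n) = 0"
  shows "R = 0"
  using assms
proof (induction R)
  case (pCons r R)
  have r: "degree r < n" using pCons.prems(1)[of 0] by simp
  have R: "degree (coeff R i) < n" for i using pCons.prems(1)[of "Suc i"] by simp
  have eq: "r = - (monom 1 n * poly R (monom 1 n))"
    using pCons.prems(2) by (simp add: eq_neg_iff_add_eq_0)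
  have "poly R (monom 1 n) = 0"
  proof (rule ccontr)
    assume "poly R (monom 1 n) \<noteq> 0"
    hence "degree r \<ge> n"
      by (subst eq) (simp add: degree_mult_eq degree_monom_eq)
    with r show False by simp
  qed
  with pCons.IH R eq show ?case by simp
qed simp

lemma degree_coeff_mult_le:
  fixes P Q :: "'a::comm_ring_1 poly poly"
  assumes "\<And>i. degree (coeff P i) \<le> m" "\<And>i. degree (coeff Q i) \<le> n"
  shows "degree (coeff (P * Q) i) \<le> m + n"
  unfolding coeff_mult
  by (intro degree_sum_le) (auto intro!: order.trans[OF degree_mult_le] add_mono assms)

lemma degree_poly_const_le:
  fixes P :: "'a::comm_ring_1 poly poly"
  assumes "\<And>i. degree (coeff P i) \<le> n"
  shows "degree (poly P [:z:]) \<le> n"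
  unfolding poly_altdef
  by (intro degree_sum_le)
     (auto intro!: order.trans[OF degree_mult_le] order.trans[OF add_mono[OF assms degree_power_le]])

lemma infinite_UNIV_alg_closed: "infinite (UNIV :: 'a::alg_closed_field set)"
proof
  assume fin: "finite (UNIV :: 'a set)"
  define P where "P = (\<Prod>a\<in>(UNIV::'a set). [:- a, 1:]) + 1"
  have "poly P x = 1" for x :: 'a
    using fin by (auto simp: P_def poly_prod)
  moreover have "degree (\<Prod>a\<in>(UNIV::'a set). [:- a, 1:]) > 0"
    using fin by (subst degree_prod_eq_sum_degree) (auto simp: card_gt_0_iff)
  hence "degree P > 0" unfolding P_def by (subst degree_add_eq_left) auto
  then obtain x where "poly P x = 0" using alg_closed_imp_poly_has_root by blast
  ultimately show False by simp
qed

text \<open>A nonzero polynomial in Y over K[X] has finitely many roots in K[X], while there are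
  infinitely many constants z. It serves to specialise Y and return to one variable.\<close>

lemma poly_poly_const_neq_0:
  fixes P :: "'a::alg_closed_field poly poly"
  assumes "P \<noteq> 0"
  obtains z where "poly P [:z:] \<noteq> 0"
proof -
  have "\<not> range (\<lambda>z. [:z:]) \<subseteq> {x. poly P x = 0}"
    using poly_roots_finite[OF assms] infinite_UNIV_alg_closed[where 'a='a]
    by (metis (no_types, lifting) finite_imageD finite_subset injI pCons_eq_iff)
  with that show ?thesis by auto
qed

section \<open>Stepanov's method\<close>

text \<open>Frobenius is additive. In the two-variable form F^q depends on Y = X^q alone, so it
  contributes nothing to the degree in X that the digit argument has to keep below q.\<close>

lemma power_power_poly_eq:
  fixes F :: "'a::field poly"
  assumes "prime CHAR('a)" "q = CHAR('a) ^ \<nu>"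
  shows "F ^ q = poly (map_poly (\<lambda>c. [:c ^ q:]) F) (monom 1 q)"
proof -
  have q: "q > 0" using assms by (simp add: prime_gt_0_nat)
  have "F ^ q = (\<Sum>i\<le>degree F. monom (coeff F i) i) ^ q"
    by (simp add: poly_as_sum_of_monoms)
  also have "\<dots> = (\<Sum>i\<le>degree F. monom (coeff F i) i ^ q)"
    using assms by (intro freshmans_dream_sum'[where n=\<nu>]) auto
  also have "\<dots> = (\<Sum>i\<le>degree F. [:coeff F i ^ q:] * monom 1 q ^ i)"
    by (intro sum.cong) (auto simp: monom_power smult_monom mult.commute)
  also have "\<dots> = poly (map_poly (\<lambda>c. [:c ^ q:]) F) (monom 1 q)"
    using q by (subst poly_altdef) (simp add: coeff_map_poly degree_map_poly)
  finally show ?thesis .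
qed

text \<open>
  Stepanov's method without derivatives: at the points counted below \<open>y ^ q\<^sup>2 = y\<close> and
  \<open>g ^ q = \<epsilon> / g\<close>, so that the \<open>q\<close>-th power of \<open>G = U + g * V\<close> is a combination of few monomials
  \<open>y ^ (a * q + i)\<close>. Its coefficients are chosen so that this combination vanishes identically.
\<close>
lemma stepanov_bound:
  fixes F :: "'a::alg_closed_field poly" and q s d :: nat
  assumes char: "prime CHAR('a)" and q: "q = CHAR('a) ^ \<nu>" and qs: "q = 2 * s + 1"
    and deg: "degree F = 2 * d" and r: "odd (Polynomial.order r F)" and d: "4 * d \<le> q"
    and F0: "F \<noteq> 0" and \<epsilon>: "\<epsilon> \<noteq> 0"
  shows "card {y. y ^ q\<^sup>2 = y \<and> poly F y ^ ((q\<^sup>2 - 1) div 2) = \<epsilon>} \<le> q * (s + 3 * d)"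
proof -
  have "Polynomial.order r F \<noteq> 0" using r by (metis even_zero)
  hence "degree F > 0" using F0 order_degree[of F r] by linarith
  hence d0: "d > 0" using deg by simp
  have s0: "s > 0" "2 * d \<le> s" using d qs d0 by linarith+
  \<comment> \<open>\<open>A\<close> and \<open>I\<close> are strict bounds for the exponents of X
    and of Y = X^q in the auxiliary polynomials. With exponents of X up to s - d, two such factors
    times F have degree at most 2 s < q in X, as the proof of \<open>G0\<close> requires.
    \<open>M\<close> is one more than the degree bound for \<open>H\<close> below, hence the number
    of equations; \<open>I\<close> makes the 2 A I unknowns exceed it by d (2 s + 3 - 4 d).\<close>
  define A I M where "A = s + 1 - d" and "I = s + 2 * d" and "M = 2*s*s + 2 * s + d"
  \<comment> \<open>At the counted points g^(q + 1) = \<epsilon>, because (q^2 - 1) / 2 = s (q +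
    1).\<close>
  define g where "g = F ^ s"
  have g0: "g \<noteq> 0" using F0 by (simp add: g_def)
  have deg_g: "degree g = 2 * d * s" by (simp add: g_def degree_power_eq F0 deg)
  define J where "J = (UNIV :: bool set) \<times> {..<A} \<times> {..<I}"
  have sumJ: "(\<Sum>j\<in>J. h j) = (\<Sum>i<I. \<Sum>a<A. h (False, a, i)) + (\<Sum>i<I. \<Sum>a<A. h (True, a, i))"
    for h :: "_ \<Rightarrow> 'a"
  proof -
    have "(\<Sum>j\<in>J. h j) = (\<Sum>b\<in>UNIV. \<Sum>a<A. \<Sum>i<I. h (b, a, i))"
      by (simp add: J_def sum.cartesian_product)
    thus ?thesis by (simp add: UNIV_bool sum.swap[of _ "{..<I}"] sum.distrib add.commute)
  qed
  \<comment> \<open>The system expresses that g G^q, as reduced at the counted points, is the zero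
    polynomial \<open>H\<close>. The part \<open>False\<close> keeps its factor g; in the part
    \<open>True\<close> the product g g^q has become \<epsilon>.\<close>
  define f where "f = (\<lambda>(b, a, i) m. coeff (if b then monom \<epsilon> (a * q + i) else g * monom 1 (a * q + i)) m)"
  have cardJ: "card J = 2 * A * I" by (simp add: J_def card_cartesian_product)
  have "M < card J"
  proof -
    obtain e where e: "s = 2 * d + e" using s0 by (metis le_Suc_ex)
    show ?thesis unfolding cardJ M_def A_def I_def e using d0
      by (cases d) (auto simp: algebra_simps)
  qed
  with underdetermined_system_solution[of J M f] obtain c where
    c: "\<exists>j\<in>J. c j \<noteq> 0" "\<forall>m<M. (\<Sum>j\<in>J. c j * f j m) = 0" by (auto simp: J_def)
  have q0: "q > 0" using qs by simp
  \<comment> \<open>Raising to the q-th power also raises the coefficients, so the auxiliary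
    polynomials get q-th roots of the solution c as coefficients. \<open>W b\<close> is the form in
    X and Y, and \<open>w b\<close> its value at Y = X^q.\<close>
  then obtain rt :: "'a \<Rightarrow> 'a" where rt: "\<And>x. rt x ^ q = x"
    using nth_root_exists[of q] by metis
  define W where "W = (\<lambda>b. \<Sum>i<I. monom (\<Sum>a<A. monom (rt (c (b, a, i))) a) i :: 'a poly poly)"
  have coeff_W: "coeff (W b) i = (if i < I then \<Sum>a<A. monom (rt (c (b, a, i))) a else 0)" for b i
    by (simp add: W_def coeff_sum)
  have deg_W: "degree (coeff (W b) i) \<le> s - d" for b i
    unfolding coeff_W A_def using s0
    by (auto intro!: degree_sum_le order.trans[OF degree_monom_le])
  define w where "w = (\<lambda>b. poly (W b) (monom 1 q))"
  have w_eq: "w b = (\<Sum>i<I. \<Sum>a<A. monom (rt (c (b, a, i))) (a + i * q))" for b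
    by (simp add: w_def W_def poly_sum poly_monom monom_power sum_distrib_right mult_monom mult.commute[of q])
  have deg_w: "degree (w b) \<le> s - d + (I - 1) * q" for b
    unfolding w_eq A_def using s0
    by (intro degree_sum_le order.trans[OF degree_monom_le] add_mono mult_right_mono) auto
  define G where "G = w False + g * w True"
  have deg_G: "degree G < q * (s + 3 * d)"
  proof -
    have "degree G \<le> 2 * d * s + (s - d + (I - 1) * q)"
      unfolding G_def using deg_w
      by (intro degree_add_le) (auto intro!: order.trans[OF degree_mult_le] simp: deg_g add_increasing trans_le_add2)
    also have "\<dots> < q * (s + 3 * d)"
    proof -
      obtain e where e: "s = 2 * d + e" using s0 by (metis le_Suc_ex)
      show ?thesis unfolding I_def qs e using d0 by (cases d) (auto simp: algebra_simps)
    qed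
    finally show ?thesis .
  qed
  \<comment> \<open>Since F g^2 = F^q, G = 0 would give F U^2 = F^q V^2 for the two parts U, V. The
    digit argument lifts this to an identity in X and Y, in which F^q depends on Y alone. At a
    constant Y = z it reads F u^2 = const v^2, which the odd order of F at r forbids.\<close>
  have G0: "G \<noteq> 0"
  proof
    assume "G = 0"
    hence "w False = - (g * w True)" by (simp add: G_def eq_neg_iff_add_eq_0)
    hence "F * (w False)\<^sup>2 = F ^ q * (w True)\<^sup>2"
      by (simp add: power_mult_distrib g_def qs power_add mult_ac flip: power_mult)
    define Fb where "Fb = map_poly (\<lambda>c. [:c ^ q:]) F"
    define R where "R = Polynomial.smult F (W False * W False) - Fb * (W True * W True)"
    have coeff_Fb: "degree (coeff Fb i) \<le> 0" for i
      using q0 by (simp add: Fb_def coeff_map_poly)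
    have Fb0: "Fb \<noteq> 0"
      using F0 q0 by (auto simp: Fb_def map_poly_eq_0_iff)
    have "poly R (monom 1 q) = 0"
      using \<open>F * (w False)\<^sup>2 = F ^ q * (w True)\<^sup>2\<close> power_power_poly_eq[OF char q, of F]
      by (simp add: R_def w_def Fb_def power2_eq_square)
    moreover have "degree (coeff R i) < q" for i
    proof -
      have 1: "degree (coeff (W b * W b) i) \<le> (s - d) + (s - d)" for b i
        by (rule degree_coeff_mult_le) (rule deg_W)+
      have "degree (coeff (Fb * (W True * W True)) i) \<le> 0 + ((s - d) + (s - d))"
        by (rule degree_coeff_mult_le) (rule coeff_Fb 1)+
      moreover have "degree (coeff (Polynomial.smult F (W False * W False)) i) \<le> 2 * d + ((s - d) + (s - d))"
        using 1[of False i] by (auto intro!: order.trans[OF degree_mult_le] simp: deg)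
      ultimately show ?thesis using s0
        unfolding R_def coeff_diff by (intro degree_diff_less) (auto simp: qs)
    qed
    ultimately have R0: "R = 0" by (intro poly_monom_eq_0_imp_eq_0)
    have "W False \<noteq> 0"
    proof
      assume W0: "W False = 0"
      with R0 Fb0 have "W True = 0" by (simp add: R_def)
      with W0 have *: "W b = 0" for b by (cases b) auto
      from c(1) obtain b a i where bai: "a < A" "i < I" "c (b, a, i) \<noteq> 0" by (auto simp: J_def)
      have "coeff (coeff (W b) i) a = rt (c (b, a, i))"
        using bai by (simp add: coeff_W coeff_sum)
      with * have "rt (c (b, a, i)) = 0" by simp
      with rt[of "c (b, a, i)"] bai q0 show False by (metis zero_power)
    qed
    then obtain z where z: "poly (W False) [:z:] \<noteq> 0" by (rule poly_poly_const_neq_0)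
    define u v k where "u = poly (W False) [:z:]" and "v = poly (W True) [:z:]" and "k = poly Fb [:z:]"
    have "poly R [:z:] = 0" using R0 by simp
    hence eq: "F * (u * u) = k * (v * v)" by (simp add: R_def u_def v_def k_def)
    have "u \<noteq> 0" using z by (simp add: u_def)
    hence nz: "k \<noteq> 0" "v \<noteq> 0" using eq F0 by auto
    have "degree k = 0" using degree_poly_const_le[OF coeff_Fb, of z] by (simp add: k_def)
    then obtain kk where "k = [:kk:]" by (rule degree_eq_zeroE)
    hence "Polynomial.order r k = 0" using nz by (intro order_0I) auto
    with arg_cong[OF eq, of "Polynomial.order r"] nz \<open>u \<noteq> 0\<close> F0
    have "Polynomial.order r F + 2 * Polynomial.order r u = 2 * Polynomial.order r v"
      by (simp add: order_mult)
    hence "even (Polynomial.order r F)" by presburger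
    with r show False by simp
  qed
  \<comment> \<open>In the q-th power the exponent (a + i q) q drops to a q + i because y^(q^2) = y.
    Multiplying by g, which is nonzero at y, then yields the value of \<open>H\<close>, and
    \<open>H\<close> vanishes identically.\<close>
  have "poly G y = 0" if y: "y ^ q\<^sup>2 = y" "poly F y ^ ((q\<^sup>2 - 1) div 2) = \<epsilon>" for y
  proof -
    have e: "(q\<^sup>2 - 1) div 2 = s * (q + 1)"
      by (simp add: qs power2_eq_square algebra_simps)
    have g\<epsilon>: "poly g y * poly g y ^ q = \<epsilon>"
    proof -
      have "poly g y * poly g y ^ q = poly F y ^ (s * (q + 1))"
        by (simp only: g_def poly_power power_mult Suc_eq_plus1[symmetric] power_Suc)
      thus ?thesis using y(2) unfolding e by simp
    qed
    hence gy: "poly g y \<noteq> 0" using \<epsilon> q0 by auto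
    have wq: "poly (w b) y ^ q = (\<Sum>i<I. \<Sum>a<A. c (b, a, i) * y ^ (a * q + i))" for b
    proof -
      have "poly (w b) y ^ q = (\<Sum>i<I. \<Sum>a<A. (rt (c (b, a, i)) * y ^ (a + i * q)) ^ q)"
        unfolding w_eq using char q by (simp add: poly_sum poly_monom freshmans_dream_sum'[where n=\<nu>])
      also have "\<dots> = (\<Sum>i<I. \<Sum>a<A. c (b, a, i) * y ^ (a * q + i))"
      proof (intro sum.cong refl)
        fix a i
        have y_eq: "y ^ ((a + i * q) * q) = y ^ (a * q) * (y ^ q\<^sup>2) ^ i"
          by (simp add: algebra_simps power_add power2_eq_square flip: power_mult)
        have "(rt (c (b, a, i)) * y ^ (a + i * q)) ^ q = rt (c (b, a, i)) ^ q * y ^ ((a + i * q) * q)"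
          by (simp only: power_mult_distrib power_mult)
        also have "\<dots> = c (b, a, i) * y ^ (a * q + i)"
          by (simp only: rt y_eq y(1) power_add)
        finally show "(rt (c (b, a, i)) * y ^ (a + i * q)) ^ q = c (b, a, i) * y ^ (a * q + i)" .
      qed
      finally show ?thesis .
    qed
    define H where "H = (\<Sum>j\<in>J. Polynomial.smult (c j)
      ((\<lambda>(b, a, i). if b then monom \<epsilon> (a * q + i) else g * monom 1 (a * q + i)) j))"
    have "H = 0"
    proof (rule poly_eqI)
      fix m
      show "coeff H m = coeff 0 m"
      proof (cases "m < M")
        case True
        with c(2) show ?thesis
          by (simp add: H_def coeff_sum f_def case_prod_unfold)
      next
        case False
        have "degree H \<le> 2 * d * s + ((s - d) * q + (I - 1))"
          unfolding H_def
        proof (intro degree_sum_le, goal_cases)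
          case (2 j)
          obtain b a i where j: "j = (b, a, i)" "a < A" "i < I" using 2 by (cases j) (auto simp: J_def)
          have "a * q + i \<le> (s - d) * q + (I - 1)"
            using j s0 by (intro add_mono mult_right_mono) (auto simp: A_def)
          hence mon: "degree (monom x (a * q + i)) \<le> (s - d) * q + (I - 1)" for x :: 'a
            using degree_monom_le order.trans by blast
          have "degree (g * monom 1 (a * q + i)) \<le> 2 * d * s + ((s - d) * q + (I - 1))"
            using degree_mult_le[of g "monom 1 (a * q + i)"] mon[of 1] deg_g by linarith
          moreover have "degree (monom \<epsilon> (a * q + i)) \<le> 2 * d * s + ((s - d) * q + (I - 1))"
            using mon by (rule trans_le_add2)
          ultimately show ?case unfolding j
            by (intro order.trans[OF degree_smult_le]) auto
        qed (auto simp: J_def)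
        also have "\<dots> < M"
        proof -
          obtain e where e: "s = 2 * d + e" using s0 by (metis le_Suc_ex)
          show ?thesis unfolding I_def M_def qs e using d0 by (cases d) (auto simp: algebra_simps)
        qed
        finally show ?thesis using False by (simp add: coeff_eq_0)
      qed
    qed
    have "poly g y * poly G y ^ q = poly g y * poly (w False) y ^ q + \<epsilon> * poly (w True) y ^ q"
      using char q by (simp add: G_def freshmans_dream'[where n=\<nu>] power_mult_distrib algebra_simps flip: g\<epsilon>)
    also have "\<dots> = poly H y"
      unfolding wq H_def poly_sum sumJ
      by (simp add: poly_monom sum_distrib_left mult_ac)
    finally show ?thesis using \<open>H = 0\<close> gy q0 by simp
  qed
  hence "{y. y ^ q\<^sup>2 = y \<and> poly F y ^ ((q\<^sup>2 - 1) div 2) = \<epsilon>} \<subseteq> {y. poly G y = 0}" by blast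
  hence "card {y. y ^ q\<^sup>2 = y \<and> poly F y ^ ((q\<^sup>2 - 1) div 2) = \<epsilon>} \<le> card {y. poly G y = 0}"
    by (intro card_mono poly_roots_finite G0)
  also have "\<dots> \<le> degree G" by (intro card_poly_roots_bound G0)
  finally show ?thesis using deg_G by linarith
qed

section \<open>Fixed fields of powers of Frobenius\<close>

text \<open>The field with p^n elements, cut out of an algebraically closed field of characteristic
  p. All finite extensions of the prime field thus live in one type and can be compared as
  sets.\<close>

definition frob_fixed :: "nat \<Rightarrow> 'a::field set" where
  "frob_fixed n = {x. x ^ (CHAR('a) ^ n) = x}"

text \<open>On \<open>frob_fixed n\<close> this is the trace to the prime field. Being defined
  everywhere, it makes the passage from n to 2 n a plain identity of sums.\<close>

definition abs_trace :: "nat \<Rightarrow> 'a::field \<Rightarrow> 'a" where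
  "abs_trace n x = (\<Sum>i<n. x ^ (CHAR('a) ^ i))"

lemma degree_monom_diff_linear:
  fixes c :: "'a::comm_ring_1"
  assumes "m > 1"
  shows "degree (monom 1 m - [:c, 1:] :: 'a poly) = m"
proof (rule antisym)
  show "degree (monom 1 m - [:c, 1:] :: 'a poly) \<le> m"
    using assms by (intro degree_diff_le) (auto simp: degree_monom_eq)
  have "coeff (monom 1 m - [:c, 1:] :: 'a poly) m = 1"
    using assms by (cases m) (auto simp: coeff_pCons split: nat.splits)
  thus "m \<le> degree (monom 1 m - [:c, 1:] :: 'a poly)"
    by (intro le_degree) auto
qed

lemma order_eq_1_if_pderiv:
  fixes P :: "'a::field poly"
  assumes "poly P r = 0" "poly (pderiv P) r \<noteq> 0"
  shows "Polynomial.order r P = 1"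
proof -
  obtain S where S: "P = [:-r, 1:] * S" using assms(1) by (meson dvdE poly_eq_0_iff_dvd)
  have "poly (pderiv P) r = poly S r"
    unfolding S pderiv_mult by (simp add: pderiv_pCons)
  hence "poly S r \<noteq> 0" using assms(2) by simp
  moreover have "P \<noteq> 0" using assms(2) by auto
  hence "Polynomial.order r P = Polynomial.order r [:-r, 1:] + Polynomial.order r S"
    unfolding S by (rule order_mult)
  ultimately show ?thesis
    using order_power_n_n[of r 1] by (simp add: order_0I)
qed

lemma card_roots_squarefree:
  fixes P :: "'a::alg_closed_field poly"
  assumes "rsquarefree P"
  shows "card {x. poly P x = 0} = degree P"
proof -
  have P0: "P \<noteq> 0" using assms by (simp add: rsquarefree_def)
  obtain A where A: "size A = degree P" "P = Polynomial.smult (lead_coeff P) (\<Prod>x\<in>#A. [:-x, 1:])"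
    using alg_closed_imp_factorization[OF P0] by auto
  have l0: "lead_coeff P \<noteq> 0" using P0 by simp
  have "poly P x = lead_coeff P * (\<Prod>y\<in>#A. x - y)" for x
    by (subst A(2)) (simp add: poly_prod_mset)
  hence roots: "{x. poly P x = 0} = set_mset A"
    using l0 by (auto simp: prod_mset_zero_iff)
  have "count A x \<le> 1" for x
  proof (rule ccontr)
    assume "\<not> count A x \<le> 1"
    hence "replicate_mset 2 x \<subseteq># A"
      by (intro mset_subset_eqI) auto
    then obtain B where "A = add_mset x (add_mset x B)"
      by (metis subset_mset.le_iff_add numeral_2_eq_2 replicate_mset_Suc replicate_mset_0 union_mset_add_mset_left add_0)
    with A(2) have "P = [:-x, 1:] ^ 2 * Polynomial.smult (lead_coeff P) (\<Prod>y\<in>#B. [:-y, 1:])"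
      by (simp only: image_mset_add_mset prod_mset.add_mset power2_eq_square mult.assoc mult_smult_right)
    hence "[:-x, 1:] ^ 2 dvd P" by (rule dvdI)
    hence "2 \<le> Polynomial.order x P"
      using P0 order_divides by blast
    with assms show False
      by (auto simp: rsquarefree_def split: if_splits) (metis One_nat_def less_numeral_extra(3) not_less_eq_eq numeral_2_eq_2 zero_le)
  qed
  hence "A = mset_set (set_mset A)"
    by (intro multiset_eqI) (metis count_mset_set(1,3) finite_set_mset le_antisym le_SucE less_one linorder_not_le not_in_iff count_greater_eq_one_iff)
  hence "card (set_mset A) = size A" by (metis size_mset_set)
  with A(1) roots show ?thesis by simp
qed

text \<open>With Q = p^n, the polynomial X^Q - X has derivative -1, hence Q distinct roots.\<close>

lemma
  fixes n :: nat
  assumes "prime CHAR('a::alg_closed_field)" "n > 0"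
  shows card_frob_fixed: "card (frob_fixed n :: 'a set) = CHAR('a) ^ n"
    and finite_frob_fixed: "finite (frob_fixed n :: 'a set)"
proof -
  define Q where "Q = CHAR('a) ^ n"
  have Q: "Q > 1" using assms by (metis Q_def One_nat_def one_less_power prime_gt_1_nat)
  define P where "P = (monom 1 Q - [:0, 1:] :: 'a poly)"
  have deg: "degree P = Q" unfolding P_def using Q by (rule degree_monom_diff_linear)
  have roots: "{x. poly P x = 0} = frob_fixed n"
    by (auto simp: P_def frob_fixed_def poly_monom Q_def)
  have "of_nat Q = (0 :: 'a)"
    using assms by (simp add: Q_def)
  hence "pderiv P = - 1"
    by (simp add: P_def pderiv_diff pderiv_monom pderiv_pCons one_pCons)
  moreover from this have "P \<noteq> 0" by auto
  ultimately have "rsquarefree P"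
    using order_eq_1_if_pderiv[of P] unfolding rsquarefree_def
    by (metis order_0I poly_1 poly_minus one_neq_zero neg_equal_0_iff_equal)
  from card_roots_squarefree[OF this] deg roots show "card (frob_fixed n :: 'a set) = CHAR('a) ^ n"
    by (simp add: Q_def)
  thus "finite (frob_fixed n :: 'a set)"
    using Q by (metis Q_def card.infinite not_one_less_zero)
qed

lemma sum_lessThan_add: "(\<Sum>i<m+n. f i) = (\<Sum>i<m. f i) + (\<Sum>i<n. f (m + i :: nat) :: 'a::comm_monoid_add)"
  by (induction n) (auto simp: add.assoc)

locale char_p_closed =
  fixes dummy :: "'a::alg_closed_field itself"
  assumes prime_char: "prime CHAR('a)"
begin

abbreviation k :: "nat \<Rightarrow> 'a set" where "k \<equiv> frob_fixed"

lemma p_gt_0 [simp]: "CHAR('a) > 0"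
  using prime_char by (simp add: prime_gt_0_nat)

lemma frob_add: "(x + y :: 'a) ^ (CHAR('a) ^ n) = x ^ (CHAR('a) ^ n) + y ^ (CHAR('a) ^ n)"
  using prime_char by (rule freshmans_dream') simp

lemma frob_diff: "(x - y :: 'a) ^ (CHAR('a) ^ n) = x ^ (CHAR('a) ^ n) - y ^ (CHAR('a) ^ n)"
  using frob_add[of "x - y" y n] by (simp add: algebra_simps)

lemma frob_uminus: "(- y :: 'a) ^ (CHAR('a) ^ n) = - (y ^ (CHAR('a) ^ n))"
  using frob_diff[of 0 y n] by (simp add: zero_power)

lemma frob_sum: "(\<Sum>i\<in>A. f i :: 'a) ^ (CHAR('a) ^ n) = (\<Sum>i\<in>A. f i ^ (CHAR('a) ^ n))"
  using prime_char by (rule freshmans_dream_sum') simp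

lemma frob_fixed_0 [simp]: "0 \<in> k n"
  and frob_fixed_1 [simp]: "1 \<in> k n"
  and frob_fixed_add: "x \<in> k n \<Longrightarrow> y \<in> k n \<Longrightarrow> x + y \<in> k n"
  and frob_fixed_diff: "x \<in> k n \<Longrightarrow> y \<in> k n \<Longrightarrow> x - y \<in> k n"
  and frob_fixed_uminus: "x \<in> k n \<Longrightarrow> - x \<in> k n"
  and frob_fixed_mult: "x \<in> k n \<Longrightarrow> y \<in> k n \<Longrightarrow> x * y \<in> k n"
  and frob_fixed_divide: "x \<in> k n \<Longrightarrow> y \<in> k n \<Longrightarrow> x / y \<in> k n"
  and frob_fixed_power: "x \<in> k n \<Longrightarrow> x ^ m \<in> k n"
  by (auto simp: frob_fixed_def frob_add frob_diff frob_uminus power_mult_distrib power_divide zero_power)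
     (metis power_mult mult.commute)

lemma frob_fixed_of_nat: "of_nat j \<in> k n"
  by (induction j) (auto intro: frob_fixed_add)

lemma frob_fixed_double: "k n \<subseteq> k (2 * n)"
  by (auto simp: frob_fixed_def mult_2 power_add power_mult)

lemma abs_trace_add: "abs_trace n (x + y :: 'a) = abs_trace n x + abs_trace n y"
  by (simp add: abs_trace_def frob_add sum.distrib)

lemma abs_trace_frob:
  fixes x :: 'a
  assumes "x \<in> k n"
  shows "abs_trace n (x ^ CHAR('a)) = abs_trace n x"
proof (cases n)
  case (Suc m)
  have "abs_trace n (x ^ CHAR('a)) = (\<Sum>i<n. x ^ (CHAR('a) ^ Suc i))"
    by (simp add: abs_trace_def power_mult mult.commute flip: power_Suc power_mult)
  also have "\<dots> = (\<Sum>i<m. x ^ (CHAR('a) ^ Suc i)) + x ^ (CHAR('a) ^ 0)"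
    using assms by (simp add: Suc frob_fixed_def)
  also have "\<dots> = abs_trace n x"
    unfolding abs_trace_def Suc by (subst sum.lessThan_Suc_shift) simp
  finally show ?thesis .
qed (simp add: abs_trace_def)

lemma abs_trace_mem:
  assumes "x \<in> k n"
  shows "abs_trace n x \<in> k 1"
proof -
  have "abs_trace n x ^ CHAR('a) = abs_trace n (x ^ CHAR('a))"
    using frob_sum[of "\<lambda>i. x ^ (CHAR('a) ^ i)" "{..<n}" 1]
    by (simp add: abs_trace_def mult.commute flip: power_mult)
  thus ?thesis by (simp add: frob_fixed_def abs_trace_frob[OF assms])
qed

text \<open>Transitivity of the trace: z + z^(p^n) is the relative trace from
  \<open>k (2 * n)\<close> to \<open>k n\<close>.\<close>

lemma abs_trace_double: "abs_trace (2 * n) (z :: 'a) = abs_trace n (z + z ^ (CHAR('a) ^ n))"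
proof -
  have "abs_trace (2 * n) z = (\<Sum>i<n. z ^ (CHAR('a) ^ i)) + (\<Sum>i<n. z ^ (CHAR('a) ^ (i + n)))"
    unfolding abs_trace_def mult_2 sum_lessThan_add by (simp add: add.commute)
  thus ?thesis
    by (simp add: abs_trace_def frob_add sum.distrib power_add mult.commute flip: power_mult)
qed

text \<open>As a polynomial the trace has degree at most p^(n - 1), too small to vanish at p^n
  points. It is not the zero polynomial, since only the term i = 0 contributes to the coefficient of
  X.\<close>

lemma abs_trace_nontrivial:
  assumes "n > 0"
  obtains x where "x \<in> k n" "abs_trace n x \<noteq> 0"
proof -
  have p1: "CHAR('a) > 1" using prime_char by (rule prime_gt_1_nat)
  define P where "P = (\<Sum>i<n. monom 1 (CHAR('a) ^ i) :: 'a poly)"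
  have "coeff P 1 = (\<Sum>i<n. if i = 0 then 1 else 0)"
    unfolding P_def coeff_sum using p1 by (intro sum.cong) auto
  hence "P \<noteq> 0" using assms by auto
  have "degree P \<le> CHAR('a) ^ (n - 1)"
    unfolding P_def using p1
    by (intro degree_sum_le) (auto intro!: order.trans[OF degree_monom_le] power_increasing)
  also have "\<dots> < CHAR('a) ^ n" using p1 assms by simp
  finally have "card {x. poly P x = 0} < card (k n)"
    using card_poly_roots_bound[OF \<open>P \<noteq> 0\<close>] card_frob_fixed[OF prime_char assms] by linarith
  hence "\<not> k n \<subseteq> {x. poly P x = 0}"
    using poly_roots_finite[OF \<open>P \<noteq> 0\<close>] card_mono by (metis not_less)
  then obtain x where "x \<in> k n" "poly P x \<noteq> 0" by auto
  thus ?thesis using that[of x] by (simp add: P_def poly_sum poly_monom abs_trace_def)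
qed

lemma frob_fixed_1_eq: "k 1 = of_nat ` {..<CHAR('a)}"
proof -
  have "inj_on (of_nat :: nat \<Rightarrow> 'a) {..<CHAR('a)}"
    by (auto simp: inj_on_def of_nat_eq_iff_cong_CHAR cong_def)
  hence "card (of_nat ` {..<CHAR('a)} :: 'a set) = card (k 1)"
    by (simp add: card_image card_frob_fixed[OF prime_char])
  moreover have "of_nat ` {..<CHAR('a)} \<subseteq> k 1" using frob_fixed_of_nat by blast
  ultimately show ?thesis
    using finite_frob_fixed[OF prime_char, of 1] by (metis card_subset_eq zero_less_one)
qed

lemma prime_field_character:
  obtains e :: "'a \<Rightarrow> complex" where
    "\<And>u v. u \<in> k 1 \<Longrightarrow> v \<in> k 1 \<Longrightarrow> e (u + v) = e u * e v"
    "\<And>u. cmod (e u) = 1" "\<And>u. u \<in> k 1 \<Longrightarrow> e u = 1 \<longleftrightarrow> u = 0"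
proof -
  define E where "E = (\<lambda>j. cis (2 * pi * real j / real CHAR('a)))"
  have E_add: "E (i + j) = E i * E j" for i j
    by (simp add: E_def cis_mult add_divide_distrib ring_distribs)
  have Emult: "E (CHAR('a) * j) = 1" for j
    by (simp add: E_def) (metis DeMoivre cis_2pi power_one mult.commute mult.assoc)
  have E_mod: "E (j mod CHAR('a)) = E j" for j
    by (metis E_add Emult mult_1 mult_div_mod_eq)
  have E_cong: "E i = E j" if "of_nat i = (of_nat j :: 'a)" for i j
    using that E_mod by (metis of_nat_eq_iff_cong_CHAR cong_def)
  have E1: "CHAR('a) dvd j" if "E j = 1" for j
  proof -
    have "cos (2 * pi * real j / real CHAR('a)) = 1"
      using that by (simp add: E_def complex_eq_iff)
    then obtain i :: int where "2 * pi * real j / real CHAR('a) = real_of_int i * 2 * pi"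
      using cos_one_2pi_int by blast
    hence "real j = real_of_int i * real CHAR('a)"
      by (simp add: field_simps)
    hence "int j = i * int CHAR('a)" by (metis of_int_eq_iff of_int_mult of_int_of_nat_eq)
    thus ?thesis by (metis dvd_triv_right int_dvd_int_iff)
  qed
  \<comment> \<open>Any representative j of u will do: \<open>E\<close> depends only on j modulo
    p.\<close>
  define e where "e = (\<lambda>u :: 'a. E (SOME j. of_nat j = u))"
  have e_of_nat: "e (of_nat j) = E j" for j
    unfolding e_def by (rule E_cong) (rule someI, rule refl)
  show ?thesis
  proof (rule that[of e])
    fix u v :: 'a assume "u \<in> k 1" "v \<in> k 1"
    thus "e (u + v) = e u * e v"
      unfolding frob_fixed_1_eq by (auto simp: e_of_nat E_add simp flip: of_nat_add)
  next
    fix u :: 'a assume "u \<in> k 1"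
    then obtain j where j: "u = of_nat j" unfolding frob_fixed_1_eq by auto
    show "e u = 1 \<longleftrightarrow> u = 0"
      unfolding j e_of_nat of_nat_eq_0_iff_char_dvd
      using E1[of j] Emult by (auto elim!: dvdE)
  qed (simp add: e_def E_def)
qed

end

section \<open>Kloosterman sums in towers of quadratic extensions\<close>

locale char_p_character = char_p_closed dummy for dummy :: "'a::alg_closed_field itself" +
  fixes e :: "'a \<Rightarrow> complex"
  assumes odd_char: "odd CHAR('a)"
    and e_add: "u \<in> k 1 \<Longrightarrow> v \<in> k 1 \<Longrightarrow> e (u + v) = e u * e v"
    and norm_e: "cmod (e u) = 1"
    and e_eq_1_iff: "u \<in> k 1 \<Longrightarrow> e u = 1 \<longleftrightarrow> u = 0"
begin

definition psi :: "nat \<Rightarrow> 'a \<Rightarrow> complex" where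
  "psi n x = e (abs_trace n x)"

definition klo :: "nat \<Rightarrow> 'a \<Rightarrow> complex" where
  "klo n b = (\<Sum>x\<in>k n - {0}. psi n (x + b / x))"

lemma psi_add: "x \<in> k n \<Longrightarrow> y \<in> k n \<Longrightarrow> psi n (x + y) = psi n x * psi n y"
  unfolding psi_def abs_trace_add by (rule e_add) (rule abs_trace_mem; assumption)+

lemma norm_psi: "cmod (psi n x) = 1"
  by (simp add: psi_def norm_e)

lemma psi_0 [simp]: "psi n 0 = 1"
  using e_eq_1_iff[of 0] by (simp add: psi_def abs_trace_def zero_power)

lemma psi_frob: "x \<in> k n \<Longrightarrow> psi n (x ^ CHAR('a)) = psi n x"
  by (simp add: psi_def abs_trace_frob)

lemma psi_double: "psi (2 * n) z = psi n (z + z ^ (CHAR('a) ^ n))"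
  by (simp add: psi_def abs_trace_double)

lemma sum_psi:
  assumes n: "n > 0"
  shows "(\<Sum>x\<in>k n. psi n x) = 0"
proof -
  obtain y where y: "y \<in> k n" "abs_trace n y \<noteq> 0" using n by (rule abs_trace_nontrivial)
  hence psi_y: "psi n y \<noteq> 1" using e_eq_1_iff[OF abs_trace_mem[OF y(1)]] by (simp add: psi_def)
  have "(\<Sum>x\<in>k n. psi n x) = (\<Sum>x\<in>k n. psi n (y + x))"
    by (rule sum.reindex_bij_witness[of _ "\<lambda>x. y + x" "\<lambda>x. x - y"])
       (auto intro: frob_fixed_add frob_fixed_diff y)
  also have "\<dots> = psi n y * (\<Sum>x\<in>k n. psi n x)"
    by (simp add: psi_add y sum_distrib_left)
  finally show ?thesis using psi_y by simp
qed

lemma sum_psi_mult: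
  assumes n: "n > 0" and a: "a \<in> k n"
  shows "(\<Sum>x\<in>k n. psi n (x * a)) = (if a = 0 then of_nat (CHAR('a) ^ n) else 0)"
proof (cases "a = 0")
  case False
  have "(\<Sum>x\<in>k n. psi n (x * a)) = (\<Sum>x\<in>k n. psi n x)"
    using a False
    by (intro sum.reindex_bij_witness[of _ "\<lambda>x. x / a" "\<lambda>x. x * a"])
       (auto intro: frob_fixed_mult frob_fixed_divide)
  with False sum_psi[OF n] show ?thesis by simp
qed (simp add: card_frob_fixed[OF prime_char n])

text \<open>
  The polynomial \<open>X\<^sup>2 - s X + m\<close> either splits over \<open>k n\<close> or has conjugate roots in \<open>k (2 * n)\<close>.
\<close>
lemma card_roots_split_or_conjugate:
  assumes s: "s \<in> k n" and m: "m \<in> k n" "m \<noteq> 0"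
  shows "card {(x, y). x \<in> k n - {0} \<and> y \<in> k n - {0} \<and> x + y = s \<and> x * y = m} +
    card {z. z \<in> k (2 * n) - {0} \<and> z + z ^ (CHAR('a) ^ n) = s \<and> z * z ^ (CHAR('a) ^ n) = m} = 2"
    (is "card ?R + card ?R' = 2")
proof -
  define fr where "fr = (\<lambda>x :: 'a. x ^ (CHAR('a) ^ n))"
  have fr_eq: "x ^ (CHAR('a) ^ n) = fr x" for x by (simp add: fr_def)
  have k_iff: "x \<in> k n \<longleftrightarrow> fr x = x" for x by (simp add: frob_fixed_def fr_def)
  have k2_iff: "x \<in> k (2 * n) \<longleftrightarrow> fr (fr x) = x" for x
    by (simp add: frob_fixed_def fr_def mult_2 power_add power_mult)
  have "degree [:m, - s, 1:] > 0" by simp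
  then obtain x0 where "poly [:m, - s, 1:] x0 = 0" using alg_closed_imp_poly_has_root by blast
  define y0 where "y0 = s - x0"
  have sum: "x0 + y0 = s" by (simp add: y0_def)
  have prod: "x0 * y0 = m"
    using \<open>poly [:m, - s, 1:] x0 = 0\<close> by (simp add: y0_def algebra_simps add_eq_0_iff)
  have nz: "x0 \<noteq> 0" "y0 \<noteq> 0" using prod m by auto
  have pair: "x + y = s \<and> x * y = m \<longleftrightarrow> (x = x0 \<and> y = y0) \<or> (x = y0 \<and> y = x0)" for x y
  proof
    assume *: "x + y = s \<and> x * y = m"
    have "(x - x0) * (x - y0) = x * (x - (x0 + y0)) + x0 * y0" by (simp add: algebra_simps)
    also have "\<dots> = x * (x - (x + y)) + x * y" using * sum prod by simp
    also have "\<dots> = 0" by (simp add: algebra_simps)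
    finally have "x = x0 \<or> x = y0" by simp
    moreover have "y = x0 + y0 - x" using * sum by (simp add: algebra_simps)
    ultimately show "(x = x0 \<and> y = y0) \<or> (x = y0 \<and> y = x0)" by auto
  qed (use sum prod in \<open>auto simp: algebra_simps\<close>)
  have fr_sum: "fr x0 + fr y0 = s" and fr_prod: "fr x0 * fr y0 = m"
    using s m sum prod by (simp_all add: k_iff fr_def flip: frob_add power_mult_distrib)
  hence "(fr x0 = x0 \<and> fr y0 = y0) \<or> (fr x0 = y0 \<and> fr y0 = x0)" by (simp add: pair[symmetric])
  moreover have R': "?R' = {z. fr (fr z) = z \<and> ((z = x0 \<and> fr z = y0) \<or> (z = y0 \<and> fr z = x0))}"
    using nz by (auto simp: k2_iff pair fr_eq)
  moreover have R: "?R = {(x, y). fr x = x \<and> fr y = y \<and> ((x = x0 \<and> y = y0) \<or> (x = y0 \<and> y = x0))}"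
    using nz by (auto simp: k_iff pair)
  ultimately consider "fr x0 = x0" "fr y0 = y0" "x0 = y0" | "fr x0 = x0" "fr y0 = y0" "x0 \<noteq> y0"
    | "fr x0 = y0" "fr y0 = x0" "x0 \<noteq> y0" by metis
  thus ?thesis
  proof cases
    case 1
    have *: "?R = {(x0, x0)}" "?R' = {x0}" unfolding R R' using 1 by auto
    show ?thesis unfolding * by simp
  next
    case 2
    have *: "?R = {(x0, y0), (y0, x0)}" "?R' = {}" unfolding R R' using 2 by auto
    show ?thesis unfolding * using 2 by simp
  next
    case 3
    have *: "?R = {}" "?R' = {x0, y0}" unfolding R R' using 3 by auto
    show ?thesis unfolding * using 3 by simp
  qed
qed

text \<open>With s = x + y and m = x y, the square of K_n becomes a sum of \<psi>(s + b s / m) over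
  pairs (s, m), weighted by the number of ordered pairs of roots of X^2 - s X + m in the small
  field. With trace s and norm m, K_(2n) becomes the same sum weighted by conjugate roots in the
  large field. The weights add up to 2, and summing over s leaves only m = -b. The relation is the
  one satisfied by -(u^n + v^n) with u v = p.\<close>

lemma klo_double:
  assumes n: "n > 0" and b: "b \<in> k n" "b \<noteq> 0"
  shows "klo (2 * n) b = of_nat (2 * CHAR('a) ^ n) - (klo n b)\<^sup>2"
proof -
  define fr where "fr = (\<lambda>x :: 'a. x ^ (CHAR('a) ^ n))"
  define T where "T = k n \<times> (k n - {0})"
  define \<phi> where "\<phi> = (\<lambda>(s, m). psi n (s + b * s / m))"
  define P where "P = (k n - {0}) \<times> (k n - {0})"
  define f where "f = (\<lambda>(x, y). (x + y, x * y :: 'a))"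
  define g where "g = (\<lambda>z. (z + fr z, z * fr z))"
  have fin: "finite (k n)" "finite (k (2 * n))"
    using n by (auto intro: finite_frob_fixed[OF prime_char])
  hence finT: "finite T" and finP: "finite P" by (auto simp: T_def P_def)
  have b_fr: "fr b = b" using b by (simp add: frob_fixed_def fr_def)
  have fr_mem: "g z \<in> T" if "z \<in> k (2 * n) - {0}" for z
  proof -
    have "fr (fr z) = z"
      using that by (simp add: frob_fixed_def fr_def mult_2 power_add power_mult)
    hence "fr (z + fr z) = z + fr z" "fr (z * fr z) = z * fr z"
      by (simp_all add: fr_def frob_add power_mult_distrib mult.commute add.commute)
    moreover have "z * fr z \<noteq> 0" using that by (simp add: fr_def)
    ultimately show ?thesis by (simp add: g_def T_def frob_fixed_def fr_def)
  qed
  have "(klo n b)\<^sup>2 = (\<Sum>xy\<in>P. \<phi> (f xy))"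
    unfolding klo_def power2_eq_square sum_product P_def sum.cartesian_product
  proof (intro sum.cong refl, goal_cases)
    case (1 z)
    then obtain x y where z: "z = (x, y)" and xy: "x \<in> k n" "y \<in> k n" "x \<noteq> 0" "y \<noteq> 0" by auto
    have "x + y + b * (x + y) / (x * y) = (x + b / x) + (y + b / y)"
      using xy by (simp add: field_simps)
    thus ?case
      using xy b by (simp add: z \<phi>_def f_def psi_add frob_fixed_add frob_fixed_divide)
  qed
  also have "\<dots> = (\<Sum>t\<in>T. \<Sum>xy\<in>{xy \<in> P. f xy = t}. \<phi> (f xy))"
    by (rule sum.group[symmetric]) (use finP finT in \<open>auto simp: P_def T_def f_def intro: frob_fixed_add frob_fixed_mult\<close>)
  also have "\<dots> = (\<Sum>t\<in>T. of_nat (card {xy \<in> P. f xy = t}) * \<phi> t)" by simp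
  finally have 1: "(klo n b)\<^sup>2 = (\<Sum>t\<in>T. of_nat (card {xy \<in> P. f xy = t}) * \<phi> t)" .
  have "klo (2 * n) b = (\<Sum>z\<in>k (2 * n) - {0}. \<phi> (g z))"
    unfolding klo_def
  proof (intro sum.cong refl)
    fix z assume z: "z \<in> k (2 * n) - {0}"
    have "fr z \<noteq> 0" using z by (simp add: fr_def)
    have "psi (2 * n) (z + b / z) = psi n (z + b / z + fr (z + b / z))"
      by (simp add: psi_double fr_def)
    also have "fr (z + b / z) = fr z + b / fr z"
      using b_fr by (simp add: fr_def frob_add power_divide)
    also have "z + b / z + (fr z + b / fr z) = z + fr z + b * (z + fr z) / (z * fr z)"
      using z \<open>fr z \<noteq> 0\<close> by (simp add: field_simps)
    finally show "psi (2 * n) (z + b / z) = \<phi> (g z)" by (simp add: \<phi>_def g_def)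
  qed
  also have "\<dots> = (\<Sum>t\<in>T. \<Sum>z\<in>{z \<in> k (2 * n) - {0}. g z = t}. \<phi> (g z))"
    using fin finT by (intro sum.group[symmetric] image_subsetI fr_mem) auto
  also have "\<dots> = (\<Sum>t\<in>T. of_nat (card {z \<in> k (2 * n) - {0}. g z = t}) * \<phi> t)" by simp
  finally have "klo (2 * n) b + (klo n b)\<^sup>2 =
      (\<Sum>t\<in>T. of_nat (card {xy \<in> P. f xy = t} + card {z \<in> k (2 * n) - {0}. g z = t}) * \<phi> t)"
    unfolding 1 by (simp add: sum.distrib algebra_simps)
  also have "\<dots> = (\<Sum>t\<in>T. 2 * \<phi> t)"
  proof (intro sum.cong refl)
    fix t assume t: "t \<in> T"
    obtain s m where sm: "t = (s, m)" by (cases t)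
    have "{xy \<in> P. f xy = t} = {(x, y). x \<in> k n - {0} \<and> y \<in> k n - {0} \<and> x + y = s \<and> x * y = m}"
      "{z \<in> k (2 * n) - {0}. g z = t} = {z. z \<in> k (2 * n) - {0} \<and> z + fr z = s \<and> z * fr z = m}"
      by (auto simp: P_def f_def g_def sm)
    hence "card {xy \<in> P. f xy = t} + card {z \<in> k (2 * n) - {0}. g z = t} = 2"
      using card_roots_split_or_conjugate[of s n m] t by (simp add: sm T_def fr_def)
    thus "of_nat (card {xy \<in> P. f xy = t} + card {z \<in> k (2 * n) - {0}. g z = t}) * \<phi> t = 2 * \<phi> t"
      by simp
  qed
  also have "\<dots> = 2 * (\<Sum>m\<in>k n - {0}. \<Sum>s\<in>k n. \<phi> (s, m))"
    unfolding T_def by (subst sum.swap) (simp add: sum.cartesian_product sum_distrib_left)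
  also have "(\<Sum>m\<in>k n - {0}. \<Sum>s\<in>k n. \<phi> (s, m)) = (\<Sum>m\<in>k n - {0}. if m = - b then of_nat (CHAR('a) ^ n) else 0)"
  proof (intro sum.cong refl)
    fix m assume m: "m \<in> k n - {0}"
    have "(\<Sum>s\<in>k n. \<phi> (s, m)) = (\<Sum>s\<in>k n. psi n (s * (1 + b / m)))"
      by (simp add: \<phi>_def algebra_simps)
    also have "\<dots> = (if 1 + b / m = 0 then of_nat (CHAR('a) ^ n) else 0)"
      using m b by (intro sum_psi_mult n frob_fixed_add frob_fixed_divide) auto
    also have "1 + b / m = 0 \<longleftrightarrow> m = - b"
      using m by (auto simp: field_simps add_eq_0_iff)
    finally show "(\<Sum>s\<in>k n. \<phi> (s, m)) = (if m = - b then of_nat (CHAR('a) ^ n) else 0)" .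
  qed
  also have "\<dots> = of_nat (CHAR('a) ^ n)"
    using fin b frob_fixed_uminus[of b n] by (simp add: sum.delta)
  finally show ?thesis by (simp add: algebra_simps)
qed

section \<open>Quadratic character sums and Weil's bound\<close>

lemma two_neq_0: "(2 :: 'a) \<noteq> 0"
proof
  assume "(2 :: 'a) = 0"
  hence "CHAR('a) dvd 2" using of_nat_eq_0_iff_char_dvd[of 2, where 'a='a] by simp
  hence "CHAR('a) \<le> 2" by (rule dvd_imp_le) simp
  moreover have "CHAR('a) \<ge> 2" using prime_char by (rule prime_ge_2_nat)
  ultimately show False using odd_char by simp
qed

text \<open>Euler's criterion: the h-th power has square 1. Its two values stand in for the
  quadratic character.\<close>

lemma power_half_order:
  assumes n: "n > 0" and D: "D \<in> k n" "D \<noteq> 0"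
  shows "D ^ ((CHAR('a) ^ n - 1) div 2) = 1 \<or> D ^ ((CHAR('a) ^ n - 1) div 2) = -1"
proof -
  define h where "h = (CHAR('a) ^ n - 1) div 2"
  have Q: "CHAR('a) ^ n = Suc (2 * h)"
    using odd_char prime_char by (simp add: h_def prime_gt_0_nat)
  have "D * ((D ^ h)\<^sup>2 - 1) = D ^ Suc (2 * h) - D"
    by (simp add: algebra_simps power_mult[symmetric] mult.commute)
  also have "\<dots> = 0" using D by (simp add: frob_fixed_def Q)
  finally have "(D ^ h)\<^sup>2 = 1" using D by simp
  thus ?thesis by (simp add: power2_eq_1_iff h_def)
qed

text \<open>The equation is quadratic with discriminant D. A square root w of D in the algebraic
  closure satisfies w^(p^n) = w D^h, so for nonzero D the roots (s + w) / 2 and (s - w) / 2 lie in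
  \<open>k n\<close> exactly when D^h = 1.\<close>

lemma card_quadratic_roots:
  assumes n: "n > 0" and D: "D \<in> k n" and s: "s \<in> k n" and b: "b \<in> k n" "b \<noteq> 0" and D_eq: "D = s\<^sup>2 - 4 * b"
  defines "h \<equiv> (CHAR('a) ^ n - 1) div 2"
  shows "real (card {x \<in> k n - {0}. x + b / x = s}) = 1 + of_bool (D ^ h = 1) - of_bool (D ^ h = -1)"
proof -
  define fr where "fr = (\<lambda>x :: 'a. x ^ (CHAR('a) ^ n))"
  have four: "(4 :: 'a) \<noteq> 0" using two_neq_0 mult_eq_0_iff[of "2 :: 'a" 2] by simp
  have k_iff: "x \<in> k n \<longleftrightarrow> fr x = x" for x by (simp add: frob_fixed_def fr_def)
  have two_k: "2 \<in> k n" using frob_fixed_of_nat[of 2 n] by simp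
  have odd: "odd (CHAR('a) ^ n)" using odd_char by simp
  have Q1: "CHAR('a) ^ n > 1" using n prime_char by (metis one_less_power prime_gt_1_nat)
  have Q: "CHAR('a) ^ n = Suc (2 * h)" using odd Q1 by (simp add: h_def)
  have h0: "h > 0" using Q Q1 by simp
  obtain w where w: "w\<^sup>2 = D" using nth_root_exists[of 2 D] by auto
  have fr_w: "fr w = w * D ^ h" by (simp add: fr_def Q power_mult w)
  have root: "x \<noteq> 0 \<and> x + b / x = s \<longleftrightarrow> x = (s + w) / 2 \<or> x = (s - w) / 2" for x
  proof -
    have "x \<noteq> 0 \<and> x + b / x = s \<longleftrightarrow> x * x + b = s * x"
    proof (cases "x = 0")
      case False
      hence "x + b / x = s \<longleftrightarrow> (x + b / x) * x = s * x" by simp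
      also have "(x + b / x) * x = x * x + b" using False by (simp add: algebra_simps)
      finally show ?thesis using False by simp
    qed (use b in simp)
    also have "\<dots> \<longleftrightarrow> (2 * x - s)\<^sup>2 = w\<^sup>2"
    proof -
      have "(2 * x - s)\<^sup>2 - w\<^sup>2 = 4 * (x * x + b - s * x)"
        unfolding w D_eq by (simp add: power2_eq_square algebra_simps)
      thus ?thesis using four by (metis mult_eq_0_iff right_minus_eq)
    qed
    also have "\<dots> \<longleftrightarrow> 2 * x - s = w \<or> 2 * x - s = - w" by (rule power2_eq_iff)
    also have "\<dots> \<longleftrightarrow> x = (s + w) / 2 \<or> x = (s - w) / 2"
      using two_neq_0 by (auto simp: field_simps)
    finally show ?thesis .
  qed
  have set_eq: "{x \<in> k n - {0}. x + b / x = s} = {x \<in> k n. x = (s + w) / 2 \<or> x = (s - w) / 2}"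
    using root by auto
  have neg1: "(-1 :: 'a) \<noteq> 1"
  proof
    assume "(-1 :: 'a) = 1"
    hence "(2 :: 'a) = 0" by (metis add.right_inverse one_add_one)
    with two_neq_0 show False by simp
  qed
  consider "D = 0" | "D \<noteq> 0" "D ^ h = 1" | "D \<noteq> 0" "D ^ h = -1"
    using power_half_order[OF n D] unfolding h_def by blast
  thus ?thesis
  proof cases
    case 1
    hence "w = 0" using w by simp
    hence "{x \<in> k n - {0}. x + b / x = s} = {s / 2}"
      unfolding set_eq using s two_k frob_fixed_divide by auto
    thus ?thesis using 1 h0 by (simp add: zero_power)
  next
    case 2
    hence "w \<in> k n" using fr_w by (simp add: k_iff)
    hence "{x \<in> k n - {0}. x + b / x = s} = {(s + w) / 2, (s - w) / 2}"
      unfolding set_eq using s two_k by (auto intro: frob_fixed_divide frob_fixed_add frob_fixed_diff)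
    moreover have "(s + w) / 2 \<noteq> (s - w) / 2"
    proof
      assume "(s + w) / 2 = (s - w) / 2"
      hence "s + w = s + - w" using two_neq_0 four by simp
      hence "w = - w" by (simp only: add_left_cancel)
      hence "2 * w = 0" by (metis add.right_inverse mult_2)
      with two_neq_0 w 2 show False by simp
    qed
    ultimately show ?thesis using 2 neg1 by simp
  next
    case 3
    have "w \<notin> k n"
    proof
      assume "w \<in> k n"
      hence "w = - w" using fr_w 3 by (simp add: k_iff)
      hence "2 * w = 0" by (metis add.right_inverse mult_2)
      with two_neq_0 w 3 show False by simp
    qed
    have half: "2 * (x / 2) = x" for x :: 'a
      using two_neq_0 by simp
    have "2 * ((s + w) / 2) - s = w" "s - 2 * ((s - w) / 2) = w"
      unfolding half by simp_all
    moreover note \<open>w \<notin> k n\<close>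
    moreover have "2 * x - s \<in> k n" "s - 2 * x \<in> k n" if "x \<in> k n" for x
      using that s two_k by (auto intro: frob_fixed_diff frob_fixed_mult)
    ultimately have "(s + w) / 2 \<notin> k n" "(s - w) / 2 \<notin> k n" by metis+
    hence "{x \<in> k n - {0}. x + b / x = s} = {}"
      unfolding set_eq by blast
    thus ?thesis using 3 neg1 by (simp only: card.empty) simp
  qed
qed

text \<open>Stepanov's method only bounds from above how often the character takes each value. As 1
  and -1 together are taken at all but at most 2 p of the q^2 points, an upper bound for one is a
  lower bound for the other. The difference is then at most 6 p q + 2 p.\<close>

lemma character_sum_bound:
  fixes q \<nu> :: nat and b c :: 'a
  assumes \<nu>: "\<nu> > 0" and q: "q = CHAR('a) ^ \<nu>" and large: "4 * CHAR('a) \<le> q"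
    and b: "b \<in> k (2 * \<nu>)" "b \<noteq> 0" and c: "c \<in> k (2 * \<nu>)"
  defines "h \<equiv> (q\<^sup>2 - 1) div 2"
  defines "D \<equiv> \<lambda>y. (y ^ CHAR('a) - y + c)\<^sup>2 - 4 * b"
  shows "\<bar>\<Sum>y\<in>k (2 * \<nu>). of_bool (D y ^ h = 1) - of_bool (D y ^ h = -1) :: real\<bar> \<le> 8 * CHAR('a) * q"
proof -
  define m where "m = CHAR('a)"
  have m: "m > 1" unfolding m_def using prime_char by (rule prime_gt_1_nat)
  define n where "n = 2 * \<nu>"
  have n: "n > 0" using \<nu> by (simp add: n_def)
  have Q: "CHAR('a) ^ n = q\<^sup>2" by (simp add: n_def q mult.commute flip: power_mult)
  have k_eq: "k n = {y. y ^ q\<^sup>2 = y}" by (simp add: frob_fixed_def Q)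
  have fin: "finite (k n)" using n by (rule finite_frob_fixed[OF prime_char])
  define H where "H = monom 1 m - [:- c, 1:]"
  define F where "F = H\<^sup>2 - [:4 * b:]"
  have degH: "degree H = m" unfolding H_def using m by (rule degree_monom_diff_linear)
  have "degree (H\<^sup>2) = 2 * m" using degH m by (subst degree_power_eq) auto
  hence degF: "degree F = 2 * m"
    unfolding F_def diff_conv_add_uminus using m by (subst degree_add_eq_left) auto
  have polyF: "poly F y = D y" for y
    by (simp add: F_def H_def D_def poly_monom m_def algebra_simps)
  have F0: "F \<noteq> 0" using degF m by auto
  \<comment> \<open>Any root r of F is simple: H(r)^2 = 4 b is nonzero and H' = -1, so F'(r) = -2
    H(r) is nonzero. This supplies the odd order that Stepanov's bound asks for.\<close>
  obtain r where r: "poly F r = 0" using alg_closed_imp_poly_has_root[of F] degF m by auto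
  have "pderiv H = - 1"
    by (simp add: H_def m_def pderiv_diff pderiv_monom pderiv_pCons one_pCons)
  hence pderivF: "poly (pderiv F) r = - (2 * poly H r)"
    by (simp add: F_def pderiv_diff power2_eq_square pderiv_mult pderiv_pCons)
  have "(4 :: 'a) \<noteq> 0" using two_neq_0 mult_eq_0_iff[of "2 :: 'a" 2] by simp
  hence "poly H r \<noteq> 0" using r b(2) by (auto simp: F_def)
  hence "poly (pderiv F) r \<noteq> 0" unfolding pderivF using two_neq_0 by simp
  with r have order: "Polynomial.order r F = 1" by (rule order_eq_1_if_pderiv)
  have "odd q" using odd_char by (simp add: q)
  then obtain s where s: "q = 2 * s + 1" by (rule oddE)
  define N where "N = (\<lambda>\<epsilon>. card {y \<in> k n. D y ^ h = \<epsilon>})"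
  have N: "N \<epsilon> \<le> q * (s + 3 * m)" if "\<epsilon> \<noteq> 0" for \<epsilon>
    using stepanov_bound[OF prime_char q s degF, of r \<epsilon>] order large F0 that
    by (simp add: N_def k_eq polyF h_def m_def)
  have neg1: "(-1 :: 'a) \<noteq> 1" using two_neq_0 by (metis add.right_inverse one_add_one)
  have "(\<Sum>y\<in>k n. of_bool (D y ^ h = \<epsilon>) :: real) = N \<epsilon>" for \<epsilon>
    unfolding N_def using fin by (simp add: sum.If_cases of_bool_def Int_def)
  hence sum_eq: "(\<Sum>y\<in>k n. of_bool (D y ^ h = 1) - of_bool (D y ^ h = -1) :: real) = real (N 1) - real (N (-1))"
    by (simp add: sum_subtractf)
  have "k n \<subseteq> {y \<in> k n. D y ^ h = 1} \<union> {y \<in> k n. D y ^ h = -1} \<union> {y. poly F y = 0}"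
  proof
    fix y assume y: "y \<in> k n"
    have "4 \<in> k n" using frob_fixed_of_nat[of 4 n] by simp
    hence "D y \<in> k n" unfolding D_def using y b c
      by (auto simp: n_def intro!: frob_fixed_diff frob_fixed_add frob_fixed_mult frob_fixed_power)
    thus "y \<in> {y \<in> k n. D y ^ h = 1} \<union> {y \<in> k n. D y ^ h = -1} \<union> {y. poly F y = 0}"
      using y power_half_order[OF n, of "D y"] by (auto simp: polyF h_def Q)
  qed
  hence "card (k n) \<le> card ({y \<in> k n. D y ^ h = 1} \<union> {y \<in> k n. D y ^ h = -1} \<union> {y. poly F y = 0})"
    using fin poly_roots_finite[OF F0] by (intro card_mono) auto
  also have "\<dots> \<le> N 1 + N (-1) + card {y. poly F y = 0}"
    unfolding N_def by (intro order.trans[OF card_Un_le] add_mono order.refl)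
  also have "card {y. poly F y = 0} \<le> 2 * m" using card_poly_roots_bound[OF F0] degF by simp
  finally have lower: "q\<^sup>2 \<le> N 1 + N (-1) + 2 * m"
    by (simp add: card_frob_fixed[OF prime_char n] Q)
  have upper: "N 1 \<le> q * s + 3 * (q * m)" "N (-1) \<le> q * s + 3 * (q * m)"
    using N[of 1] N[of "-1"] by (simp_all add: algebra_simps)
  have "q\<^sup>2 = 2 * (q * s) + q" by (simp add: s power2_eq_square algebra_simps)
  hence "int (N 1) - int (N (-1)) \<le> 6 * int (q * m) + 2 * int m"
    "int (N (-1)) - int (N 1) \<le> 6 * int (q * m) + 2 * int m"
    using lower upper by linarith+
  moreover have "m \<le> q * m" using s by simp
  ultimately have "\<bar>int (N 1) - int (N (-1))\<bar> \<le> 8 * int (q * m)" by linarith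
  hence "\<bar>real (N 1) - real (N (-1))\<bar> \<le> 8 * real (q * m)"
    by (metis (mono_tags, lifting) of_int_abs of_int_diff of_int_le_iff of_int_mult of_int_numeral of_int_of_nat_eq)
  thus ?thesis unfolding sum_eq[unfolded n_def] by (simp add: m_def mult_ac)
qed

text \<open>The average over y loses nothing: there are as many values of c as of y, so the bound
  for a single inner character sum is the bound for the Kloosterman sum.\<close>

lemma klo_bound_even:
  assumes \<nu>: "\<nu> > 0" and q: "q = CHAR('a) ^ \<nu>" and large: "4 * CHAR('a) \<le> q"
    and b: "b \<in> k (2 * \<nu>)" "b \<noteq> 0"
  shows "cmod (klo (2 * \<nu>) b) \<le> 8 * CHAR('a) * q"
proof -
  define n where "n = 2 * \<nu>"
  have n: "n > 0" using \<nu> by (simp add: n_def)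
  have Q: "CHAR('a) ^ n = q\<^sup>2" by (simp add: n_def q mult.commute flip: power_mult)
  have fin: "finite (k n)" using n by (rule finite_frob_fixed[OF prime_char])
  have bn: "b \<in> k n" using b by (simp add: n_def)
  define h where "h = (q\<^sup>2 - 1) div 2"
  define \<chi> where "\<chi> = (\<lambda>s :: 'a. of_bool ((s\<^sup>2 - 4 * b) ^ h = 1) - of_bool ((s\<^sup>2 - 4 * b) ^ h = -1) :: real)"
  have four: "4 \<in> k n" using frob_fixed_of_nat[of 4 n] by simp
  have "klo n b = (\<Sum>s\<in>k n. \<Sum>x\<in>{x \<in> k n - {0}. x + b / x = s}. psi n (x + b / x))"
    unfolding klo_def using fin bn
    by (intro sum.group[symmetric] image_subsetI) (auto intro: frob_fixed_add frob_fixed_divide)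
  also have "\<dots> = (\<Sum>s\<in>k n. of_real (real (card {x \<in> k n - {0}. x + b / x = s})) * psi n s)" by simp
  also have "\<dots> = (\<Sum>s\<in>k n. of_real (1 + \<chi> s) * psi n s)"
  proof (intro sum.cong refl)
    fix s assume s: "s \<in> k n"
    have "s\<^sup>2 - 4 * b \<in> k n"
      using s bn four by (auto intro: frob_fixed_diff frob_fixed_mult frob_fixed_power)
    from card_quadratic_roots[OF n this s bn b(2) refl]
    have "real (card {x \<in> k n - {0}. x + b / x = s}) = 1 + \<chi> s"
      by (simp add: \<chi>_def h_def Q)
    thus "of_real (real (card {x \<in> k n - {0}. x + b / x = s})) * psi n s = of_real (1 + \<chi> s) * psi n s"
      by (simp only:)
  qed
  also have "\<dots> = (\<Sum>s\<in>k n. of_real (\<chi> s) * psi n s)"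
    using sum_psi[OF n] by (simp add: ring_distribs sum.distrib)
  finally have K: "klo n b = (\<Sum>s\<in>k n. of_real (\<chi> s) * psi n s)" .
  \<comment> \<open>Elements y^p - y have character value 1, because y and y^p have the same trace.
    Translating the summation variable by them leaves the sum unchanged.\<close>
  have shift: "(\<Sum>c\<in>k n. of_real (\<chi> (y ^ CHAR('a) - y + c)) * psi n c) = klo n b" if y: "y \<in> k n" for y
  proof -
    define u where "u = y ^ CHAR('a) - y"
    have u: "u \<in> k n" unfolding u_def using y by (auto intro: frob_fixed_diff frob_fixed_power)
    have "psi n y = psi n (u + y)" using psi_frob[OF y] by (simp add: u_def)
    also have "\<dots> = psi n u * psi n y" by (rule psi_add[OF u y])
    finally have "psi n u = 1" using norm_psi[of n y] by auto
    hence "klo n b = (\<Sum>s\<in>k n. of_real (\<chi> s) * psi n s)" "\<And>c. c \<in> k n \<Longrightarrow> psi n (u + c) = psi n c"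
      using K by (simp_all add: psi_add u)
    moreover have "(\<Sum>s\<in>k n. of_real (\<chi> s) * psi n s) = (\<Sum>c\<in>k n. of_real (\<chi> (u + c)) * psi n (u + c))"
      by (rule sum.reindex_bij_witness[of _ "\<lambda>x. u + x" "\<lambda>x. x - u"])
         (auto intro: frob_fixed_add frob_fixed_diff u)
    ultimately show ?thesis by (simp add: u_def)
  qed
  have "of_nat (q\<^sup>2) * klo n b = (\<Sum>y\<in>k n. \<Sum>c\<in>k n. of_real (\<chi> (y ^ CHAR('a) - y + c)) * psi n c)"
    by (simp add: shift card_frob_fixed[OF prime_char n] Q)
  also have "\<dots> = (\<Sum>c\<in>k n. of_real (\<Sum>y\<in>k n. \<chi> (y ^ CHAR('a) - y + c)) * psi n c)"
    by (subst sum.swap) (simp add: sum_distrib_right)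
  also have "cmod \<dots> \<le> (\<Sum>c\<in>k n. real (8 * CHAR('a) * q))"
  proof (rule sum_norm_le)
    fix c assume "c \<in> k n"
    thus "cmod (of_real (\<Sum>y\<in>k n. \<chi> (y ^ CHAR('a) - y + c)) * psi n c) \<le> real (8 * CHAR('a) * q)"
      unfolding norm_mult norm_psi norm_of_real
      using character_sum_bound[OF \<nu> q large b, of c] by (simp add: \<chi>_def h_def n_def)
  qed
  finally have "real (q\<^sup>2) * cmod (klo n b) \<le> real (q\<^sup>2) * (8 * CHAR('a) * q)"
    by (simp only: norm_mult norm_of_nat sum_constant card_frob_fixed[OF prime_char n] Q of_nat_mult)
  moreover have "q > 0" using q prime_char by (simp add: prime_gt_0_nat)
  ultimately show ?thesis by (simp add: n_def)
qed

theorem klo_bound: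
  assumes n: "n > 0" and b: "b \<in> k n" "b \<noteq> 0"
  shows "cmod (klo n b) \<le> 2 * sqrt (CHAR('a) ^ n)"
proof (rule ccontr)
  assume large: "\<not> cmod (klo n b) \<le> 2 * sqrt (CHAR('a) ^ n)"
  define m where "m = CHAR('a)"
  have m: "m \<ge> 3" unfolding m_def using prime_ge_2_nat[OF prime_char] odd_char
    by (cases "CHAR('a) = 2") auto
  define \<eta> where "\<eta> = cmod (klo n b) / sqrt (m ^ n) - 2"
  have m0: "sqrt (m ^ j) > 0" for j using m by simp
  have \<eta>: "\<eta> > 0" using large m0[of n] by (simp add: \<eta>_def m_def field_simps)
  \<comment> \<open>Doubling turns 2 + t into at least (2 + t)^2 - 2 \<ge> 2 + 4 t. The excess over
    2 grows by the factor 4 each time, while the constant 8 p of the even case stays fixed.\<close>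
  have grow: "cmod (klo (n * 2 ^ j) b) \<ge> (2 + 4 ^ j * \<eta>) * sqrt (m ^ (n * 2 ^ j)) \<and> b \<in> k (n * 2 ^ j)" for j
  proof (induction j)
    case 0
    thus ?case using b m0[of n] by (simp add: \<eta>_def field_simps)
  next
    case (Suc j)
    define l where "l = n * 2 ^ j"
    have l: "l > 0" using n by (simp add: l_def)
    define Y where "Y = real m ^ l"
    have Y: "Y \<ge> 0" "sqrt Y ^ 2 = Y" by (simp_all add: Y_def)
    define t where "t = 4 ^ j * \<eta>"
    have t: "t \<ge> 0" using \<eta> by (simp add: t_def)
    have IH: "cmod (klo l b) \<ge> (2 + t) * sqrt Y" "b \<in> k l" using Suc by (simp_all add: l_def Y_def t_def)
    have "((2 + t) * sqrt Y)\<^sup>2 \<le> (cmod (klo l b))\<^sup>2" using IH t Y by (intro power_mono) auto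
    hence "(2 + t)\<^sup>2 * Y \<le> (cmod (klo l b))\<^sup>2" by (simp add: power_mult_distrib Y)
    moreover have "(2 + t)\<^sup>2 * Y \<ge> (4 + 4 * t) * Y"
      using t Y by (intro mult_right_mono) (auto simp: power2_eq_square algebra_simps)
    moreover have "cmod (klo (2 * l) b) \<ge> cmod ((klo l b)\<^sup>2) - cmod (of_nat (2 * CHAR('a) ^ l))"
      unfolding klo_double[OF l IH(2) b(2)] by (subst norm_minus_commute) (rule norm_triangle_ineq2)
    hence "cmod (klo (2 * l) b) \<ge> (cmod (klo l b))\<^sup>2 - 2 * Y"
      unfolding norm_power norm_of_nat by (simp add: Y_def m_def)
    ultimately have "cmod (klo (2 * l) b) \<ge> (2 + 4 * t) * Y" by (simp add: algebra_simps)
    moreover have "sqrt (real m ^ (2 * l)) = Y"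
      using Y by (simp add: Y_def power_mult mult.commute[of 2] real_sqrt_power)
    moreover have "b \<in> k (2 * l)" using IH frob_fixed_double by blast
    ultimately show ?case by (simp add: l_def t_def mult_ac)
  qed
  \<comment> \<open>The first condition contradicts the constant 8 p. The second gives \<nu> \<ge>
    8, which yields the condition 4 p \<le> p^\<nu> of the even case.\<close>
  obtain j where j: "4 ^ j * \<eta> > 8 * real m" "j \<ge> 4"
  proof -
    obtain i where i: "8 * real m / \<eta> < 4 ^ i" using real_arch_pow[of "4::real" "8 * real m / \<eta>"] by auto
    have "(4::real) ^ i \<le> 4 ^ (i + 4)" by (rule power_increasing) auto
    hence "4 ^ i * \<eta> \<le> 4 ^ (i + 4) * \<eta>" using \<eta> by (intro mult_right_mono) auto
    moreover have "8 * real m < 4 ^ i * \<eta>" using i \<eta> by (simp add: field_simps)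
    ultimately have "4 ^ (i + 4) * \<eta> > 8 * real m" by linarith
    thus ?thesis using that[of "i + 4"] by simp
  qed
  define \<nu> where "\<nu> = n * 2 ^ (j - 1)"
  have \<nu>: "n * 2 ^ j = 2 * \<nu>" using j by (cases j) (auto simp: \<nu>_def)
  have "(2::nat) ^ 3 \<le> 2 ^ (j - 1)" using j by (intro power_increasing) auto
  hence "\<nu> \<ge> 8" using n by (cases n) (auto simp: \<nu>_def)
  have "4 * m \<le> m ^ 3"
  proof -
    have "4 * m \<le> (3 * 3) * m" by simp
    also have "\<dots> \<le> (m * m) * m" using m by (intro mult_mono) auto
    finally show ?thesis by (simp add: power3_eq_cube)
  qed
  also have "\<dots> \<le> m ^ \<nu>" using \<open>\<nu> \<ge> 8\<close> m by (intro power_increasing) auto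
  finally have "cmod (klo (2 * \<nu>) b) \<le> 8 * m * m ^ \<nu>"
    using klo_bound_even[of \<nu> "m ^ \<nu>" b] grow[of j] \<open>\<nu> \<ge> 8\<close> b by (simp add: m_def \<nu>)
  moreover have "sqrt (real m ^ (2 * \<nu>)) = real m ^ \<nu>"
    by (metis power_even_eq real_sqrt_abs abs_of_nonneg zero_le_power of_nat_0_le_iff)
  hence "cmod (klo (2 * \<nu>) b) \<ge> (2 + 4 ^ j * \<eta>) * m ^ \<nu>"
    using grow[of j] by (simp add: \<nu>)
  ultimately have "(2 + 4 ^ j * \<eta>) * m ^ \<nu> \<le> 8 * m * m ^ \<nu>" by simp
  moreover have "real m ^ \<nu> > 0" using m by simp
  ultimately have "2 + 4 ^ j * \<eta> \<le> 8 * m" by simp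
  with j show False by simp
qed

end

section \<open>A character of a finite field\<close>

text \<open>Instead of a basis over the prime field, additive subgroups of order p^j are enlarged
  until they fill the field: an element v outside S gives p disjoint translates S + i v.\<close>

lemma card_finite_field_prime_power:
  obtains n where "n > 0" "card (UNIV :: 'k::finite_field set) = CHAR('k) ^ n"
proof -
  let ?p = "CHAR('k)"
  have p: "prime ?p" by simp
  have step: "(\<exists>n. card (UNIV :: 'k set) = ?p ^ n) \<or>
     (\<exists>S :: 'k set. 0 \<in> S \<and> (\<forall>x\<in>S. \<forall>y\<in>S. x + y \<in> S) \<and> card S = ?p ^ j)" for j
  proof (induction j)
    case 0
    have "card {0 :: 'k} = ?p ^ 0" by simp
    thus ?case by (intro disjI2 exI[of _ "{0}"]) auto
  next
    case (Suc j)
    show ?case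
    proof (cases "\<exists>n. card (UNIV :: 'k set) = ?p ^ n")
      case False
      with Suc obtain S :: "'k set" where S: "0 \<in> S" "\<And>x y. x \<in> S \<Longrightarrow> y \<in> S \<Longrightarrow> x + y \<in> S"
        "card S = ?p ^ j" by blast
      with False have "S \<noteq> UNIV" by metis
      then obtain v where v: "v \<notin> S" by auto
      have mult: "of_nat i * x \<in> S" if "x \<in> S" for i x
        by (induction i) (use that S in \<open>auto simp: algebra_simps\<close>)
      have neg: "- x \<in> S" if "x \<in> S" for x
      proof -
        have "of_nat (?p - 1) * x + x = of_nat (Suc (?p - 1)) * x"
          by (simp only: of_nat_Suc ring_distribs mult_1) (rule add.commute)
        also have "Suc (?p - 1) = ?p" by simp
        finally have "of_nat (?p - 1) * x = - x" by (simp only: eq_neg_iff_add_eq_0 of_nat_CHAR mult_zero_left)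
        thus ?thesis using mult[OF that] by metis
      qed
      define f where "f = (\<lambda>(s, i). s + of_nat i * v)"
      \<comment> \<open>If two translates met, d v would lie in S for some 0 < d < p. As d is
        invertible modulo p, v itself would lie in S.\<close>
      have aux: False if "s + of_nat i * v = s' + of_nat i' * v" "s \<in> S" "s' \<in> S" "i < i'" "i' < ?p" for s s' i i'
      proof -
        define d where "d = i' - i"
        have d: "0 < d" "d < ?p" using that by (auto simp: d_def)
        have "of_nat d * v = s - s'"
          using that by (simp add: d_def of_nat_diff algebra_simps)
        hence "of_nat d * v \<in> S" using S(2)[OF that(2) neg[OF that(3)]] by simp
        have "\<not> ?p dvd d" using d by (meson nat_dvd_not_less)
        hence "coprime d ?p" using p by (metis coprime_commute prime_imp_coprime)
        then obtain x where "[d * x = Suc 0] (mod ?p)" using cong_solve_coprime_nat by blast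
        hence "of_nat (d * x) = (1 :: 'k)"
          by (metis of_nat_eq_iff_cong_CHAR of_nat_1 One_nat_def)
        hence "of_nat x * of_nat d = (1 :: 'k)" by (simp only: of_nat_mult mult.commute)
        hence "v = of_nat x * (of_nat d * v)" by (simp only: mult.assoc[symmetric] mult_1)
        with mult[OF \<open>of_nat d * v \<in> S\<close>] v show False by metis
      qed
      have "inj_on f (S \<times> {..<?p})"
      proof (rule inj_onI)
        fix a b assume *: "a \<in> S \<times> {..<?p}" "b \<in> S \<times> {..<?p}" "f a = f b"
        obtain s i s' i' where ab: "a = (s, i)" "b = (s', i')" by (cases a; cases b)
        have si: "s + of_nat i * v = s' + of_nat i' * v" "s \<in> S" "s' \<in> S" "i < ?p" "i' < ?p"
          using * by (simp_all add: ab f_def)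
        have "i = i'"
        proof (rule linorder_cases[of i i'])
          assume "i < i'" with aux[OF si(1-3)] si show ?thesis by blast
        next
          assume "i' < i" with aux[OF si(1)[symmetric] si(3,2)] si show ?thesis by blast
        qed
        thus "a = b" using * by (simp add: ab f_def)
      qed
      hence "card (f ` (S \<times> {..<?p})) = ?p ^ Suc j"
        by (simp add: card_image card_cartesian_product S)
      moreover have "0 \<in> f ` (S \<times> {..<?p})"
        using S p by (intro image_eqI[of _ _ "(0, 0)"]) (auto simp: f_def prime_gt_0_nat)
      moreover have "x + y \<in> f ` (S \<times> {..<?p})" if xy: "x \<in> f ` (S \<times> {..<?p})" "y \<in> f ` (S \<times> {..<?p})" for x y
      proof -
        obtain s i s' i' where *: "x = s + of_nat i * v" "y = s' + of_nat i' * v" "s \<in> S" "s' \<in> S"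
          using xy by (auto simp: f_def)
        have "of_nat ((i + i') mod ?p) = (of_nat (i + i') :: 'k)"
          by (simp only: of_nat_eq_iff_cong_CHAR cong_def mod_mod_trivial)
        moreover have "x + y = (s + s') + of_nat (i + i') * v" by (simp add: * algebra_simps)
        ultimately have "x + y = f (s + s', (i + i') mod ?p)" by (simp only: f_def prod.case)
        moreover have "(s + s', (i + i') mod ?p) \<in> S \<times> {..<?p}" using * S by simp
        ultimately show ?thesis by blast
      qed
      ultimately show ?thesis
        by (intro disjI2 exI[of _ "f ` (S \<times> {..<?p})"] conjI ballI)
    qed auto
  qed
  have "\<exists>n. card (UNIV :: 'k set) = ?p ^ n"
  proof (rule ccontr)
    assume "\<nexists>n. card (UNIV :: 'k set) = ?p ^ n"
    \<comment> \<open>The cardinality c itself is used as the number of enlargements, since p^c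
      \<ge> 2^c > c.\<close>
    with step[of "card (UNIV :: 'k set)"] obtain S :: "'k set" where
      "card S = ?p ^ card (UNIV :: 'k set)" by blast
    moreover have "card S \<le> card (UNIV :: 'k set)" by (intro card_mono) auto
    moreover have "card (UNIV :: 'k set) < 2 ^ card (UNIV :: 'k set)" by simp
    moreover have "2 ^ card (UNIV :: 'k set) \<le> ?p ^ card (UNIV :: 'k set)"
      using p by (intro power_mono prime_ge_2_nat) auto
    ultimately show False by linarith
  qed
  then obtain n where n: "card (UNIV :: 'k set) = ?p ^ n" by blast
  have "card {0, 1 :: 'k} \<le> card (UNIV :: 'k set)" by (intro card_mono) auto
  with n have "n > 0" by (cases n) auto
  with n that show ?thesis by blast
qed

text \<open>The interface between the two halves of the proof: the harmonic analysis relies on these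
  properties of a character and no longer on the algebraic closure.\<close>

locale weil_character =
  fixes \<psi> :: "'k::finite_field \<Rightarrow> complex"
  assumes odd_card: "odd (card (UNIV :: 'k set))"
    and psi_add: "\<psi> (x + y) = \<psi> x * \<psi> y"
    and norm_psi [simp]: "cmod (\<psi> x) = 1"
    and psi_nontrivial: "\<exists>x. \<psi> x \<noteq> 1"
    and kloosterman_bound: "b \<noteq> 0 \<Longrightarrow> cmod (\<Sum>x\<in>UNIV - {0}. \<psi> (x + b / x)) \<le> 2 * sqrt (card (UNIV :: 'k set))"

text \<open>The image of the field in its algebraic closure consists of p^n elements fixed by the
  n-th power of Frobenius, so it is all of \<open>frob_fixed n\<close>. The character
  \<open>psi n\<close> is pulled back along this embedding.\<close>

lemma weil_character_exists:
  assumes "odd (card (UNIV :: 'k::finite_field set))"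
  obtains \<psi> :: "'k::finite_field \<Rightarrow> complex" where "weil_character \<psi>"
proof -
  obtain n where n: "n > 0" "card (UNIV :: 'k set) = CHAR('k) ^ n" by (rule card_finite_field_prime_power)
  interpret L: char_p_closed "TYPE('k alg_closure)"
    by unfold_locales simp
  obtain e :: "'k alg_closure \<Rightarrow> complex" where e:
    "\<And>u v. u \<in> frob_fixed 1 \<Longrightarrow> v \<in> frob_fixed 1 \<Longrightarrow> e (u + v) = e u * e v"
    "\<And>u. cmod (e u) = 1" "\<And>u. u \<in> frob_fixed 1 \<Longrightarrow> e u = 1 \<longleftrightarrow> u = 0"
    using L.prime_field_character by blast
  interpret L: char_p_character "TYPE('k alg_closure)" e
    using assms n e by unfold_locales simp_all
  have range: "range to_ac = (frob_fixed n :: 'k alg_closure set)"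
  proof (rule card_subset_eq)
    show "finite (frob_fixed n :: 'k alg_closure set)"
      using n L.prime_char by (intro finite_frob_fixed)
    show "range to_ac \<subseteq> (frob_fixed n :: 'k alg_closure set)"
      using finite_field_power_card_eq_same[where 'a='k] n(2)
      by (auto simp: frob_fixed_def simp flip: to_ac_power)
    show "card (range (to_ac :: 'k \<Rightarrow> _)) = card (frob_fixed n :: 'k alg_closure set)"
      using n card_frob_fixed[OF L.prime_char n(1)] by (simp add: card_image inj_to_ac)
  qed
  hence mem: "to_ac x \<in> frob_fixed n" for x :: 'k by auto
  define \<psi> where "\<psi> = (\<lambda>x :: 'k. L.psi n (to_ac x))"
  have "weil_character \<psi>"
  proof
    show "\<exists>x. \<psi> x \<noteq> 1"
    proof (rule ccontr)
      assume "\<nexists>x. \<psi> x \<noteq> 1"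
      hence "(\<Sum>x\<in>frob_fixed n. L.psi n x) = of_nat (card (frob_fixed n :: 'k alg_closure set))"
        unfolding range[symmetric] by (subst sum.cong[OF refl, of _ _ "\<lambda>_. 1"]) (auto simp: \<psi>_def)
      thus False using L.sum_psi[OF n(1)] n card_frob_fixed[OF L.prime_char n(1)] by simp
    qed
    fix b :: 'k assume b: "b \<noteq> 0"
    have "(\<Sum>x\<in>UNIV - {0}. \<psi> (x + b / x)) = L.klo n (to_ac b)"
      unfolding L.klo_def range[symmetric]
      by (rule sum.reindex_bij_witness[of _ of_ac to_ac]) (auto simp: \<psi>_def)
    thus "cmod (\<Sum>x\<in>UNIV - {0}. \<psi> (x + b / x)) \<le> 2 * sqrt (card (UNIV :: 'k set))"
      using L.klo_bound[OF n(1) mem[of b]] b n by simp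
  qed (use assms in \<open>auto simp: \<psi>_def L.norm_psi L.psi_add mem\<close>)
  thus ?thesis by (rule that)
qed

section \<open>The plane as a quadratic algebra\<close>

text \<open>The element x + i y with i^2 = -1. The matrix with rows (a, -b) and (b, a) is
  multiplication by a + i b, so rotations become elements of norm 1 and motions become ring
  arithmetic. If -1 is a square there are zero divisors, and cancellation has to go through
  \<open>gnorm\<close>.\<close>

datatype 'a gauss = Gauss (gre: 'a) (gim: 'a)

lemma gauss_eq_iff: "x = y \<longleftrightarrow> gre x = gre y \<and> gim x = gim y"
  by (cases x; cases y) simp

instantiation gauss :: (comm_ring_1) comm_ring_1
begin

definition "0 = Gauss 0 0"
definition "1 = Gauss 1 0"
definition "x + y = Gauss (gre x + gre y) (gim x + gim y)"
definition "x - y = Gauss (gre x - gre y) (gim x - gim y)"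
definition "- x = Gauss (- gre x) (- gim x)"
definition "x * y = Gauss (gre x * gre y - gim x * gim y) (gre x * gim y + gim x * gre y)"

lemma gauss_simps [simp]:
  "gre 0 = 0" "gim 0 = 0" "gre 1 = 1" "gim 1 = 0"
  "gre (x + y) = gre x + gre y" "gim (x + y) = gim x + gim y"
  "gre (x - y) = gre x - gre y" "gim (x - y) = gim x - gim y"
  "gre (- x) = - gre x" "gim (- x) = - gim x"
  "gre (x * y) = gre x * gre y - gim x * gim y"
  "gim (x * y) = gre x * gim y + gim x * gre y"
  by (simp_all add: zero_gauss_def one_gauss_def plus_gauss_def minus_gauss_def uminus_gauss_def times_gauss_def)

instance
  by standard (simp_all add: gauss_eq_iff algebra_simps)

end

lemma UNIV_gauss: "(UNIV :: 'a gauss set) = (\<lambda>(x, y). Gauss x y) ` UNIV"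
proof -
  have "x \<in> range (\<lambda>(x, y). Gauss x y)" for x :: "'a gauss"
    by (cases x) auto
  thus ?thesis by auto
qed

instance gauss :: (finite) finite
  by standard (simp add: UNIV_gauss)

lemma sum_gauss: "(\<Sum>x\<in>UNIV. f x) = (\<Sum>a\<in>UNIV. \<Sum>b\<in>UNIV. f (Gauss a b))"
  unfolding sum.cartesian_product
  by (rule sum.reindex_bij_witness[of _ "\<lambda>(a, b). Gauss a b" "\<lambda>x. (gre x, gim x)"]) auto

definition gcnj :: "'a::comm_ring_1 gauss \<Rightarrow> 'a gauss" where
  "gcnj x = Gauss (gre x) (- gim x)"

definition gnorm :: "'a::comm_ring_1 gauss \<Rightarrow> 'a" where
  "gnorm x = gre x * gre x + gim x * gim x"

definition gdot :: "'a::comm_ring_1 gauss \<Rightarrow> 'a gauss \<Rightarrow> 'a" where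
  "gdot x y = gre x * gre y + gim x * gim y"

definition gcirc :: "'a::comm_ring_1 gauss set" where
  "gcirc = {h. gnorm h = 1}"

lemma gcnj_simps [simp]: "gre (gcnj x) = gre x" "gim (gcnj x) = - gim x"
  by (simp_all add: gcnj_def)

lemma gcnj_gcnj [simp]: "gcnj (gcnj x) = x"
  by (simp add: gauss_eq_iff)

lemma gnorm_mult: "gnorm (x * y) = gnorm x * gnorm y"
  by (simp add: gnorm_def algebra_simps)

lemma gnorm_gcnj [simp]: "gnorm (gcnj x) = gnorm x"
  by (simp add: gnorm_def)

lemma gcnj_mult_self: "gcnj x * x = Gauss (gnorm x) 0"
  by (simp add: gauss_eq_iff gnorm_def algebra_simps)

text \<open>Multiplication by the conjugate is the adjoint. This turns a rotation of points into a
  rotation of frequencies.\<close>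

lemma gdot_mult: "gdot (h * z) \<xi> = gdot z (gcnj h * \<xi>)"
  by (simp add: gdot_def algebra_simps)

lemma gdot_add: "gdot (x + y) \<xi> = gdot x \<xi> + gdot y \<xi>"
  and gdot_0 [simp]: "gdot 0 \<xi> = 0" "gdot x 0 = 0"
  and gdot_commute: "gdot x \<xi> = gdot \<xi> x"
  by (simp_all add: gdot_def algebra_simps)

lemma gcirc_gcnj: "h \<in> gcirc \<Longrightarrow> gcnj h \<in> gcirc"
  and gcirc_mult: "h \<in> gcirc \<Longrightarrow> h' \<in> gcirc \<Longrightarrow> h * h' \<in> gcirc"
  by (simp_all add: gcirc_def gnorm_mult)

lemma gcirc_cancel [simp]:
  assumes "h \<in> gcirc"
  shows "gcnj h * h = 1" "h * gcnj h = 1" "gcnj h * (h * x) = x" "h * (gcnj h * x) = x"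
proof -
  show *: "gcnj h * h = 1" using assms by (simp add: gcnj_mult_self gcirc_def gauss_eq_iff)
  thus **: "h * gcnj h = 1" by (simp add: mult.commute)
  show "gcnj h * (h * x) = x" "h * (gcnj h * x) = x"
    using * ** by (simp_all flip: mult.assoc)
qed

lemma gnorm_neq_0_cancel:
  fixes c :: "'a::idom gauss"
  assumes "gnorm c \<noteq> 0"
  shows "c * x = c * y \<longleftrightarrow> x = y"
proof
  assume "c * x = c * y"
  hence "gcnj c * c * x = gcnj c * c * y" by (simp add: mult.assoc)
  thus "x = y" using assms by (simp add: gcnj_mult_self gauss_eq_iff)
qed simp

text \<open>The point is that \<xi> may be a zero divisor. For u = \<open>gcnj h * h'\<close> the
  element u - 1 annihilates \<xi>, so its norm 2 - 2 Re u is zero; Re u = 1 and norm 1 then leave Im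
  u = 0.\<close>

lemma gcirc_free:
  fixes h h' \<xi> :: "'a::idom gauss"
  assumes h: "h \<in> gcirc" and h': "h' \<in> gcirc" and eq: "h * \<xi> = h' * \<xi>" and \<xi>: "\<xi> \<noteq> 0"
    and two: "(2 :: 'a) \<noteq> 0"
  shows "h = h'"
proof -
  define u where "u = gcnj h * h'"
  have u: "gnorm u = 1" using h h' by (simp add: u_def gnorm_mult gcirc_def)
  have "u * \<xi> = gcnj h * (h * \<xi>)" unfolding eq by (simp add: u_def mult.assoc)
  hence u\<xi>: "u * \<xi> = 1 * \<xi>" using h by simp
  hence "(u - 1) * \<xi> = (u - 1) * 0" by (simp only: left_diff_distrib) simp
  hence "gnorm (u - 1) = 0" using gnorm_neq_0_cancel \<xi> by blast
  moreover have "gnorm (u - 1) = gnorm u + 1 - 2 * gre u"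
    by (simp add: gnorm_def algebra_simps)
  ultimately have "2 * (1 - gre u) = 0" using u by (simp add: algebra_simps)
  hence "gre u = 1" using two by simp
  moreover from this u have "gim u = 0" by (simp add: gnorm_def)
  ultimately have "u = 1" by (simp add: gauss_eq_iff)
  thus "h = h'" using h by (metis gcirc_cancel(4) mult.right_neutral u_def)
qed

section \<open>Orthogonality and the Fourier transform on the plane\<close>

context weil_character
begin

definition q :: real where "q = real (card (UNIV :: 'k set))"

lemma q_pos: "q > 0" by (simp add: q_def finite_UNIV_card_ge_0)

lemma two_neq_0: "(2 :: 'k) \<noteq> 0"
proof
  assume "(2 :: 'k) = 0"
  hence "CHAR('k) dvd 2" using of_nat_eq_0_iff_char_dvd[of 2, where 'a='k] by simp
  hence "CHAR('k) \<le> 2" by (rule dvd_imp_le) simp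
  moreover have "CHAR('k) \<ge> 2" by (simp add: prime_ge_2_nat)
  ultimately have "CHAR('k) = 2" by simp
  moreover obtain n where "n > 0" "card (UNIV :: 'k set) = CHAR('k) ^ n" by (rule card_finite_field_prime_power)
  ultimately show False using odd_card by simp
qed

lemma psi_0 [simp]: "\<psi> 0 = 1"
proof -
  have "\<psi> 0 \<noteq> 0" using norm_psi[of 0] by (metis norm_zero zero_neq_one)
  thus ?thesis using psi_add[of 0 0] by simp
qed

lemma psi_uminus: "\<psi> (- x) = cnj (\<psi> x)"
proof -
  have "\<psi> (- x) * \<psi> x = 1" by (simp flip: psi_add)
  moreover have "cnj (\<psi> x) * \<psi> x = 1"
    using norm_psi[of x] complex_norm_square[of "\<psi> x"] by (simp add: mult.commute)
  ultimately show ?thesis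
    by (metis mult_right_cancel mult_zero_right zero_neq_one)
qed

lemma sum_psi_mult: "(\<Sum>x\<in>UNIV. \<psi> (x * c)) = (if c = 0 then of_real q else 0)"
proof (cases "c = 0")
  case False
  obtain y where y: "\<psi> y \<noteq> 1" using psi_nontrivial by blast
  have "(\<Sum>x\<in>UNIV. \<psi> (x * c)) = (\<Sum>x\<in>UNIV. \<psi> x)"
    using False by (intro sum.reindex_bij_witness[of _ "\<lambda>x. x / c" "\<lambda>x. x * c"]) auto
  also have "\<dots> = (\<Sum>x\<in>UNIV. \<psi> (y + x))"
    by (rule sum.reindex_bij_witness[of _ "\<lambda>x. y + x" "\<lambda>x. x - y"]) auto
  also have "\<dots> = \<psi> y * (\<Sum>x\<in>UNIV. \<psi> x)" by (simp add: psi_add sum_distrib_left)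
  finally have "(\<Sum>x\<in>UNIV. \<psi> (x * c)) = (\<Sum>x\<in>UNIV. \<psi> x)" "(\<Sum>x\<in>UNIV. \<psi> x) = \<psi> y * (\<Sum>x\<in>UNIV. \<psi> x)"
    using \<open>(\<Sum>x\<in>UNIV. \<psi> (x * c)) = (\<Sum>x\<in>UNIV. \<psi> x)\<close> by simp_all
  with y False show ?thesis by simp
qed (simp add: q_def)

lemma sum_psi_gdot: "(\<Sum>z\<in>UNIV. \<psi> (gdot z \<xi>)) = (if \<xi> = 0 then of_real (q\<^sup>2) else 0)"
proof -
  have "(\<Sum>z\<in>UNIV. \<psi> (gdot z \<xi>)) = (\<Sum>a\<in>UNIV. \<psi> (a * gre \<xi>)) * (\<Sum>b\<in>UNIV. \<psi> (b * gim \<xi>))"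
    by (simp add: sum_gauss gdot_def psi_add sum_product)
  thus ?thesis by (simp add: sum_psi_mult gauss_eq_iff power2_eq_square)
qed

definition ghat :: "('k gauss \<Rightarrow> complex) \<Rightarrow> 'k gauss \<Rightarrow> complex" where
  "ghat f \<xi> = (\<Sum>z\<in>UNIV. f z * \<psi> (gdot z \<xi>))"

lemma psi_gdot_diff: "\<psi> (gdot \<xi> (z - w)) = \<psi> (gdot z \<xi>) * cnj (\<psi> (gdot w \<xi>))"
proof -
  have "gdot \<xi> (z - w) = gdot z \<xi> + - gdot w \<xi>" by (simp add: gdot_def algebra_simps)
  thus ?thesis by (simp only: psi_add psi_uminus)
qed

lemma parseval: "(\<Sum>\<xi>\<in>UNIV. (cmod (ghat f \<xi>))\<^sup>2) = q\<^sup>2 * (\<Sum>z\<in>UNIV. (cmod (f z))\<^sup>2)"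
proof -
  have "of_real (\<Sum>\<xi>\<in>UNIV. (cmod (ghat f \<xi>))\<^sup>2) = (\<Sum>\<xi>\<in>UNIV. ghat f \<xi> * cnj (ghat f \<xi>))"
    by (simp only: of_real_sum complex_norm_square)
  also have "\<dots> = (\<Sum>\<xi>\<in>UNIV. \<Sum>z\<in>UNIV. \<Sum>w\<in>UNIV. f z * cnj (f w) * \<psi> (gdot \<xi> (z - w)))"
    unfolding ghat_def cnj_sum sum_product
    by (simp add: psi_gdot_diff mult_ac)
  also have "\<dots> = (\<Sum>z\<in>UNIV. \<Sum>w\<in>UNIV. f z * cnj (f w) * (\<Sum>\<xi>\<in>UNIV. \<psi> (gdot \<xi> (z - w))))"
    by (subst sum.swap, rule sum.cong, rule refl, subst sum.swap) (simp add: sum_distrib_left)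
  also have "\<dots> = (\<Sum>z\<in>UNIV. \<Sum>w\<in>UNIV. if w = z then f z * cnj (f z) * of_real (q\<^sup>2) else 0)"
    by (intro sum.cong refl) (auto simp: sum_psi_gdot)
  also have "\<dots> = (\<Sum>z\<in>UNIV. f z * cnj (f z) * of_real (q\<^sup>2))"
    by (simp add: sum.delta)
  also have "\<dots> = of_real (q\<^sup>2 * (\<Sum>z\<in>UNIV. (cmod (f z))\<^sup>2))"
    by (simp add: sum_distrib_left mult.commute flip: complex_norm_square)
  finally show ?thesis by (simp only: of_real_eq_iff)
qed

end

section \<open>Representations by products of rigid motions\<close>

fun gmul :: "'a::comm_ring_1 gauss \<times> 'a gauss \<Rightarrow> 'a gauss \<times> 'a gauss \<Rightarrow> 'a gauss \<times> 'a gauss" where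
  "gmul (z, h) (z', h') = (z + h * z', h * h')"

text \<open>Cauchy-Schwarz on the support. Applied to representation numbers, it converts an energy
  bound into a lower bound for the product set.\<close>

lemma sum_squared_le_card_support:
  fixes f :: "'b \<Rightarrow> real"
  assumes "finite S"
  shows "(\<Sum>x\<in>S. f x)\<^sup>2 \<le> card {x \<in> S. f x \<noteq> 0} * (\<Sum>x\<in>S. (f x)\<^sup>2)"
proof -
  have "(\<Sum>x\<in>S. f x) = (\<Sum>x\<in>{x \<in> S. f x \<noteq> 0}. 1 * f x)"
    using assms by (intro sum.mono_neutral_cong_right) auto
  hence "(\<Sum>x\<in>S. f x)\<^sup>2 \<le> (\<Sum>x\<in>{x \<in> S. f x \<noteq> 0}. 1\<^sup>2) * (\<Sum>x\<in>{x \<in> S. f x \<noteq> 0}. (f x)\<^sup>2)"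
    using Cauchy_Schwarz_ineq_sum[of "\<lambda>_. 1" f "{x \<in> S. f x \<noteq> 0}"] by simp
  also have "(\<Sum>x\<in>{x \<in> S. f x \<noteq> 0}. (f x)\<^sup>2) = (\<Sum>x\<in>S. (f x)\<^sup>2)"
    using assms by (intro sum.mono_neutral_left) auto
  finally show ?thesis by simp
qed

context weil_character
begin

text \<open>
  The second moment of the number \<open>r\<close> of representations is computed on the Fourier side. The zero
  frequency only sees the sizes of the fibres. As the circle acts freely on the other frequencies,
  averaging over it there costs no more than one application of Parseval's identity.
\<close>
lemma card_product_set:
  fixes A :: "('k gauss \<times> 'k gauss) set" and K :: real
  assumes A: "A \<subseteq> UNIV \<times> gcirc" and K: "\<And>h. card {z. (z, h) \<in> A} \<le> K"
  shows "real (card A) ^ 4 \<le> card (case_prod gmul ` (A \<times> A)) * (real (card A) ^ 3 * K / q\<^sup>2 + q\<^sup>2 * real (card A) ^ 2)"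
proof -
  define M where "M = real (card A)"
  define ind :: "'k gauss \<Rightarrow> 'k gauss \<Rightarrow> complex" where "ind = (\<lambda>h z. of_bool ((z, h) \<in> A))"
  define a where "a = (\<lambda>h. ghat (ind h))"
  define n where "n = (\<lambda>h. real (card {z. (z, h) \<in> A}))"
  \<comment> \<open>The first factor (z1, h1) of a product (z, h) determines the second one by
    division, so r h z counts the representations of (z, h).\<close>
  define r where "r = (\<lambda>h z. \<Sum>h1\<in>gcirc. \<Sum>z1\<in>UNIV.
    of_bool ((z1, h1) \<in> A) * of_bool ((gcnj h1 * (z - z1), gcnj h1 * h) \<in> A) :: real)"
  let ?H = "gcirc :: 'k gauss set"
  have finH: "finite ?H" by simp
  have of_bool_real: "complex_of_real (of_bool b) = of_bool b" for b by (cases b) simp_all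
  \<comment> \<open>The product of motions is a convolution twisted by rotations. Its Fourier
    transform is a convolution over the circle only, with the frequency of the second factor
    rotated.\<close>
  have ghat_r: "ghat (\<lambda>z. of_real (r h z)) \<xi> = (\<Sum>h1\<in>?H. a h1 \<xi> * a (gcnj h1 * h) (gcnj h1 * \<xi>))" for h \<xi>
  proof -
    have "ghat (\<lambda>z. of_real (r h z)) \<xi> = (\<Sum>z\<in>UNIV. \<Sum>h1\<in>?H. \<Sum>z1\<in>UNIV.
        ind h1 z1 * ind (gcnj h1 * h) (gcnj h1 * (z - z1)) * \<psi> (gdot z \<xi>))"
      by (simp add: ghat_def r_def ind_def sum_distrib_right of_bool_real
          del: sum_of_bool_mult_eq sum_mult_of_bool_eq sum_of_bool_eq)
    also have "\<dots> = (\<Sum>h1\<in>?H. \<Sum>z1\<in>UNIV. \<Sum>z\<in>UNIV.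
        ind h1 z1 * ind (gcnj h1 * h) (gcnj h1 * (z - z1)) * \<psi> (gdot z \<xi>))"
      by (subst sum.swap, rule sum.cong, rule refl, rule sum.swap)
    also have "\<dots> = (\<Sum>h1\<in>?H. \<Sum>z1\<in>UNIV. \<Sum>z2\<in>UNIV.
        (ind h1 z1 * \<psi> (gdot z1 \<xi>)) * (ind (gcnj h1 * h) z2 * \<psi> (gdot z2 (gcnj h1 * \<xi>))))"
    proof (rule sum.cong[OF refl], rule sum.cong[OF refl])
      fix h1 z1 assume h1: "h1 \<in> ?H"
      show "(\<Sum>z\<in>UNIV. ind h1 z1 * ind (gcnj h1 * h) (gcnj h1 * (z - z1)) * \<psi> (gdot z \<xi>)) =
        (\<Sum>z2\<in>UNIV. (ind h1 z1 * \<psi> (gdot z1 \<xi>)) * (ind (gcnj h1 * h) z2 * \<psi> (gdot z2 (gcnj h1 * \<xi>))))"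
      proof (rule sum.reindex_bij_witness[of _ "\<lambda>z2. z1 + h1 * z2" "\<lambda>z. gcnj h1 * (z - z1)"])
        fix z
        have "gdot z \<xi> = gdot (z1 + h1 * (gcnj h1 * (z - z1))) \<xi>" using h1 by simp
        also have "\<dots> = gdot z1 \<xi> + gdot (gcnj h1 * (z - z1)) (gcnj h1 * \<xi>)"
          by (simp only: gdot_add gdot_mult)
        finally show "ind h1 z1 * \<psi> (gdot z1 \<xi>) * (ind (gcnj h1 * h) (gcnj h1 * (z - z1)) *
          \<psi> (gdot (gcnj h1 * (z - z1)) (gcnj h1 * \<xi>))) =
          ind h1 z1 * ind (gcnj h1 * h) (gcnj h1 * (z - z1)) * \<psi> (gdot z \<xi>)"
          by (simp add: psi_add)
      qed (use h1 in auto)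
    qed
    also have "\<dots> = (\<Sum>h1\<in>?H. a h1 \<xi> * a (gcnj h1 * h) (gcnj h1 * \<xi>))"
      by (simp add: a_def ghat_def sum_product)
    finally show ?thesis .
  qed
  have a0: "a h 0 = of_real (n h)" for h
    by (simp add: a_def ghat_def ind_def n_def of_bool_def sum.If_cases)
  have sum_a: "(\<Sum>\<xi>\<in>UNIV. (cmod (a h \<xi>))\<^sup>2) = q\<^sup>2 * n h" for h
    unfolding a_def parseval
    by (simp add: ind_def n_def of_bool_def if_distrib[of cmod] if_distrib[of "\<lambda>x. x\<^sup>2"] sum.If_cases cong: if_cong)
  have "A = (\<Union>h\<in>?H. (\<lambda>z. (z, h)) ` {z. (z, h) \<in> A})" using A by auto
  hence "card A = card (\<Union>h\<in>?H. (\<lambda>z. (z, h)) ` {z. (z, h) \<in> A})" by simp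
  also have "\<dots> = (\<Sum>h\<in>?H. card ((\<lambda>z. (z, h)) ` {z. (z, h) \<in> A}))"
    by (rule card_UN_disjoint) auto
  also have "\<dots> = (\<Sum>h\<in>?H. card {z. (z, h) \<in> A})"
    by (intro sum.cong refl card_image) (auto simp: inj_on_def)
  finally have sum_n: "(\<Sum>h\<in>?H. n h) = M" by (simp add: M_def n_def)
  have n_ge_0: "n h \<ge> 0" for h by (simp add: n_def)
  have shift: "(\<Sum>h\<in>?H. f (gcnj h1 * h)) = (\<Sum>h\<in>?H. f h)" if "h1 \<in> ?H" for h1 and f :: "_ \<Rightarrow> real"
    using that by (intro sum.reindex_bij_witness[of _ "\<lambda>h. h1 * h" "\<lambda>h. gcnj h1 * h"]) (auto intro: gcirc_mult gcirc_gcnj)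
  have shift': "(\<Sum>h\<in>?H. f (gcnj h)) = (\<Sum>h\<in>?H. f h)" for f :: "_ \<Rightarrow> real"
    by (intro sum.reindex_bij_witness[of _ gcnj gcnj]) (auto intro: gcirc_gcnj)
  have "ghat (\<lambda>z. of_real (r h z)) 0 = of_real (\<Sum>z\<in>UNIV. r h z)" for h by (simp add: ghat_def)
  hence "of_real (\<Sum>z\<in>UNIV. r h z) = (of_real (\<Sum>h1\<in>?H. n h1 * n (gcnj h1 * h)) :: complex)" for h
    unfolding ghat_r by (simp add: a0)
  hence sum_r: "(\<Sum>z\<in>UNIV. r h z) = (\<Sum>h1\<in>?H. n h1 * n (gcnj h1 * h))" for h
    by (simp only: of_real_eq_iff)
  have total: "(\<Sum>h\<in>?H. \<Sum>h1\<in>?H. n h1 * n (gcnj h1 * h)) = M\<^sup>2"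
    by (subst sum.swap) (simp add: shift sum_n power2_eq_square flip: sum_distrib_left sum_distrib_right)
  define B where "B = (\<lambda>\<xi>. \<Sum>h\<in>?H. (cmod (a h \<xi>))\<^sup>2)"
  have shift_B: "(\<Sum>h\<in>?H. (cmod (a (gcnj h1 * h) \<xi>))\<^sup>2) = B \<xi>" if "h1 \<in> ?H" for h1 \<xi>
    unfolding B_def using that by (rule shift)
  have B_ge_0: "B \<xi> \<ge> 0" for \<xi> by (simp add: B_def sum_nonneg)
  have sum_B: "(\<Sum>\<xi>\<in>UNIV. B \<xi>) = q\<^sup>2 * M"
    unfolding B_def by (subst sum.swap) (simp add: sum_a sum_n flip: sum_distrib_left)
  \<comment> \<open>The zero frequency is the convolution of fibre sizes on the circle. One factor
    of its square is bounded by K M, and the other sums to M^2.\<close>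
  have zero_freq: "(\<Sum>h\<in>?H. (cmod (ghat (\<lambda>z. of_real (r h z)) 0))\<^sup>2) \<le> M ^ 3 * K"
  proof -
    have "(\<Sum>h\<in>?H. (cmod (ghat (\<lambda>z. of_real (r h z)) 0))\<^sup>2) = (\<Sum>h\<in>?H. (\<Sum>h1\<in>?H. n h1 * n (gcnj h1 * h))\<^sup>2)"
      by (simp add: ghat_def sum_r del: of_real_sum flip: of_real_sum)
    also have "\<dots> \<le> (\<Sum>h\<in>?H. (K * M) * (\<Sum>h1\<in>?H. n h1 * n (gcnj h1 * h)))"
    proof (intro sum_mono)
      fix h
      have "(\<Sum>h1\<in>?H. n h1 * n (gcnj h1 * h)) \<le> (\<Sum>h1\<in>?H. n h1 * K)"
        using K n_ge_0 by (intro sum_mono mult_left_mono) (auto simp: n_def)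
      also have "\<dots> = K * M" by (subst sum_distrib_right[symmetric]) (simp add: sum_n)
      finally show "(\<Sum>h1\<in>?H. n h1 * n (gcnj h1 * h))\<^sup>2 \<le> (K * M) * (\<Sum>h1\<in>?H. n h1 * n (gcnj h1 * h))"
        unfolding power2_eq_square using n_ge_0 by (intro mult_right_mono sum_nonneg) auto
    qed
    also have "\<dots> = M ^ 3 * K"
      by (simp add: total power2_eq_square power3_eq_cube flip: sum_distrib_left)
    finally show ?thesis .
  qed
  \<comment> \<open>After Cauchy-Schwarz in h1, the sum over h turns the second factor into B at a
    rotation of \<xi>. Freeness makes the orbit of \<xi> injective, so the sum over rotations is at
    most the sum of B over the whole plane.\<close>
  have nonzero_freq: "(\<Sum>h\<in>?H. \<Sum>\<xi>\<in>UNIV-{0}. (cmod (ghat (\<lambda>z. of_real (r h z)) \<xi>))\<^sup>2) \<le> (q\<^sup>2 * M)\<^sup>2"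
  proof -
    have "(cmod (ghat (\<lambda>z. of_real (r h z)) \<xi>))\<^sup>2 \<le>
        B \<xi> * (\<Sum>h1\<in>?H. (cmod (a (gcnj h1 * h) (gcnj h1 * \<xi>)))\<^sup>2)" for h \<xi>
    proof -
      have "cmod (ghat (\<lambda>z. of_real (r h z)) \<xi>) \<le> (\<Sum>h1\<in>?H. cmod (a h1 \<xi>) * cmod (a (gcnj h1 * h) (gcnj h1 * \<xi>)))"
        unfolding ghat_r by (rule sum_norm_le) (simp add: norm_mult)
      hence "(cmod (ghat (\<lambda>z. of_real (r h z)) \<xi>))\<^sup>2 \<le> (\<Sum>h1\<in>?H. cmod (a h1 \<xi>) * cmod (a (gcnj h1 * h) (gcnj h1 * \<xi>)))\<^sup>2"
        by (intro power_mono) auto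
      also have "\<dots> \<le> B \<xi> * (\<Sum>h1\<in>?H. (cmod (a (gcnj h1 * h) (gcnj h1 * \<xi>)))\<^sup>2)"
        unfolding B_def by (rule Cauchy_Schwarz_ineq_sum)
      finally show ?thesis .
    qed
    hence "(\<Sum>h\<in>?H. \<Sum>\<xi>\<in>UNIV-{0}. (cmod (ghat (\<lambda>z. of_real (r h z)) \<xi>))\<^sup>2) \<le>
      (\<Sum>h\<in>?H. \<Sum>\<xi>\<in>UNIV-{0}. B \<xi> * (\<Sum>h1\<in>?H. (cmod (a (gcnj h1 * h) (gcnj h1 * \<xi>)))\<^sup>2))"
      by (intro sum_mono)
    also have "\<dots> = (\<Sum>\<xi>\<in>UNIV-{0}. B \<xi> * (\<Sum>h1\<in>?H. \<Sum>h\<in>?H. (cmod (a (gcnj h1 * h) (gcnj h1 * \<xi>)))\<^sup>2))"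
      by (subst sum.swap, rule sum.cong[OF refl], subst sum_distrib_left[symmetric], subst sum.swap, rule refl)
    also have "\<dots> = (\<Sum>\<xi>\<in>UNIV-{0}. B \<xi> * (\<Sum>h1\<in>?H. B (gcnj h1 * \<xi>)))"
      by (simp add: shift_B)
    also have "\<dots> \<le> (\<Sum>\<xi>\<in>UNIV-{0}. B \<xi> * (q\<^sup>2 * M))"
    proof (intro sum_mono mult_left_mono)
      fix \<xi> :: "'k gauss" assume \<xi>: "\<xi> \<in> UNIV - {0}"
      have "(\<Sum>h1\<in>?H. B (gcnj h1 * \<xi>)) = (\<Sum>h1\<in>?H. B (h1 * \<xi>))" by (rule shift')
      also have "\<dots> = sum B ((\<lambda>h1. h1 * \<xi>) ` ?H)"
      proof (subst sum.reindex)
        show "inj_on (\<lambda>h1. h1 * \<xi>) ?H"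
          by (rule inj_onI) (use gcirc_free \<xi> two_neq_0 in auto)
      qed simp
      also have "\<dots> \<le> sum B UNIV" by (intro sum_mono2) (auto simp: B_ge_0)
      finally show "(\<Sum>h1\<in>?H. B (gcnj h1 * \<xi>)) \<le> q\<^sup>2 * M" by (simp add: sum_B)
    qed (simp add: B_ge_0)
    also have "\<dots> = (\<Sum>\<xi>\<in>UNIV-{0}. B \<xi>) * (q\<^sup>2 * M)" by (simp add: sum_distrib_right)
    also have "\<dots> \<le> (\<Sum>\<xi>\<in>UNIV. B \<xi>) * (q\<^sup>2 * M)"
      by (intro mult_right_mono sum_mono2) (auto simp: B_ge_0 M_def)
    finally show ?thesis by (simp add: sum_B power2_eq_square)
  qed
  define R where "R = (\<Sum>h\<in>?H. \<Sum>z\<in>UNIV. (r h z)\<^sup>2)"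
  have "q\<^sup>2 * R = (\<Sum>h\<in>?H. \<Sum>\<xi>\<in>UNIV. (cmod (ghat (\<lambda>z. of_real (r h z)) \<xi>))\<^sup>2)"
    unfolding parseval R_def by (simp add: sum_distrib_left)
  also have "\<dots> = (\<Sum>h\<in>?H. (cmod (ghat (\<lambda>z. of_real (r h z)) 0))\<^sup>2) +
      (\<Sum>h\<in>?H. \<Sum>\<xi>\<in>UNIV-{0}. (cmod (ghat (\<lambda>z. of_real (r h z)) \<xi>))\<^sup>2)"
    by (subst sum.remove[of UNIV 0]) (auto simp: sum.distrib)
  also have "\<dots> \<le> M ^ 3 * K + (q\<^sup>2 * M)\<^sup>2" by (intro add_mono zero_freq nonzero_freq)
  finally have "q\<^sup>2 * R \<le> q\<^sup>2 * (M ^ 3 * K / q\<^sup>2 + q\<^sup>2 * M\<^sup>2)"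
    using q_pos by (simp add: field_simps power2_eq_square)
  hence R: "R \<le> M ^ 3 * K / q\<^sup>2 + q\<^sup>2 * M\<^sup>2" using q_pos by simp
  define S where "S = ?H \<times> (UNIV :: 'k gauss set)"
  have "M ^ 4 = (\<Sum>(h, z)\<in>S. r h z)\<^sup>2"
    using total by (simp add: S_def sum_r flip: sum.cartesian_product)
  also have "\<dots> \<le> card {x \<in> S. (case x of (h, z) \<Rightarrow> r h z) \<noteq> 0} * (\<Sum>x\<in>S. (case x of (h, z) \<Rightarrow> r h z)\<^sup>2)"
    by (rule sum_squared_le_card_support) (simp add: S_def)
  also have "(\<Sum>x\<in>S. (case x of (h, z) \<Rightarrow> r h z)\<^sup>2) = R"
    unfolding R_def S_def sum.cartesian_product by (intro sum.cong) auto
  \<comment> \<open>A nonzero r h z exhibits (z, h) as a product. \<open>prod.swap\<close> only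
    restores the order of components, as S lists rotations first.\<close>
  also have "card {x \<in> S. (case x of (h, z) \<Rightarrow> r h z) \<noteq> 0} \<le> card (case_prod gmul ` (A \<times> A))"
  proof (rule card_inj_on_le[of prod.swap])
    show "prod.swap ` {x \<in> S. (case x of (h, z) \<Rightarrow> r h z) \<noteq> 0} \<subseteq> case_prod gmul ` (A \<times> A)"
    proof (safe, goal_cases)
      case (1 _ _ h z)
      then obtain h1 z1 where *: "h1 \<in> ?H" "(z1, h1) \<in> A" "(gcnj h1 * (z - z1), gcnj h1 * h) \<in> A"
        unfolding r_def by (auto elim!: sum.not_neutral_contains_not_neutral)
      hence "(z, h) = case_prod gmul ((z1, h1), (gcnj h1 * (z - z1), gcnj h1 * h))" by simp
      with * 1 show ?case by (metis (no_types, lifting) SigmaI image_eqI swap_simp)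
    qed
  qed auto
  hence "card {x \<in> S. (case x of (h, z) \<Rightarrow> r h z) \<noteq> 0} * R \<le> card (case_prod gmul ` (A \<times> A)) * (M ^ 3 * K / q\<^sup>2 + q\<^sup>2 * M\<^sup>2)"
    using R by (intro mult_mono) (auto simp: R_def sum_nonneg)
  finally show ?thesis by (simp add: M_def)
qed

end

section \<open>Counting distances\<close>

definition motions :: "'a::comm_ring_1 gauss set \<Rightarrow> 'a \<Rightarrow> 'a gauss \<Rightarrow> 'a gauss \<Rightarrow> ('a gauss \<times> 'a gauss) set" where
  "motions E t u v = {(z, h). h \<in> gcirc \<and> (\<exists>x\<in>E. \<exists>y\<in>E. gnorm (x - y) = t \<and> z + h * x = u \<and> z + h * y = v)}"

context weil_character
begin

text \<open>The set of squares has more than q / 2 elements, since a nonzero square has at most two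
  roots; hence it meets its reflection x -> s - x.\<close>

lemma sum_two_squares: "\<exists>c. gnorm c = (s :: 'k)"
proof -
  define S1 where "S1 = range (\<lambda>a :: 'k. a * a)"
  define S2 where "S2 = (\<lambda>x. s - x) ` S1"
  have "0 \<in> S1" by (auto simp: S1_def)
  hence cards: "card (S1 - {0}) = card S1 - 1" "card S1 > 0"
    by (simp_all add: card_gt_0_iff) auto
  have "UNIV - {0 :: 'k} = (\<Union>y\<in>S1 - {0}. {a. a * a = y})" by (auto simp: S1_def)
  hence "card (UNIV - {0 :: 'k}) = card (\<Union>y\<in>S1 - {0}. {a. a * a = y})" by simp
  also have "\<dots> \<le> (\<Sum>y\<in>S1 - {0}. card {a. a * a = y})" by (rule card_UN_le) simp
  also have "\<dots> \<le> (\<Sum>y\<in>S1 - {0}. 2)"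
  proof (rule sum_mono)
    fix y assume "y \<in> S1 - {0}"
    then obtain b where "y = b * b" by (auto simp: S1_def)
    hence "{a. a * a = y} \<subseteq> {b, - b}" by (auto simp: square_eq_iff)
    hence "card {a. a * a = y} \<le> card {b, - b}" by (intro card_mono) auto
    also have "\<dots> \<le> 2" by (simp add: card_insert_if)
    finally show "card {a. a * a = y} \<le> 2" .
  qed
  finally have "card (UNIV :: 'k set) < 2 * card S1"
    using cards by simp
  moreover have "card S2 = card S1" unfolding S2_def by (rule card_image) (auto simp: inj_on_def)
  moreover have "card (S1 \<union> S2) \<le> card (UNIV :: 'k set)" by (intro card_mono) auto
  ultimately have "S1 \<inter> S2 \<noteq> {}" using card_Un_disjoint[of S1 S2] by auto
  then obtain a b where "a * a = s - b * b" by (auto simp: S1_def S2_def)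
  hence "gnorm (Gauss a b) = s" by (simp add: gnorm_def)
  thus ?thesis by blast
qed

section \<open>Gauss sums and the Fourier transform of a circle\<close>

definition gauss_sum :: "'k \<Rightarrow> complex" where
  "gauss_sum s = (\<Sum>x\<in>UNIV. \<psi> (s * gnorm x))"

text \<open>Multiplication by an element of norm s permutes the plane and scales the norm by s. In
  two variables no quadratic character of s remains, and so the circle leads to an ordinary
  Kloosterman sum.\<close>

lemma gauss_sum_const:
  assumes "s \<noteq> 0"
  shows "gauss_sum s = gauss_sum 1"
proof -
  obtain c :: "'k gauss" where c: "gnorm c = s" using sum_two_squares by blast
  have inj: "inj (\<lambda>x. c * x)" using assms c by (intro injI) (simp add: gnorm_neq_0_cancel)
  hence "surj (\<lambda>x. c * x)" by (rule finite_UNIV_inj_surj[OF finite])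
  hence "gauss_sum 1 = sum (\<lambda>x. \<psi> (gnorm x)) (range (\<lambda>x. c * x))" by (simp add: gauss_sum_def)
  also have "\<dots> = gauss_sum s"
    by (subst sum.reindex[OF inj]) (simp add: gauss_sum_def gnorm_mult c)
  finally show ?thesis by simp
qed

lemma norm_gauss_sum: "cmod (gauss_sum 1) = q"
proof -
  define G where "G = (\<Sum>a\<in>UNIV. \<psi> (a * a))"
  have "gauss_sum 1 = G * G"
    by (simp add: gauss_sum_def G_def sum_gauss gnorm_def psi_add sum_product)
  moreover have "G * cnj G = of_real q"
  proof -
    have "G * cnj G = (\<Sum>b\<in>UNIV. \<Sum>a\<in>UNIV. \<psi> (a * a) * \<psi> (- (b * b)))"
      unfolding G_def cnj_sum sum_product by (subst sum.swap) (simp add: psi_uminus)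
    \<comment> \<open>With a = b + w one has a^2 - b^2 = w^2 + 2 b w, which is linear in b; the sum
      over b leaves only w = 0.\<close>
    also have "\<dots> = (\<Sum>b\<in>UNIV. \<Sum>w\<in>UNIV. \<psi> (w * w) * \<psi> (b * (2 * w)))"
    proof (rule sum.cong[OF refl])
      fix b
      show "(\<Sum>a\<in>UNIV. \<psi> (a * a) * \<psi> (- (b * b))) = (\<Sum>w\<in>UNIV. \<psi> (w * w) * \<psi> (b * (2 * w)))"
        by (rule sum.reindex_bij_witness[of _ "\<lambda>w. b + w" "\<lambda>a. a - b"])
           (auto simp: algebra_simps simp flip: psi_add)
    qed
    also have "\<dots> = (\<Sum>w\<in>UNIV. \<psi> (w * w) * (\<Sum>b\<in>UNIV. \<psi> (b * (2 * w))))"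
      by (subst sum.swap) (simp add: sum_distrib_left)
    also have "\<dots> = (\<Sum>w\<in>(UNIV :: 'k set). if w = 0 then of_real q else 0)"
      by (intro sum.cong refl) (use two_neq_0 in \<open>auto simp: sum_psi_mult\<close>)
    also have "\<dots> = of_real q" by (simp add: sum.delta)
    finally show ?thesis .
  qed
  hence "of_real ((cmod G)\<^sup>2) = (of_real q :: complex)" by (simp only: complex_norm_square)
  hence "(cmod G)\<^sup>2 = q" by (simp only: of_real_eq_iff)
  ultimately show ?thesis by (simp add: norm_mult power2_eq_square)
qed

lemma q_ge_1: "q \<ge> 1"
  by (simp add: q_def Suc_le_eq finite_UNIV_card_ge_0)

text \<open>The condition \<open>gnorm x = t\<close> is detected by a sum of characters over s. The
  term s = 0 gives the value q at \<xi> = 0. For the others, completing the square produces a Gauss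
  sum times a phase, and x = -s t turns the sum of phases into a Kloosterman sum with parameter
  \<open>gnorm \<xi> * t\<close> / 4.\<close>

lemma circle_transform:
  assumes t: "t \<noteq> 0"
  shows "cmod ((\<Sum>x | gnorm x = t. \<psi> (gdot x \<xi>)) - (if \<xi> = 0 then of_real q else 0)) \<le> 2 * sqrt q"
proof -
  define N where "N = gnorm \<xi>"
  define b where "b = N * t / (2 * 2)"
  define l where "l = (\<Sum>x | gnorm x = t. \<psi> (gdot x \<xi>))"
  have inner: "(\<Sum>x\<in>UNIV. \<psi> (gdot x \<xi>) * \<psi> (s * (gnorm x - t))) = gauss_sum 1 * \<psi> (- (s * t) + b / (- (s * t)))"
    if s: "s \<noteq> 0" for s
  proof -
    \<comment> \<open>The centre \<xi> / (2 s) that completes the square.\<close>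
    define d where "d = Gauss (gre \<xi> / (2 * s)) (gim \<xi> / (2 * s))"
    have d: "2 * s * gre d = gre \<xi>" "2 * s * gim d = gim \<xi>" using s two_neq_0 by (simp_all add: d_def)
    have bs: "b / (- (s * t)) = - (s * gnorm d)"
    proof -
      have "2 * 2 * s * s * gnorm d = (2 * s * gre d) * (2 * s * gre d) + (2 * s * gim d) * (2 * s * gim d)"
        by (simp add: gnorm_def algebra_simps)
      also have "\<dots> = N" by (simp only: d N_def gnorm_def)
      finally have N: "N = 2 * 2 * s * s * gnorm d" by simp
      have "b = 2 * 2 * (s * s * gnorm d * t) / (2 * 2)" by (simp only: b_def N mult_ac)
      also have "\<dots> = s * s * gnorm d * t"
        by (rule nonzero_mult_div_cancel_left) (use two_neq_0 in \<open>simp only: mult_eq_0_iff, simp\<close>)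
      finally have "b = s * s * gnorm d * t" .
      thus ?thesis using s t by (simp add: field_simps)
    qed
    have "(\<Sum>x\<in>UNIV. \<psi> (gdot x \<xi>) * \<psi> (s * (gnorm x - t))) =
      (\<Sum>y\<in>UNIV. \<psi> (s * gnorm y) * \<psi> (- (s * t) + b / (- (s * t))))"
    proof (rule sum.reindex_bij_witness[of _ "\<lambda>y. y - d" "\<lambda>x. x + d"])
      fix x :: "'k gauss"
      have "gdot x \<xi> = s * (2 * gdot x d)" unfolding gdot_def d(1,2)[symmetric] by (simp only: ring_distribs mult_ac)
      moreover have "gnorm (x + d) = gnorm x + 2 * gdot x d + gnorm d"
        by (simp add: gnorm_def gdot_def algebra_simps)
      ultimately have "s * gnorm (x + d) + (- (s * t) + - (s * gnorm d)) = gdot x \<xi> + s * (gnorm x - t)"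
        by (simp add: algebra_simps)
      thus "\<psi> (s * gnorm (x + d)) * \<psi> (- (s * t) + b / (- (s * t))) = \<psi> (gdot x \<xi>) * \<psi> (s * (gnorm x - t))"
        unfolding bs psi_add[symmetric] by (simp only:)
    qed auto
    also have "\<dots> = gauss_sum s * \<psi> (- (s * t) + b / (- (s * t)))"
      by (simp only: gauss_sum_def sum_distrib_right)
    finally show ?thesis using gauss_sum_const[OF s] by simp
  qed
  have "of_real q * l = (\<Sum>x\<in>UNIV. \<psi> (gdot x \<xi>) * (\<Sum>s\<in>UNIV. \<psi> (s * (gnorm x - t))))"
  proof -
    have "(\<Sum>x\<in>UNIV. \<psi> (gdot x \<xi>) * (\<Sum>s\<in>UNIV. \<psi> (s * (gnorm x - t)))) =
        (\<Sum>x\<in>UNIV. if gnorm x = t then of_real q * \<psi> (gdot x \<xi>) else 0)"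
      by (intro sum.cong refl) (simp add: sum_psi_mult)
    also have "\<dots> = (\<Sum>x | gnorm x = t. of_real q * \<psi> (gdot x \<xi>))"
      by (simp add: sum.If_cases)
    finally show ?thesis by (simp add: l_def sum_distrib_left)
  qed
  also have "\<dots> = (\<Sum>s\<in>UNIV. \<Sum>x\<in>UNIV. \<psi> (gdot x \<xi>) * \<psi> (s * (gnorm x - t)))"
    by (simp add: sum_distrib_left) (rule sum.swap)
  also have "\<dots> = (\<Sum>x\<in>UNIV. \<psi> (gdot x \<xi>)) +
      (\<Sum>s\<in>UNIV - {0}. \<Sum>x\<in>UNIV. \<psi> (gdot x \<xi>) * \<psi> (s * (gnorm x - t)))"
    by (subst sum.remove[of UNIV 0]) auto
  also have "(\<Sum>s\<in>UNIV - {0}. \<Sum>x\<in>UNIV. \<psi> (gdot x \<xi>) * \<psi> (s * (gnorm x - t))) =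
      gauss_sum 1 * (\<Sum>s\<in>UNIV - {0}. \<psi> (- (s * t) + b / (- (s * t))))"
    by (simp add: inner sum_distrib_left)
  also have "(\<Sum>s\<in>UNIV - {0}. \<psi> (- (s * t) + b / (- (s * t)))) = (\<Sum>x\<in>UNIV - {0}. \<psi> (x + b / x))"
    by (rule sum.reindex_bij_witness[of _ "\<lambda>x. - x / t" "\<lambda>s. - (s * t)"]) (use t in auto)
  finally have "of_real q * (l - (if \<xi> = 0 then of_real q else 0)) = gauss_sum 1 * (\<Sum>x\<in>UNIV - {0}. \<psi> (x + b / x))"
    by (auto simp: sum_psi_gdot algebra_simps power2_eq_square)
  hence "cmod (of_real q * (l - (if \<xi> = 0 then of_real q else 0))) = cmod (gauss_sum 1 * (\<Sum>x\<in>UNIV - {0}. \<psi> (x + b / x)))"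
    by (simp only:)
  hence "q * cmod (l - (if \<xi> = 0 then of_real q else 0)) = q * cmod (\<Sum>x\<in>UNIV - {0}. \<psi> (x + b / x))"
    unfolding norm_mult norm_gauss_sum using q_pos by simp
  hence "cmod (l - (if \<xi> = 0 then of_real q else 0)) = cmod (\<Sum>x\<in>UNIV - {0}. \<psi> (x + b / x))"
    using q_pos by simp
  also have "\<dots> \<le> 2 * sqrt q"
  proof (cases "b = 0")
    \<comment> \<open>This covers isotropic \<xi>, including 0: the Kloosterman sum degenerates to a
      full character sum without the term at 0, which is -1.\<close>
    case True
    have "(\<Sum>x\<in>UNIV. \<psi> (x * 1)) = 0" by (subst sum_psi_mult) simp
    hence "(\<Sum>x\<in>UNIV - {0}. \<psi> x) = -1"
      by (subst (asm) sum.remove[of UNIV 0]) (auto simp: eq_neg_iff_add_eq_0 add.commute)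
    moreover have "1 \<le> sqrt q" using q_ge_1 by simp
    hence "1 \<le> 2 * sqrt q" by linarith
    ultimately show ?thesis using True by simp
  qed (use kloosterman_bound q_def in simp)
  finally show ?thesis by (simp add: l_def)
qed

theorem distance_count:
  fixes E :: "'k gauss set"
  assumes t: "t \<noteq> 0"
  shows "\<bar>real (card {(x, y). x \<in> E \<and> y \<in> E \<and> gnorm (x - y) = t}) - real (card E) ^ 2 / q\<bar> \<le> 2 * sqrt q * card E"
proof -
  define C where "C = real (card {(x, y). x \<in> E \<and> y \<in> E \<and> gnorm (x - y) = t})"
  define f :: "'k gauss \<Rightarrow> complex" where "f = (\<lambda>x. if x \<in> E then 1 else 0)"
  define l where "l = (\<lambda>\<xi>. \<Sum>v | gnorm v = t. \<psi> (gdot v \<xi>))"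
  \<comment> \<open>The deviation from the main term is taken at every frequency, 0 included, so
    that one bound and one application of Parseval treat them all.\<close>
  define r where "r = (\<lambda>\<xi>. l \<xi> - (if \<xi> = 0 then of_real q else 0))"
  have ghat_f: "ghat f \<xi> = (\<Sum>x\<in>E. \<psi> (gdot x \<xi>))" for \<xi>
    by (simp add: ghat_def f_def if_distrib[of "\<lambda>c. c * _"] sum.If_cases cong: if_cong)
  have sum_f: "(\<Sum>\<xi>\<in>UNIV. (cmod (ghat f \<xi>))\<^sup>2) = q\<^sup>2 * card E"
    unfolding parseval by (simp add: f_def if_distrib[of cmod] if_distrib[of "\<lambda>x. x\<^sup>2"] sum.If_cases cong: if_cong)
  have "of_real (q\<^sup>2 * C) = (\<Sum>x\<in>E. \<Sum>y\<in>E. if gnorm (x - y) = t then of_real (q\<^sup>2) else 0 :: complex)"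
  proof -
    have "(\<Sum>x\<in>E. \<Sum>y\<in>E. if gnorm (x - y) = t then of_real (q\<^sup>2) else 0 :: complex) =
        (\<Sum>p\<in>{(x, y). x \<in> E \<and> y \<in> E \<and> gnorm (x - y) = t}. of_real (q\<^sup>2))"
      unfolding sum.cartesian_product by (rule sum.mono_neutral_cong_right) (auto split: if_splits)
    thus ?thesis by (simp add: C_def mult.commute)
  qed
  also have "\<dots> = (\<Sum>x\<in>E. \<Sum>y\<in>E. \<Sum>v | gnorm v = t. \<Sum>\<xi>\<in>UNIV. \<psi> (gdot \<xi> (v - (x - y))))"
  proof (intro sum.cong refl)
    fix x y
    have "(\<Sum>v | gnorm v = t. \<Sum>\<xi>\<in>UNIV. \<psi> (gdot \<xi> (v - (x - y)))) =
      (\<Sum>v | gnorm v = t. if v = x - y then of_real (q\<^sup>2) else 0)"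
      by (intro sum.cong refl) (simp add: sum_psi_gdot)
    thus "(if gnorm (x - y) = t then of_real (q\<^sup>2) else 0 :: complex) =
      (\<Sum>v | gnorm v = t. \<Sum>\<xi>\<in>UNIV. \<psi> (gdot \<xi> (v - (x - y))))"
      by (simp add: sum.delta)
  qed
  also have "\<dots> = (\<Sum>x\<in>E. \<Sum>y\<in>E. \<Sum>v | gnorm v = t. \<Sum>\<xi>\<in>UNIV. \<psi> (gdot v \<xi>) * (cnj (\<psi> (gdot x \<xi>)) * \<psi> (gdot y \<xi>)))"
    by (intro sum.cong refl) (simp add: psi_gdot_diff mult_ac flip: gdot_commute[of _ "_ - _"])
  also have "\<dots> = (\<Sum>x\<in>E. \<Sum>y\<in>E. \<Sum>\<xi>\<in>UNIV. l \<xi> * (cnj (\<psi> (gdot x \<xi>)) * \<psi> (gdot y \<xi>)))"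
    unfolding l_def sum_distrib_right by (rule sum.cong[OF refl], rule sum.cong[OF refl], rule sum.swap)
  also have "\<dots> = (\<Sum>x\<in>E. \<Sum>\<xi>\<in>UNIV. \<Sum>y\<in>E. l \<xi> * (cnj (\<psi> (gdot x \<xi>)) * \<psi> (gdot y \<xi>)))"
    by (rule sum.cong[OF refl], rule sum.swap)
  also have "\<dots> = (\<Sum>\<xi>\<in>UNIV. l \<xi> * (ghat f \<xi> * cnj (ghat f \<xi>)))"
  proof (subst sum.swap, rule sum.cong[OF refl])
    fix \<xi>
    have "(\<Sum>x\<in>E. \<Sum>y\<in>E. l \<xi> * (cnj (\<psi> (gdot x \<xi>)) * \<psi> (gdot y \<xi>))) =
        l \<xi> * ((\<Sum>x\<in>E. cnj (\<psi> (gdot x \<xi>))) * (\<Sum>y\<in>E. \<psi> (gdot y \<xi>)))"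
      by (subst sum_product) (simp only: sum_distrib_left)
    thus "(\<Sum>x\<in>E. \<Sum>y\<in>E. l \<xi> * (cnj (\<psi> (gdot x \<xi>)) * \<psi> (gdot y \<xi>))) = l \<xi> * (ghat f \<xi> * cnj (ghat f \<xi>))"
      by (simp add: ghat_f mult.commute)
  qed
  also have "\<dots> = (\<Sum>\<xi>\<in>UNIV. l \<xi> * of_real ((cmod (ghat f \<xi>))\<^sup>2))"
    by (simp only: complex_norm_square)
  also have "\<dots> = (\<Sum>\<xi>\<in>UNIV. r \<xi> * of_real ((cmod (ghat f \<xi>))\<^sup>2) +
      (if \<xi> = 0 then of_real (q * (cmod (ghat f 0))\<^sup>2) else 0))"
    by (intro sum.cong refl) (auto simp: r_def algebra_simps)
  also have "\<dots> = (\<Sum>\<xi>\<in>UNIV. r \<xi> * of_real ((cmod (ghat f \<xi>))\<^sup>2)) + of_real (q * (cmod (ghat f 0))\<^sup>2)"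
    by (simp add: sum.distrib sum.delta)
  also have "ghat f 0 = of_nat (card E)" by (simp add: ghat_f)
  finally have "(\<Sum>\<xi>\<in>UNIV. r \<xi> * of_real ((cmod (ghat f \<xi>))\<^sup>2)) = of_real (q\<^sup>2 * C - q * real (card E) ^ 2)"
    by (simp add: algebra_simps)
  hence "\<bar>q\<^sup>2 * C - q * real (card E) ^ 2\<bar> = cmod (\<Sum>\<xi>\<in>UNIV. r \<xi> * of_real ((cmod (ghat f \<xi>))\<^sup>2))"
    by (simp only: norm_of_real)
  also have "\<dots> \<le> (\<Sum>\<xi>\<in>UNIV. 2 * sqrt q * (cmod (ghat f \<xi>))\<^sup>2)"
  proof (rule sum_norm_le)
    fix \<xi>
    have "cmod (r \<xi>) \<le> 2 * sqrt q" unfolding r_def l_def by (rule circle_transform[OF t])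
    thus "cmod (r \<xi> * of_real ((cmod (ghat f \<xi>))\<^sup>2)) \<le> 2 * sqrt q * (cmod (ghat f \<xi>))\<^sup>2"
      unfolding norm_mult norm_of_real abs_power2 by (rule mult_right_mono) simp
  qed
  also have "\<dots> = q\<^sup>2 * (2 * sqrt q * card E)"
    using sum_f by (simp add: mult_ac flip: sum_distrib_left)
  also have "q\<^sup>2 * C - q * real (card E) ^ 2 = q\<^sup>2 * (C - real (card E) ^ 2 / q)"
    using q_pos by (simp add: field_simps power2_eq_square)
  finally show ?thesis using q_pos by (simp add: C_def abs_mult)
qed

section \<open>Motions as pairs of points at distance t\<close>

lemma card_motions:
  fixes E :: "'k gauss set"
  assumes t: "t \<noteq> 0" and uv: "gnorm (u - v) = t"
  shows "card (motions E t u v) = card {(x, y). x \<in> E \<and> y \<in> E \<and> gnorm (x - y) = t}"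
proof (rule bij_betw_same_card)
  define f where "f = (\<lambda>(z, h). (gcnj h * (u - z), gcnj h * (v - z)))"
  show "bij_betw f (motions E t u v) {(x, y). x \<in> E \<and> y \<in> E \<and> gnorm (x - y) = t}"
  proof (rule bij_betwI')
    fix a b assume "a \<in> motions E t u v" "b \<in> motions E t u v"
    then obtain z h z' h' where ab: "a = (z, h)" "b = (z', h')" and h: "h \<in> gcirc" "h' \<in> gcirc"
      by (auto simp: motions_def)
    show "(f a = f b) = (a = b)"
    proof
      assume "f a = f b"
      hence eq: "gcnj h * (u - z) = gcnj h' * (u - z')" "gcnj h * (v - z) = gcnj h' * (v - z')"
        by (simp_all add: f_def ab)
      have "gcnj h * (u - v) = gcnj h * (u - z) - gcnj h * (v - z)" by (simp add: algebra_simps)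
      also have "\<dots> = gcnj h' * (u - v)" unfolding eq by (simp add: algebra_simps)
      finally have "(u - v) * gcnj h = (u - v) * gcnj h'" by (simp add: mult.commute)
      hence "gcnj h = gcnj h'" using gnorm_neq_0_cancel t uv by blast
      hence hh: "h = h'" by (metis gcnj_gcnj)
      with eq(1) have "h * (gcnj h * (u - z)) = h * (gcnj h * (u - z'))" by simp
      with h hh show "a = b" by (simp add: ab)
    qed simp
  next
    fix a assume "a \<in> motions E t u v"
    then obtain z h x y where "a = (z, h)" "h \<in> gcirc" "x \<in> E" "y \<in> E" "gnorm (x - y) = t"
      "z + h * x = u" "z + h * y = v" by (auto simp: motions_def)
    thus "f a \<in> {(x, y). x \<in> E \<and> y \<in> E \<and> gnorm (x - y) = t}" by (auto simp: f_def)
  next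
    fix b assume "b \<in> {(x, y). x \<in> E \<and> y \<in> E \<and> gnorm (x - y) = t}"
    then obtain x y where b: "b = (x, y)" "x \<in> E" "y \<in> E" "gnorm (x - y) = t" by auto
    \<comment> \<open>The quotient (u - v) / (x - y): the inverse of x - y is its conjugate divided
      by its norm t. As u - v has the same norm, h lies on the circle.\<close>
    define h where "h = (u - v) * gcnj (x - y) * Gauss (1 / t) 0"
    have "gnorm (Gauss (1 / t) 0) = 1 / t * (1 / t)" by (simp add: gnorm_def)
    hence h: "h \<in> gcirc" using t b uv by (simp add: h_def gcirc_def gnorm_mult)
    have "Gauss (1 / t) 0 * (gcnj (x - y) * (x - y)) = 1"
      unfolding gcnj_mult_self b(4) using t by (simp add: gauss_eq_iff)
    hence "h * (x - y) = u - v" by (simp add: h_def mult_ac)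
    hence hxy: "h * x - h * y = u - v" by (simp add: algebra_simps)
    have "(u - h * x, h) \<in> motions E t u v"
    proof -
      have "u - h * x + h * x = u" "u - h * x + h * y = v" using hxy by (simp_all add: algebra_simps)
      thus ?thesis unfolding motions_def using b h by blast
    qed
    moreover have "f (u - h * x, h) = b"
    proof -
      have "v - (u - h * x) = h * y" using hxy by (simp add: algebra_simps)
      thus ?thesis using h by (simp add: f_def b)
    qed
    ultimately show "\<exists>a\<in>motions E t u v. b = f a" by metis
  qed
qed

text \<open>A motion with rotation h that sends x to u has translation u - h x. Each fibre over the
  circle thus has at most |E| elements, which is the value of \<open>K\<close> used in the energy
  bound.\<close>

theorem motions_bounds:
  fixes E :: "'k gauss set"
  assumes t: "t \<noteq> 0" and uv: "gnorm (u - v) = t"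
  defines "M \<equiv> motions E t u v"
  shows "\<bar>real (card M) - real (card E) ^ 2 / q\<bar> \<le> 2 * sqrt q * card E"
    and "real (card M) ^ 4 \<le> card (case_prod gmul ` (M \<times> M)) * (real (card M) ^ 3 * card E / q\<^sup>2 + q\<^sup>2 * real (card M) ^ 2)"
proof -
  show "\<bar>real (card M) - real (card E) ^ 2 / q\<bar> \<le> 2 * sqrt q * card E"
    unfolding M_def card_motions[OF t uv] by (rule distance_count[OF t])
  have "card {z. (z, h) \<in> M} \<le> card E" for h
  proof (rule surj_card_le)
    show "{z. (z, h) \<in> M} \<subseteq> (\<lambda>x. u - h * x) ` E"
      by (auto simp: M_def motions_def)
  qed simp
  thus "real (card M) ^ 4 \<le> card (case_prod gmul ` (M \<times> M)) * (real (card M) ^ 3 * card E / q\<^sup>2 + q\<^sup>2 * real (card M) ^ 2)"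
    by (intro card_product_set) (auto simp: M_def motions_def)
qed

end

section \<open>From types to ring records\<close>

text \<open>Both inequalities in terms of the record alone, free of characters, so that they can be
  carried along ring isomorphisms. The growth itself is deduced only after this transfer.\<close>

definition growth_bounds :: "'a ring \<Rightarrow> bool" where
  "growth_bounds F \<longleftrightarrow> (\<forall>E t u v.
     E \<subseteq> plane F \<and> t \<in> carrier F - {\<zero>\<^bsub>F\<^esub>} \<and> u \<in> E \<and> v \<in> E \<and> qdist F u v = t \<longrightarrow>
     (let q = real (order F);
          M = motion_set F E t u v
      in \<bar>real (card M) - real (card E) ^ 2 / q\<bar> \<le> 2 * sqrt q * card E \<and>
         real (card M) ^ 4 \<le> card (M <#>\<^bsub>rigid_motions F\<^esub> M) * (real (card M) ^ 3 * card E / q\<^sup>2 + q\<^sup>2 * real (card M) ^ 2)))"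

lemma set_mult_rigid_motions:
  "A <#>\<^bsub>rigid_motions F\<^esub> B = (\<lambda>(g, h). g \<otimes>\<^bsub>rigid_motions F\<^esub> h) ` (A \<times> B)"
  by (auto simp: set_mult_def)

lemma growth_bounds_iso:
  assumes R: "ring R" and S: "ring S" and \<phi>: "\<phi> \<in> ring_iso R S" and gb: "growth_bounds R"
  shows "growth_bounds S"
proof -
  interpret R: ring R by fact
  interpret S: ring S by fact
  interpret \<phi>: ring_hom_ring R S \<phi>
    using \<phi> by (intro ring_hom_ringI2 R S) (simp add: ring_iso_def)
  have inj: "inj_on \<phi> (carrier R)" and surj: "\<phi> ` carrier R = carrier S"
    using \<phi> by (auto simp: ring_iso_def bij_betw_def)
  have \<phi>_minus: "\<phi> (a \<ominus>\<^bsub>R\<^esub> b) = \<phi> a \<ominus>\<^bsub>S\<^esub> \<phi> b" if "a \<in> carrier R" "b \<in> carrier R" for a b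
    using that by (simp add: a_minus_def)
  have \<phi>_pow2: "\<phi> (a [^]\<^bsub>R\<^esub> (2::nat)) = \<phi> a [^]\<^bsub>S\<^esub> (2::nat)" if "a \<in> carrier R" for a
    using that by (simp add: numeral_2_eq_2)
  define v2 where "v2 = map_prod \<phi> \<phi>"
  define m2 where "m2 = map_prod v2 v2"
  define \<Phi> where "\<Phi> = map_prod v2 m2"
  have plane: "plane S = v2 ` plane R"
    by (auto simp: plane_def v2_def surj[symmetric])
  have inj_v2: "inj_on v2 (plane R)"
    using inj by (auto simp: plane_def v2_def inj_on_def)
  have add: "vec_add S (v2 x) (v2 y) = v2 (vec_add R x y)" if "x \<in> plane R" "y \<in> plane R" for x y
    using that by (cases x; cases y) (simp add: v2_def plane_def)
  have mv: "mat_vec S (m2 h) (v2 x) = v2 (mat_vec R h x)" if "h \<in> plane R \<times> plane R" "x \<in> plane R" for h x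
    using that by (cases h; cases x; cases "fst h"; cases "snd h") (simp add: v2_def m2_def plane_def)
  have mm: "mat_mult S (m2 h) (m2 h') = m2 (mat_mult R h h')" if "h \<in> plane R \<times> plane R" "h' \<in> plane R \<times> plane R" for h h'
    using that by (cases h; cases h'; cases "fst h"; cases "snd h"; cases "fst h'"; cases "snd h'")
      (simp add: v2_def m2_def plane_def)
  have vec_closed: "vec_add R x y \<in> plane R" if "x \<in> plane R" "y \<in> plane R" for x y
    using that by (cases x; cases y) (simp add: plane_def)
  have mv_closed: "mat_vec R h x \<in> plane R" if "h \<in> plane R \<times> plane R" "x \<in> plane R" for h x
    using that by (cases h; cases x; cases "fst h"; cases "snd h") (simp add: plane_def)
  have qd_closed: "qdist R x y \<in> carrier R" if "x \<in> plane R" "y \<in> plane R" for x y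
    using that by (cases x; cases y) (simp add: plane_def)
  have qd: "qdist S (v2 x) (v2 y) = \<phi> (qdist R x y)" if "x \<in> plane R" "y \<in> plane R" for x y
    using that by (cases x; cases y) (simp add: v2_def plane_def \<phi>_pow2 \<phi>_minus)
  have SO2_R: "SO2 R \<subseteq> plane R \<times> plane R" by (auto simp: SO2_def plane_def)
  have SO2: "SO2 S = m2 ` SO2 R"
  proof (intro equalityI subsetI)
    fix h assume "h \<in> SO2 S"
    then obtain a b where h: "h = ((a, \<ominus>\<^bsub>S\<^esub> b), (b, a))" "a \<in> carrier S" "b \<in> carrier S"
      "a [^]\<^bsub>S\<^esub> (2::nat) \<oplus>\<^bsub>S\<^esub> b [^]\<^bsub>S\<^esub> (2::nat) = \<one>\<^bsub>S\<^esub>" by (auto simp: SO2_def)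
    then obtain a' b' where ab: "a = \<phi> a'" "b = \<phi> b'" "a' \<in> carrier R" "b' \<in> carrier R"
      unfolding surj[symmetric] by auto
    have "\<phi> (a' [^]\<^bsub>R\<^esub> (2::nat) \<oplus>\<^bsub>R\<^esub> b' [^]\<^bsub>R\<^esub> (2::nat)) = \<phi> \<one>\<^bsub>R\<^esub>" using h ab by (simp add: \<phi>_pow2)
    hence "a' [^]\<^bsub>R\<^esub> (2::nat) \<oplus>\<^bsub>R\<^esub> b' [^]\<^bsub>R\<^esub> (2::nat) = \<one>\<^bsub>R\<^esub>"
      using ab by (intro inj_onD[OF inj]) auto
    moreover have "h = m2 ((a', \<ominus>\<^bsub>R\<^esub> b'), (b', a'))" using h ab by (simp add: m2_def v2_def)
    ultimately show "h \<in> m2 ` SO2 R" using ab by (auto simp: SO2_def)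
  next
    fix h assume "h \<in> m2 ` SO2 R"
    then obtain a b where h: "h = m2 ((a, \<ominus>\<^bsub>R\<^esub> b), (b, a))" "a \<in> carrier R" "b \<in> carrier R"
      "a [^]\<^bsub>R\<^esub> (2::nat) \<oplus>\<^bsub>R\<^esub> b [^]\<^bsub>R\<^esub> (2::nat) = \<one>\<^bsub>R\<^esub>" by (auto simp: SO2_def)
    hence "\<phi> a [^]\<^bsub>S\<^esub> (2::nat) \<oplus>\<^bsub>S\<^esub> \<phi> b [^]\<^bsub>S\<^esub> (2::nat) = \<one>\<^bsub>S\<^esub>"
      by (simp flip: \<phi>_pow2 \<phi>.hom_add)
    thus "h \<in> SO2 S" using h by (auto simp: SO2_def m2_def v2_def)
  qed
  have carrier_R: "carrier (rigid_motions R) = plane R \<times> SO2 R" by (simp add: rigid_motions_def)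
  have carrier_S: "carrier (rigid_motions S) = \<Phi> ` carrier (rigid_motions R)"
    by (auto simp: rigid_motions_def plane SO2 \<Phi>_def)
  \<comment> \<open>Injectivity holds for all vectors and matrices over the carrier. For products of
    motions it then suffices that their entries stay in the carrier.\<close>
  have inj_\<Phi>: "inj_on \<Phi> (plane R \<times> (plane R \<times> plane R))"
    using inj_v2 by (auto simp: \<Phi>_def m2_def inj_on_def)
  have act: "act S (\<Phi> g) (v2 x) = v2 (act R g x)" if "g \<in> carrier (rigid_motions R)" "x \<in> plane R" for g x
    using that SO2_R unfolding carrier_R by (cases g) (auto simp: \<Phi>_def mv add mv_closed subsetD)
  have act_closed: "act R g x \<in> plane R" if "g \<in> carrier (rigid_motions R)" "x \<in> plane R" for g x
    using that SO2_R unfolding carrier_R by (cases g) (auto intro!: vec_closed mv_closed)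
  have mult: "\<Phi> g \<otimes>\<^bsub>rigid_motions S\<^esub> \<Phi> h = \<Phi> (g \<otimes>\<^bsub>rigid_motions R\<^esub> h)"
    if gh: "g \<in> carrier (rigid_motions R)" "h \<in> carrier (rigid_motions R)" for g h
  proof -
    obtain z1 h1 z2 h2 where "g = (z1, h1)" "h = (z2, h2)" "z1 \<in> plane R" "z2 \<in> plane R"
      "h1 \<in> plane R \<times> plane R" "h2 \<in> plane R \<times> plane R"
      using gh SO2_R unfolding carrier_R by blast
    thus ?thesis by (simp add: rigid_motions_def \<Phi>_def mv add mm mv_closed)
  qed
  have mult_closed: "g \<otimes>\<^bsub>rigid_motions R\<^esub> h \<in> plane R \<times> (plane R \<times> plane R)"
    if gh: "g \<in> carrier (rigid_motions R)" "h \<in> carrier (rigid_motions R)" for g h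
  proof -
    have "mat_mult R a b \<in> plane R \<times> plane R" if "a \<in> plane R \<times> plane R" "b \<in> plane R \<times> plane R" for a b
      using that by (cases a; cases b; cases "fst a"; cases "snd a"; cases "fst b"; cases "snd b") (simp add: plane_def)
    moreover obtain z1 h1 z2 h2 where "g = (z1, h1)" "h = (z2, h2)" "z1 \<in> plane R" "z2 \<in> plane R"
      "h1 \<in> plane R \<times> plane R" "h2 \<in> plane R \<times> plane R"
      using gh SO2_R unfolding carrier_R by blast
    ultimately show ?thesis by (simp add: rigid_motions_def vec_closed mv_closed)
  qed
  have order: "order S = order R" unfolding Coset.order_def surj[symmetric] by (rule card_image[OF inj])
  show ?thesis
    unfolding growth_bounds_def
  proof (intro allI impI)
    fix E t u v
    assume *: "E \<subseteq> plane S \<and> t \<in> carrier S - {\<zero>\<^bsub>S\<^esub>} \<and> u \<in> E \<and> v \<in> E \<and> qdist S u v = t"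
    define E' where "E' = {x \<in> plane R. v2 x \<in> E}"
    have E': "E' \<subseteq> plane R" "E = v2 ` E'" using * by (auto simp: E'_def plane)
    then obtain u' v' where uv: "u' \<in> E'" "v' \<in> E'" "u = v2 u'" "v = v2 v'" using * by auto
    define t' where "t' = qdist R u' v'"
    have t': "t' \<in> carrier R" "t = \<phi> t'"
      using uv E' * qd qd_closed by (auto simp: t'_def subset_eq)
    hence t'0: "t' \<noteq> \<zero>\<^bsub>R\<^esub>" using * by auto
    define M where "M = motion_set R E' t' u' v'"
    have M_carrier: "M \<subseteq> carrier (rigid_motions R)" by (auto simp: M_def motion_set_def)
    hence M_sub: "M \<subseteq> plane R \<times> (plane R \<times> plane R)" using SO2_R by (auto simp: carrier_R)
    have "act S (\<Phi> g) (v2 x) = v2 w \<longleftrightarrow> act R g x = w"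
      if "g \<in> carrier (rigid_motions R)" "x \<in> plane R" "w \<in> plane R" for g x w
      using that act act_closed inj_v2 by (metis inj_onD)
    moreover have "qdist S (v2 x) (v2 y) = \<phi> t' \<longleftrightarrow> qdist R x y = t'" if "x \<in> plane R" "y \<in> plane R" for x y
      using that qd qd_closed t' inj by (metis inj_onD)
    ultimately have "\<Phi> g \<in> motion_set S E t u v \<longleftrightarrow> g \<in> M" if "g \<in> carrier (rigid_motions R)" for g
      using that E'(1) uv carrier_S unfolding motion_set_def M_def E'(2) t'(2) uv(3,4)
      by (auto simp: subset_eq)
    moreover have "motion_set S E t u v \<subseteq> \<Phi> ` carrier (rigid_motions R)"
      by (auto simp: motion_set_def carrier_S)
    ultimately have M: "motion_set S E t u v = \<Phi> ` M" using M_carrier by blast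
    have prod_sub: "M <#>\<^bsub>rigid_motions R\<^esub> M \<subseteq> plane R \<times> (plane R \<times> plane R)"
      unfolding set_mult_rigid_motions
    proof (rule image_subsetI)
      fix gh assume "gh \<in> M \<times> M"
      then obtain g h where gh: "gh = (g, h)" "g \<in> M" "h \<in> M" by (cases gh) auto
      show "(case gh of (g, h) \<Rightarrow> g \<otimes>\<^bsub>rigid_motions R\<^esub> h) \<in> plane R \<times> plane R \<times> plane R"
        using mult_closed[OF subsetD[OF M_carrier gh(2)] subsetD[OF M_carrier gh(3)]] unfolding gh(1) prod.case .
    qed
    have "(\<Phi> ` M) <#>\<^bsub>rigid_motions S\<^esub> (\<Phi> ` M) = \<Phi> ` (M <#>\<^bsub>rigid_motions R\<^esub> M)"
    proof -
      have "(\<Phi> ` M) <#>\<^bsub>rigid_motions S\<^esub> (\<Phi> ` M) = (\<lambda>(g, h). \<Phi> g \<otimes>\<^bsub>rigid_motions S\<^esub> \<Phi> h) ` (M \<times> M)"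
        unfolding set_mult_rigid_motions by force
      also have "\<dots> = (\<lambda>(g, h). \<Phi> (g \<otimes>\<^bsub>rigid_motions R\<^esub> h)) ` (M \<times> M)"
        by (intro image_cong refl) (auto simp: mult subsetD[OF M_carrier])
      also have "\<dots> = \<Phi> ` (M <#>\<^bsub>rigid_motions R\<^esub> M)"
        unfolding set_mult_rigid_motions by force
      finally show ?thesis .
    qed
    hence "card (motion_set S E t u v <#>\<^bsub>rigid_motions S\<^esub> motion_set S E t u v) = card (M <#>\<^bsub>rigid_motions R\<^esub> M)"
      unfolding M by (simp add: card_image[OF inj_on_subset[OF inj_\<Phi> prod_sub]])
    moreover have "card (motion_set S E t u v) = card M"
      unfolding M by (rule card_image[OF inj_on_subset[OF inj_\<Phi> M_sub]])
    moreover have "card E = card E'"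
      unfolding E'(2) by (rule card_image[OF inj_on_subset[OF inj_v2 E'(1)]])
    moreover have "let q = real (order R)
      in \<bar>real (card M) - real (card E') ^ 2 / q\<bar> \<le> 2 * sqrt q * card E' \<and>
         real (card M) ^ 4 \<le> card (M <#>\<^bsub>rigid_motions R\<^esub> M) * (real (card M) ^ 3 * card E' / q\<^sup>2 + q\<^sup>2 * real (card M) ^ 2)"
      using gb[unfolded growth_bounds_def, rule_format, of E' t' u' v'] E' t' t'0 uv
      unfolding M_def Let_def by (simp add: t'_def)
    ultimately show "let q = real (order S); M = motion_set S E t u v
      in \<bar>real (card M) - real (card E) ^ 2 / q\<bar> \<le> 2 * sqrt q * card E \<and>
         real (card M) ^ 4 \<le> card (M <#>\<^bsub>rigid_motions S\<^esub> M) * (real (card M) ^ 3 * card E / q\<^sup>2 + q\<^sup>2 * real (card M) ^ 2)"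
      unfolding Let_def order by simp
  qed
qed

lemma growth_bounds_type:
  assumes "odd (card (UNIV :: 'k::finite_field set))"
  shows "growth_bounds (ring_of_type_algebra :: 'k ring)"
proof -
  obtain \<psi> :: "'k \<Rightarrow> complex" where "weil_character \<psi>"
    using weil_character_exists[OF assms] by blast
  then interpret weil_character \<psi> .
  define F where "F = (ring_of_type_algebra :: 'k ring)"
  interpret F: field F unfolding F_def by (rule field_from_type_algebra)
  have F [simp]: "carrier F = UNIV" "a \<otimes>\<^bsub>F\<^esub> b = a * b" "a \<oplus>\<^bsub>F\<^esub> b = a + b" "\<one>\<^bsub>F\<^esub> = 1" "\<zero>\<^bsub>F\<^esub> = 0" for a b
    by (simp_all add: F_def ring_of_type_algebra_def)
  have a_inv [simp]: "\<ominus>\<^bsub>F\<^esub> a = - a" for a by (rule F.minus_equality) simp_all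
  have a_minus [simp]: "a \<ominus>\<^bsub>F\<^esub> b = a - b" for a b by (simp add: a_minus_def)
  have pow2 [simp]: "a [^]\<^bsub>F\<^esub> (2::nat) = a * a" for a
    by (simp add: numeral_2_eq_2)
  have order: "real (order F) = q" by (simp add: Coset.order_def q_def)
  define G where "G = (\<lambda>(a :: 'k, b). Gauss a b)"
  \<comment> \<open>A rotation matrix is determined by its first column, read as a + i b.\<close>
  define H where "H = (\<lambda>((a :: 'k, _ :: 'k), (b, _ :: 'k)). Gauss a b)"
  define \<Gamma> where "\<Gamma> = map_prod G H"
  have inj_G: "inj G" by (auto simp: G_def inj_on_def)
  have SO2: "SO2 F = {((a, - b), (b, a)) | a b. a * a + b * b = 1}" by (simp add: SO2_def)
  have carrier: "carrier (rigid_motions F) = UNIV \<times> SO2 F" by (simp add: rigid_motions_def plane_def)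
  \<comment> \<open>Only the shape of the matrix matters here, not its determinant; this shape is
    visibly preserved by products.\<close>
  have inj_\<Gamma>: "inj_on \<Gamma> (UNIV \<times> {m. fst (fst m) = snd (snd m) \<and> snd (fst m) = - fst (snd m)})"
    by (auto simp: \<Gamma>_def G_def H_def inj_on_def)
  have act: "G (act F g x) = fst (\<Gamma> g) + snd (\<Gamma> g) * G x" if "g \<in> carrier (rigid_motions F)" for g x
    using that unfolding carrier SO2
    by (cases x) (auto simp: \<Gamma>_def G_def H_def gauss_eq_iff algebra_simps)
  have mult: "\<Gamma> (g \<otimes>\<^bsub>rigid_motions F\<^esub> h) = gmul (\<Gamma> g) (\<Gamma> h)"
    if "g \<in> carrier (rigid_motions F)" "h \<in> carrier (rigid_motions F)" for g h
    using that unfolding carrier SO2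
    by (auto simp: rigid_motions_def \<Gamma>_def G_def H_def gauss_eq_iff algebra_simps)
  have mult_closed: "g \<otimes>\<^bsub>rigid_motions F\<^esub> h \<in> UNIV \<times> {m. fst (fst m) = snd (snd m) \<and> snd (fst m) = - fst (snd m)}"
    if "g \<in> carrier (rigid_motions F)" "h \<in> carrier (rigid_motions F)" for g h
    using that unfolding carrier SO2 by (auto simp: rigid_motions_def algebra_simps)
  have qd: "qdist F x y = gnorm (G x - G y)" for x y
    by (cases x; cases y) (simp add: G_def gnorm_def)
  show ?thesis
    unfolding F_def[symmetric] growth_bounds_def
  proof (intro allI impI)
    fix E t u v
    assume *: "E \<subseteq> plane F \<and> t \<in> carrier F - {\<zero>\<^bsub>F\<^esub>} \<and> u \<in> E \<and> v \<in> E \<and> qdist F u v = t"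
    define M where "M = motion_set F E t u v"
    have M_carrier: "M \<subseteq> carrier (rigid_motions F)" by (auto simp: M_def motion_set_def)
    hence M_sub: "M \<subseteq> UNIV \<times> {m. fst (fst m) = snd (snd m) \<and> snd (fst m) = - fst (snd m)}" unfolding carrier SO2 by auto
    have mem: "\<Gamma> g \<in> motions (G ` E) t (G u) (G v) \<longleftrightarrow> g \<in> M" if g: "g \<in> carrier (rigid_motions F)" for g
    proof -
      have "snd (\<Gamma> g) \<in> gcirc"
        using g unfolding carrier SO2 by (auto simp: \<Gamma>_def H_def gcirc_def gnorm_def)
      hence "\<Gamma> g \<in> motions (G ` E) t (G u) (G v) \<longleftrightarrow>
        (\<exists>x\<in>E. \<exists>y\<in>E. gnorm (G x - G y) = t \<and> fst (\<Gamma> g) + snd (\<Gamma> g) * G x = G u \<and> fst (\<Gamma> g) + snd (\<Gamma> g) * G y = G v)"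
        by (auto simp: motions_def case_prod_unfold)
      also have "\<dots> \<longleftrightarrow> g \<in> M"
        using g inj_G by (simp add: act[symmetric] qd[symmetric] inj_eq M_def motion_set_def)
      finally show ?thesis .
    qed
    have "motions (G ` E) t (G u) (G v) \<subseteq> \<Gamma> ` carrier (rigid_motions F)"
    proof
      fix g assume "g \<in> motions (G ` E) t (G u) (G v)"
      then obtain z h where g: "g = (z, h)" "gnorm h = 1" by (auto simp: motions_def gcirc_def)
      hence "g = \<Gamma> ((gre z, gim z), ((gre h, - gim h), (gim h, gre h)))"
        by (simp add: \<Gamma>_def G_def H_def)
      moreover have "((gre z, gim z), ((gre h, - gim h), (gim h, gre h))) \<in> carrier (rigid_motions F)"
        using g unfolding carrier SO2 by (auto simp: gnorm_def)
      ultimately show "g \<in> \<Gamma> ` carrier (rigid_motions F)" by blast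
    qed
    hence M: "motions (G ` E) t (G u) (G v) = \<Gamma> ` M" using mem M_carrier by blast
    have card_M: "card (motions (G ` E) t (G u) (G v)) = card M"
      unfolding M by (rule card_image[OF inj_on_subset[OF inj_\<Gamma> M_sub]])
    have "case_prod gmul ` (\<Gamma> ` M \<times> \<Gamma> ` M) = (\<lambda>(g, h). gmul (\<Gamma> g) (\<Gamma> h)) ` (M \<times> M)" by force
    also have "\<dots> = (\<lambda>(g, h). \<Gamma> (g \<otimes>\<^bsub>rigid_motions F\<^esub> h)) ` (M \<times> M)"
      by (intro image_cong refl) (auto simp: mult subsetD[OF M_carrier])
    also have "\<dots> = \<Gamma> ` (M <#>\<^bsub>rigid_motions F\<^esub> M)"
      unfolding set_mult_rigid_motions by force
    finally have "card (case_prod gmul ` (\<Gamma> ` M \<times> \<Gamma> ` M)) = card (\<Gamma> ` (M <#>\<^bsub>rigid_motions F\<^esub> M))" by simp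
    also have "\<dots> = card (M <#>\<^bsub>rigid_motions F\<^esub> M)"
    proof (rule card_image[OF inj_on_subset[OF inj_\<Gamma>]])
      show "M <#>\<^bsub>rigid_motions F\<^esub> M \<subseteq> UNIV \<times> {m. fst (fst m) = snd (snd m) \<and> snd (fst m) = - fst (snd m)}"
        unfolding set_mult_rigid_motions
      proof (rule image_subsetI)
        fix gh assume "gh \<in> M \<times> M"
        then obtain g h where gh: "gh = (g, h)" "g \<in> M" "h \<in> M" by (cases gh) auto
        show "(case gh of (g, h) \<Rightarrow> g \<otimes>\<^bsub>rigid_motions F\<^esub> h) \<in>
            UNIV \<times> {m. fst (fst m) = snd (snd m) \<and> snd (fst m) = - fst (snd m)}"
          using mult_closed[OF subsetD[OF M_carrier gh(2)] subsetD[OF M_carrier gh(3)]] unfolding gh(1) prod.case .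
      qed
    qed
    finally have card_MM: "card (case_prod gmul ` (\<Gamma> ` M \<times> \<Gamma> ` M)) = card (M <#>\<^bsub>rigid_motions F\<^esub> M)" .
    have card_E: "card (G ` E) = card E" using inj_G by (intro card_image) (auto simp: inj_on_def)
    have "t \<noteq> 0" "gnorm (G u - G v) = t" using * by (auto simp: qd)
    note bounds = motions_bounds[OF this, of "G ` E"]
    show "let q = real (order F); M = motion_set F E t u v
      in \<bar>real (card M) - real (card E) ^ 2 / q\<bar> \<le> 2 * sqrt q * card E \<and>
         real (card M) ^ 4 \<le> card (M <#>\<^bsub>rigid_motions F\<^esub> M) * (real (card M) ^ 3 * card E / q\<^sup>2 + q\<^sup>2 * real (card M) ^ 2)"
      using bounds unfolding Let_def order card_E M_def[symmetric] card_M unfolding M card_MM by blast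
  qed
qed

text \<open>
  To leave the record world, a field over which \<open>growth_bounds\<close> fails is turned into a type, if there
  is one. The results about type class fields then show that there is none.
\<close>
definition critical_field :: "int ring" where
  "critical_field = (SOME F. field F \<and> finite (carrier F) \<and> odd (order F) \<and>
     (growth_bounds F \<longrightarrow> (\<forall>F' :: int ring. field F' \<and> finite (carrier F') \<and> odd (order F') \<longrightarrow> growth_bounds F')))"

lemma
  shows field_critical_field: "field critical_field"
    and finite_critical_field: "finite (carrier critical_field)"
    and odd_critical_field: "odd (order critical_field)"
    and critical_field_critical: "growth_bounds critical_field \<Longrightarrow>
      field F' \<Longrightarrow> finite (carrier F') \<Longrightarrow> odd (order F') \<Longrightarrow> growth_bounds (F' :: int ring)"
proof -
  have "\<exists>F :: int ring. field F \<and> finite (carrier F) \<and> odd (order F)"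
  proof -
    \<comment> \<open>The field with three elements ensures that there is a record to choose even if
      no counterexample exists.\<close>
    interpret residues_prime 3 "residue_ring 3" by unfold_locales simp_all
    have "card {0..2 :: int} = 3" by simp
    thus ?thesis using is_field
      by (intro exI[of _ "residue_ring 3"]) (simp add: Coset.order_def residue_ring_def)
  qed
  hence "\<exists>F :: int ring. field F \<and> finite (carrier F) \<and> odd (order F) \<and>
     (growth_bounds F \<longrightarrow> (\<forall>F' :: int ring. field F' \<and> finite (carrier F') \<and> odd (order F') \<longrightarrow> growth_bounds F'))"
    by blast
  from someI_ex[OF this, folded critical_field_def]
  show "field critical_field" "finite (carrier critical_field)" "odd (order critical_field)"
    "growth_bounds critical_field \<Longrightarrow>
      field F' \<Longrightarrow> finite (carrier F') \<Longrightarrow> odd (order F') \<Longrightarrow> growth_bounds (F' :: int ring)"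
    by blast+
qed

interpretation crit: cring critical_field
  using field_critical_field by (simp add: field_def domain_def)

lemma zero_neq_one_critical_field: "\<zero>\<^bsub>critical_field\<^esub> \<noteq> \<one>\<^bsub>critical_field\<^esub>"
  using domain.one_not_zero[of critical_field] field_critical_field by (auto simp: field_def)

lemma Units_critical_field: "Units critical_field = carrier critical_field - {\<zero>\<^bsub>critical_field\<^esub>}"
  by (rule field.field_Units[OF field_critical_field])

typedef critical = "carrier critical_field"
  using crit.zero_closed by blast

setup_lifting type_definition_critical

instantiation critical :: field
begin

lift_definition zero_critical :: critical is "\<zero>\<^bsub>critical_field\<^esub>" by simp
lift_definition one_critical :: critical is "\<one>\<^bsub>critical_field\<^esub>" by simp
lift_definition plus_critical :: "critical \<Rightarrow> critical \<Rightarrow> critical" is "add critical_field" by simp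
lift_definition minus_critical :: "critical \<Rightarrow> critical \<Rightarrow> critical" is "a_minus critical_field" by simp
lift_definition times_critical :: "critical \<Rightarrow> critical \<Rightarrow> critical" is "monoid.mult critical_field" by simp
lift_definition uminus_critical :: "critical \<Rightarrow> critical" is "a_inv critical_field" by simp
lift_definition inverse_critical :: "critical \<Rightarrow> critical"
  is "\<lambda>x. if x = \<zero>\<^bsub>critical_field\<^esub> then \<zero>\<^bsub>critical_field\<^esub> else m_inv critical_field x"
  by (auto simp: Units_critical_field)
definition divide_critical :: "critical \<Rightarrow> critical \<Rightarrow> critical" where
  "divide_critical x y = x * inverse y"

instance
proof
  fix a b c :: critical
  show "a * b * c = a * (b * c)" by transfer (rule crit.m_assoc)
  show "a * b = b * a" by transfer (rule crit.m_comm)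
  show "1 * a = a" by transfer (rule crit.l_one)
  show "a + b + c = a + (b + c)" by transfer (rule crit.a_assoc)
  show "a + b = b + a" by transfer (rule crit.a_comm)
  show "0 + a = a" by transfer (rule crit.l_zero)
  show "- a + a = 0" by transfer (rule crit.l_neg)
  show "a - b = a + - b" by transfer (simp add: a_minus_def)
  show "(a + b) * c = a * c + b * c" by transfer (rule crit.l_distr)
  show "(0 :: critical) \<noteq> 1" by transfer (rule zero_neq_one_critical_field)
  show "inverse a * a = 1" if "a \<noteq> 0" using that by transfer (simp add: Units_critical_field)
  show "a div b = a * inverse b" by (rule divide_critical_def)
  show "inverse (0 :: critical) = 0" by transfer simp
qed

end

lemma UNIV_critical: "(UNIV :: critical set) = Abs_critical ` carrier critical_field"
  by (rule type_definition.Abs_image[OF type_definition_critical, symmetric])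

instance critical :: finite_field
  by standard (simp add: UNIV_critical finite_critical_field)

lemma Rep_critical_iso: "Rep_critical \<in> ring_iso ring_of_type_algebra critical_field"
  using Rep_critical Rep_critical_inject type_definition.Rep_range[OF type_definition_critical]
  by (auto simp: ring_iso_def ring_hom_def bij_betw_def inj_on_def ring_of_type_algebra_def
      times_critical.rep_eq plus_critical.rep_eq one_critical.rep_eq)

text \<open>The bounds pass from the type \<open>critical\<close> to its record, by the choice of
  that record to every odd finite field on integers, and from an integer copy \<open>F'\<close> back
  to F. A finite carrier can always be copied into the integers.\<close>

theorem growth_bounds_finite_field:
  fixes F :: "'a ring"
  assumes F: "field F" and fin: "finite (carrier F)" and odd: "odd (order F)"
  shows "growth_bounds F"
proof -
  have "card (UNIV :: critical set) = order critical_field"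
    unfolding Coset.order_def type_definition.Rep_range[OF type_definition_critical, symmetric]
    by (rule card_image[symmetric]) (simp add: inj_on_def Rep_critical_inject)
  hence "growth_bounds (ring_of_type_algebra :: critical ring)"
    by (intro growth_bounds_type) (simp add: odd_critical_field)
  hence crit: "growth_bounds critical_field"
    by (rule growth_bounds_iso[OF ring_from_type_algebra crit.ring_axioms Rep_critical_iso])
  interpret F: field F by (rule F)
  obtain f :: "'a \<Rightarrow> nat" where "inj_on f (carrier F)"
    using finite_imp_inj_to_nat_seg[OF fin] by blast
  hence inj: "inj_on (int \<circ> f) (carrier F)" by (auto simp: inj_on_def)
  define F' where "F' = image_ring (int \<circ> f) F"
  have F': "field F'" unfolding F'_def by (rule F.inj_imp_image_ring_is_field[OF inj])
  have iso: "int \<circ> f \<in> ring_iso F F'" unfolding F'_def by (rule inj_imp_image_ring_iso[OF inj])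
  have carrier: "carrier F' = (int \<circ> f) ` carrier F" unfolding F'_def by (rule image_ring_carrier)
  have "finite (carrier F')" "odd (order F')"
    using fin odd card_image[OF inj] by (simp_all add: carrier Coset.order_def)
  hence "growth_bounds F'" using critical_field_critical[OF crit F'] by blast
  moreover have "ring F'" using F' by (simp add: field_def domain_def cring_def)
  ultimately show ?thesis
    using growth_bounds_iso[OF _ F.ring_axioms ring_iso_set_sym[OF F.ring_axioms iso]] by blast
qed

section \<open>The theorem\<close>

text \<open>Here e = |E|, m = |X_t| and P = |X_t X_t|. The assumption \<open>large\<close> makes the
  counting error at most half of the main term, so m is comparable to e^2 / q. The two entries of
  the minimum come from the two summands of the energy bound, according to which dominates: the
  first case gives the constant 4, the second gives 8.\<close>

lemma growth_from_bounds:
  fixes q e m P \<alpha> :: real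
  assumes \<alpha>: "3 / 2 < \<alpha>" and q: "q \<ge> 1" and large: "4 \<le> q powr (\<alpha> - 3 / 2)"
    and e: "e = q powr \<alpha>"
    and count: "\<bar>m - e ^ 2 / q\<bar> \<le> 2 * sqrt q * e"
    and energy: "m ^ 4 \<le> P * (m ^ 3 * e / q\<^sup>2 + q\<^sup>2 * m ^ 2)" and P: "P \<ge> 0"
  shows "min (q * e) (e ^ 4 / q ^ 4) \<le> 8 * P" and "0 < m" and "m \<le> 2 * q powr (2 * \<alpha> - 1)"
proof -
  have e0: "e > 0" using q e by simp
  have sqrt_q: "sqrt q = q powr (1 / 2)" using q by (simp add: powr_half_sqrt)
  have e_q: "e = q powr (\<alpha> - 3 / 2) * sqrt q * q"
  proof -
    have "e = q powr ((\<alpha> - 3 / 2) + 1 / 2 + 1)" by (simp add: e)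
    also have "\<dots> = q powr (\<alpha> - 3 / 2) * q powr (1 / 2) * q powr 1" by (simp only: powr_add)
    finally show ?thesis using q by (simp add: sqrt_q)
  qed
  have "4 * (sqrt q * q) \<le> e"
    unfolding e_q mult.assoc using large q by (intro mult_right_mono) auto
  hence "4 * (sqrt q * q) * e \<le> e * e" using e0 by (intro mult_right_mono) auto
  hence err: "2 * sqrt q * e \<le> e ^ 2 / q / 2"
    using q by (simp add: field_simps power2_eq_square)
  have lower: "e ^ 2 / q / 2 \<le> m" and upper: "m \<le> 2 * (e ^ 2 / q)"
    using count err e0 q unfolding abs_le_iff by (simp_all add: field_simps)
  have "e ^ 2 / q / 2 > 0" using e0 q by simp
  thus m0: "m > 0" using lower by linarith
  have "e ^ 2 / q = q powr (2 * \<alpha> - 1)"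
    using q by (simp add: e powr_diff powr_power mult.commute)
  thus "m \<le> 2 * q powr (2 * \<alpha> - 1)" using upper by simp
  have "m\<^sup>2 * m\<^sup>2 \<le> m\<^sup>2 * (P * (m * e / q\<^sup>2 + q\<^sup>2))"
    using energy by (simp add: algebra_simps power2_eq_square power3_eq_cube power4_eq_xxxx)
  hence main: "m\<^sup>2 \<le> P * (m * e / q\<^sup>2 + q\<^sup>2)" by (rule mult_left_le_imp_le) (use m0 in simp)
  show "min (q * e) (e ^ 4 / q ^ 4) \<le> 8 * P"
  proof (cases "q\<^sup>2 \<le> m * e / q\<^sup>2")
    case True
    define w where "w = m * e / q\<^sup>2"
    have "P * (w + q\<^sup>2) \<le> P * (2 * w)"
      using P by (rule mult_left_mono[rotated]) (use True in \<open>simp add: w_def[symmetric]\<close>)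
    with main have "m\<^sup>2 \<le> P * (2 * (m * e / q\<^sup>2))" unfolding w_def by (rule order.trans)
    hence "m * (m * q\<^sup>2) \<le> m * (2 * P * e)" using q by (simp add: field_simps power2_eq_square)
    hence "m * q\<^sup>2 \<le> 2 * P * e" by (rule mult_left_le_imp_le) (rule m0)
    moreover have "e ^ 2 / q / 2 * q\<^sup>2 \<le> m * q\<^sup>2" using lower by (intro mult_right_mono) auto
    moreover have "e ^ 2 / q / 2 * q\<^sup>2 = e * (q * e) / 2" using q by (simp add: field_simps power2_eq_square)
    ultimately have "e * (q * e) \<le> e * (4 * P)" by (simp add: algebra_simps)
    hence "q * e \<le> 4 * P" by (rule mult_left_le_imp_le) (rule e0)
    thus ?thesis using P by linarith
  next
    case False
    have "m\<^sup>2 \<le> P * (2 * q\<^sup>2)"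
      using main False P mult_left_mono[of "m * e / q\<^sup>2 + q\<^sup>2" "2 * q\<^sup>2" P] by linarith
    moreover have "(e ^ 2 / q / 2)\<^sup>2 \<le> m\<^sup>2" using lower e0 q by (intro power_mono) auto
    ultimately have "(e ^ 2 / q / 2)\<^sup>2 \<le> P * (2 * q\<^sup>2)" by linarith
    hence "e ^ 4 \<le> 8 * P * q ^ 4"
      using q by (simp add: field_simps power2_eq_square power4_eq_xxxx)
    hence "e ^ 4 / q ^ 4 \<le> 8 * P" using q by (simp add: field_simps)
    thus ?thesis by linarith
  qed
qed

theorem theorem9:
  fixes \<alpha> :: real
  assumes "3 / 2 < \<alpha>" and "\<alpha> < 2"
  shows "\<exists>\<delta>>0. \<exists>c>0. \<exists>c'>0. \<exists>q0::nat. \<forall>(F :: 'a ring) E t u0 v0.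
           field F \<and> finite (carrier F) \<and> odd (order F) \<and> q0 \<le> order F \<and>
           E \<subseteq> plane F \<and> real (card E) = real (order F) powr \<alpha> \<and>
           t \<in> carrier F - {\<zero>\<^bsub>F\<^esub>} \<and> u0 \<in> E \<and> v0 \<in> E \<and> qdist F u0 v0 = t \<longrightarrow>
           (let q = real (order F);
                Xt = motion_set F E t u0 v0;
                XtXt = Xt <#>\<^bsub>rigid_motions F\<^esub> Xt
            in real (card XtXt) \<ge> c * real (card Xt) powr (1 + \<delta>) \<and>
               real (card XtXt) \<ge> c' * min (q * real (card E)) (real (card E) ^ 4 / q ^ 4))"
proof -
  \<comment> \<open>For |E| = q^\<alpha> the minimum is q^\<beta>, while |X_t| is at most 2 q^(2
    \<alpha> - 1). So \<delta> is chosen to make (2 \<alpha> - 1)(1 + \<delta>) = \<beta>; it is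
    positive because both entries of \<beta> exceed 2 \<alpha> - 1.\<close>
  define \<beta> where "\<beta> = min (1 + \<alpha>) (4 * \<alpha> - 4)"
  define \<delta> where "\<delta> = \<beta> / (2 * \<alpha> - 1) - 1"
  have \<beta>: "\<beta> > 2 * \<alpha> - 1" using assms by (simp add: \<beta>_def)
  hence \<delta>: "\<delta> > 0" using assms by (simp add: \<delta>_def field_simps)
  have \<beta>_eq: "(2 * \<alpha> - 1) * (1 + \<delta>) = \<beta>" using assms by (simp add: \<delta>_def)
  \<comment> \<open>The 8 is the constant of the minimum bound; the power of 2 absorbs the factor 2
    in the upper bound for |X_t|.\<close>
  define c where "c = 1 / (8 * 2 powr (1 + \<delta>))"
  \<comment> \<open>From this size on q^(\<alpha> - 3/2) \<ge> 4, as
    \<open>growth_from_bounds\<close> demands.\<close>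
  obtain q0 :: nat where q0: "4 powr (1 / (\<alpha> - 3 / 2)) \<le> real q0" using real_arch_simple by blast
  have main: "c * real (card Xt) powr (1 + \<delta>) \<le> real (card XtXt) \<and>
      1 / 8 * min (q * real (card E)) (real (card E) ^ 4 / q ^ 4) \<le> real (card XtXt)"
    if F: "field F" "finite (carrier F)" "odd (order F)" and q0': "q0 \<le> order F"
      and E: "E \<subseteq> plane F" "real (card E) = real (order F) powr \<alpha>"
      and t: "t \<in> carrier F - {\<zero>\<^bsub>F\<^esub>}" "u0 \<in> E" "v0 \<in> E" "qdist F u0 v0 = t"
      and defs: "q = real (order F)" "Xt = motion_set F E t u0 v0" "XtXt = Xt <#>\<^bsub>rigid_motions F\<^esub> Xt"
    for F :: "'a ring" and E t u0 v0 q Xt XtXt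
  proof -
    have "order F > 0" using F(3) by (rule odd_pos)
    hence q1: "q \<ge> 1" by (simp add: defs)
    have "4 = (4 powr (1 / (\<alpha> - 3 / 2))) powr (\<alpha> - 3 / 2)" using assms by (simp add: powr_powr)
    also have "\<dots> \<le> q powr (\<alpha> - 3 / 2)"
      using assms q0 q0' by (intro powr_mono2) (auto simp: defs)
    finally have large: "4 \<le> q powr (\<alpha> - 3 / 2)" .
    have Eq: "real (card E) = q powr \<alpha>" using E(2) by (simp add: defs)
    have "\<bar>real (card Xt) - real (card E) ^ 2 / q\<bar> \<le> 2 * sqrt q * card E"
      "real (card Xt) ^ 4 \<le> card XtXt * (real (card Xt) ^ 3 * card E / q\<^sup>2 + q\<^sup>2 * real (card Xt) ^ 2)"
      using growth_bounds_finite_field[OF F, unfolded growth_bounds_def, rule_format, of E t u0 v0] E t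
      by (simp_all add: defs Let_def)
    note bounds = growth_from_bounds[OF assms(1) q1 large Eq this of_nat_0_le_iff]
    have "real (card Xt) powr (1 + \<delta>) \<le> (2 * q powr (2 * \<alpha> - 1)) powr (1 + \<delta>)"
      using bounds(2,3) \<delta> by (intro powr_mono2) auto
    also have "\<dots> = 2 powr (1 + \<delta>) * q powr \<beta>"
      using q1 by (simp add: powr_mult powr_powr \<beta>_eq)
    finally have "c * real (card Xt) powr (1 + \<delta>) \<le> c * (2 powr (1 + \<delta>) * q powr \<beta>)"
      by (rule mult_left_mono) (simp add: c_def)
    hence "c * real (card Xt) powr (1 + \<delta>) \<le> 1 / 8 * q powr \<beta>" by (simp add: c_def)
    moreover have "q powr \<beta> \<le> min (q * real (card E)) (real (card E) ^ 4 / q ^ 4)"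
    proof -
      have "q * real (card E) = q powr (1 + \<alpha>)" using q1 by (simp add: Eq powr_mult_base)
      moreover have "real (card E) ^ 4 / q ^ 4 = q powr (4 * \<alpha> - 4)"
        using q1 by (simp add: Eq powr_diff powr_power mult.commute powr_numeral)
      ultimately show ?thesis using q1 by (auto simp: \<beta>_def intro!: powr_mono)
    qed
    ultimately show ?thesis using bounds(1) by linarith
  qed
  have "c > 0" by (simp add: c_def)
  show ?thesis
    unfolding Let_def
  proof (intro exI conjI allI impI)
    show "\<delta> > 0" "c > 0" by fact+
    show "(1 / 8 :: real) > 0" by simp
  next
    fix F :: "'a ring" and E t u0 v0
    assume "field F \<and> finite (carrier F) \<and> odd (order F) \<and> q0 \<le> order F \<and>
      E \<subseteq> plane F \<and> real (card E) = real (order F) powr \<alpha> \<and>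
      t \<in> carrier F - {\<zero>\<^bsub>F\<^esub>} \<and> u0 \<in> E \<and> v0 \<in> E \<and> qdist F u0 v0 = t"
    note main[OF _ _ _ _ _ _ _ _ _ _ refl refl refl, of F E t u0 v0]
    with \<open>field F \<and> _\<close>
    show "c * real (card (motion_set F E t u0 v0)) powr (1 + \<delta>)
        \<le> real (card (motion_set F E t u0 v0 <#>\<^bsub>rigid_motions F\<^esub> motion_set F E t u0 v0))"
      "1 / 8 * min (real (order F) * real (card E)) (real (card E) ^ 4 / real (order F) ^ 4)
        \<le> real (card (motion_set F E t u0 v0 <#>\<^bsub>rigid_motions F\<^esub> motion_set F E t u0 v0))"
      by blast+
  qed
qed

end
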